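(* Let $K\ge2$ be even and let $Q(x)=\sum_{k=0}^Kq_kx^k$ be a polynomial with real coefficients and $q_K>0$. Let $v\in C^K(\mathbb{R})\cap L^\infty(\mathbb{R})$ satisfy $v(\xi)>0$ and $|v'(\xi)|\le Cv(\xi)$ for all $\xi\in\mathbb{R}$ and some constant $C$. Let $A$ be the self-adjoint operator $A=vQ(D)v$ in $L^2(\mathbb{R})$, $D=i\,d/d\xi$. Then the operator $A$ is positive (that is, $A\ge0$) if and only if $Q(x)\ge0$ for all $x\in\mathbb{R}$. Moreover, if $Q(x_0)<0$ for some $x_0\in\mathbb{R}$, then the negative spectrum of $A$ is infinite.
   Context: The symmetric operator $A_0$ in $L^2(\mathbb{R})$ is defined on the domain $C_0^K(\mathbb{R})$ ($K$ times continuously differentiable functions with compact support) by $A_0g=vQ(D)(vg)$. Under the stated conditions on $v$ it is essentially self-adjoint, and $A$ denotes its closure; $\mathcal{D}(A)$ consists of all $g\in L^2(\mathbb{R})$ such that $vQ(D)(vg)$, understood in the sense of distributions, belongs to $L^2(\mathbb{R})$, and $Ag=vQ(D)(vg)$. *)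

theory Defs
  imports "HOL-Analysis.Analysis" "HOL-Computational_Algebra.Polynomial"
begin

definition C_k :: "nat \<Rightarrow> (real \<Rightarrow> 'a::real_normed_vector) \<Rightarrow> bool" where
  "C_k K f \<longleftrightarrow>
     (\<forall>k<K. \<forall>x. ((\<lambda>h y. vector_derivative h (at y)) ^^ k) f differentiable (at x)) \<and>
     continuous_on UNIV (((\<lambda>h y. vector_derivative h (at y)) ^^ K) f)"

definition C0_k :: "nat \<Rightarrow> (real \<Rightarrow> complex) set" where
  "C0_k K = {g. C_k K g \<and> compact (closure {x. g x \<noteq> 0})}"

text \<open>
  Elements of $L^2$ are represented by functions, so that equality in $L^2$ is equality almost
  everywhere, i.e. \<open>L2_norm (f - g) = 0\<close>. The definitions of \<open>L2_inner\<close> and \<open>L2_norm\<close>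
  are meaningful only for arguments in \<open>L2\<close> (a Bochner integral of a non-integrable function
  is 0); they are applied only to linear combinations of elements of \<open>L2\<close>.
\<close>

definition L2 :: "(real \<Rightarrow> complex) set" where
  "L2 = {f \<in> borel_measurable lborel. integrable lborel (\<lambda>x. (cmod (f x))\<^sup>2)}"

definition L2_inner :: "(real \<Rightarrow> complex) \<Rightarrow> (real \<Rightarrow> complex) \<Rightarrow> complex" where
  "L2_inner f g = (LINT x|lborel. f x * cnj (g x))"

definition L2_norm :: "(real \<Rightarrow> complex) \<Rightarrow> real" where
  "L2_norm f = sqrt (LINT x|lborel. (cmod (f x))\<^sup>2)"

text \<open>
  An unbounded operator in $L^2$ is given by its graph: a set of pairs \<open>(g, h)\<close> of elements of
  \<open>L2\<close>, where \<open>g\<close> represents an element of the domain and \<open>h\<close> its image.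
\<close>

type_synonym L2_operator = "((real \<Rightarrow> complex) \<times> (real \<Rightarrow> complex)) set"

definition op_closure :: "L2_operator \<Rightarrow> L2_operator" where
  "op_closure T = {(g, h). g \<in> L2 \<and> h \<in> L2 \<and>
     (\<exists>u w. (\<forall>n::nat. (u n, w n) \<in> T) \<and>
        (\<lambda>n. L2_norm (\<lambda>x. u n x - g x)) \<longlonglongrightarrow> 0 \<and>
        (\<lambda>n. L2_norm (\<lambda>x. w n x - h x)) \<longlonglongrightarrow> 0)}"

definition op_positive :: "L2_operator \<Rightarrow> bool" where
  "op_positive T \<longleftrightarrow> (\<forall>(g, h)\<in>T. L2_inner h g \<in> \<real>\<^sub>\<ge>\<^sub>0)"

text \<open>
  \<open>T - z\<close> is surjective onto $L^2$, and the estimate says at once that it is injective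
  (modulo null sets) and that its inverse is bounded.
\<close>

definition op_resolvent_set :: "L2_operator \<Rightarrow> complex set" where
  "op_resolvent_set T = {z.
     (\<forall>f\<in>L2. \<exists>(g, h)\<in>T. AE x in lborel. h x - z * g x = f x) \<and>
     (\<exists>B. \<forall>(g, h)\<in>T. L2_norm g \<le> B * L2_norm (\<lambda>x. h x - z * g x))}"

definition op_spectrum :: "L2_operator \<Rightarrow> complex set" where
  "op_spectrum T = - op_resolvent_set T"

definition D :: "(real \<Rightarrow> complex) \<Rightarrow> real \<Rightarrow> complex" where
  "D f = (\<lambda>\<xi>. \<i> * vector_derivative f (at \<xi>))"

definition poly_D :: "real poly \<Rightarrow> (real \<Rightarrow> complex) \<Rightarrow> real \<Rightarrow> complex" where
  "poly_D Q f = (\<lambda>\<xi>. \<Sum>k\<le>degree Q. of_real (coeff Q k) * (D ^^ k) f \<xi>)"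

definition A0 :: "(real \<Rightarrow> real) \<Rightarrow> real poly \<Rightarrow> L2_operator" where
  "A0 v Q = {(g, h). g \<in> C0_k (degree Q) \<and>
     h = (\<lambda>\<xi>. of_real (v \<xi>) * poly_D Q (\<lambda>\<eta>. of_real (v \<eta>) * g \<eta>) \<xi>)}"

text \<open>
  The operator $A = v Q(D) v$ is the closure of the essentially self-adjoint \<open>A0\<close>.
\<close>

definition A :: "(real \<Rightarrow> real) \<Rightarrow> real poly \<Rightarrow> L2_operator" where
  "A v Q = op_closure (A0 v Q)"

end

theory Submission
  imports Defs "HOL-Computational_Algebra.Fundamental_Theorem_Algebra"
begin

text \<open>
  Write \<open>B g = v Q(D)(v g)\<close> for test functions \<open>g\<close>, that is, functions of class \<open>C\<^sup>K\<close> with compact support; \<open>A\<close> is the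
  closure of \<open>B\<close>. With \<open>w = v g\<close> one has \<open>\<langle>B g, g\<rangle> = \<langle>Q(D) w, w\<rangle>\<close>, and \<open>g \<mapsto> v g\<close> is a bijection of the space of test
  functions, so the sign of the form depends on \<open>Q\<close> only.

  If \<open>Q \<ge> 0\<close>, then \<open>Q = p\<^sup>2 + r\<^sup>2\<close> with real polynomials \<open>p\<close> and \<open>r\<close> (\<open>nonneg_poly_sum_of_squares\<close>), and the form equals
  \<open>|p(D) w|\<^sup>2 + |r(D) w|\<^sup>2\<close>; positivity passes to the closure. If \<open>Q(x0) < 0\<close>, a plane wave \<open>exp(-\<i> x0 x)\<close> modulated by a
  wide bump \<open>\<phi>(\<epsilon> x - 2 j)\<close> has form value \<open>(Q(x0) |\<phi>|\<^sup>2 + O(\<epsilon>)) / \<epsilon>\<close>. For varying \<open>j\<close> the supports are disjoint, so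
  \<open>B\<close> is negative on the infinite-dimensional span \<open>N\<close> of these packets (\<open>negative_wave_packets\<close>).

  An infinite-dimensional negative subspace alone would be compatible with a single negative eigenvalue of infinite
  multiplicity. What excludes this is that \<open>(B - l) g = f\<close> is an ordinary differential equation of order \<open>K\<close>. Among any
  \<open>K + 1\<close> right-hand sides supported in \<open>[a, b]\<close> there is a nontrivial combination for which the equation has a solution
  supported in \<open>[a, b]\<close>: solve with zero data at \<open>a\<close> and impose the \<open>K\<close> conditions at \<open>b\<close>
  (\<open>compactly_supported_solution\<close>). Applying this to blocks of packets, and iterating, shows that for any finite set of
  reals \<open>\<Lambda> 0, \<dots>, \<Lambda> (m - 1)\<close> some \<open>h\<close> in \<open>N\<close>, other than the zero function, has the form \<open>h = \<Prod>\<^sub>k (B - \<Lambda> k) g\<close> with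
  test functions at every stage (\<open>shifted_prod_range_meets_span\<close>).

  Suppose now that the negative spectrum consists of \<open>\<Lambda> 0 < \<dots> < \<Lambda> (m - 1)\<close>, and put \<open>\<Lambda> m = 0\<close>. A symmetric operator
  whose spectrum has no point in an interval \<open>(c - r, c + r)\<close> satisfies \<open>|(T - c) g| \<ge> r |g|\<close>
  (\<open>resolvent_gap_estimate\<close>). Hence \<open>(B - \<Lambda> k)(B - \<Lambda> (k + 1)) \<ge> 0\<close> for all \<open>k < m\<close>, and \<open>B - \<Lambda> 0 \<ge> 0\<close>. These
  inequalities imply algebraically that \<open>B \<Prod>\<^sub>k (B - \<Lambda> k)\<^sup>2 \<ge> 0\<close> (\<open>shifted_prod_form_nonneg\<close>), that is,
  \<open>\<langle>B h, h\<rangle> \<ge> 0\<close> for the \<open>h\<close> above, contrary to \<open>h\<close> being a nonzero element of \<open>N\<close>.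
\<close>

section \<open>Differentiable functions and the operator D\<close>

lemma C_k_0: "C_k 0 f \<longleftrightarrow> continuous_on UNIV f"
  by (simp add: C_k_def)

text \<open>
  Peels the innermost derivative off the iterate, so that statements about \<open>C_k\<close> can be proved by induction with the function varying.
\<close>
lemma C_k_Suc:
  "C_k (Suc n) f \<longleftrightarrow> (\<forall>x. f differentiable (at x)) \<and> C_k n (\<lambda>y. vector_derivative f (at y))"
  unfolding C_k_def by (simp add: All_less_Suc2 funpow_swap1 del: funpow.simps add: funpow_Suc_right)

lemma C_k_SucI:
  assumes "\<And>x. (f has_vector_derivative f' x) (at x)" and "C_k n f'"
  shows "C_k (Suc n) f"
proof -
  have "(\<lambda>y. vector_derivative f (at y)) = f'"
    using assms(1) by (simp add: fun_eq_iff vector_derivative_at)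
  with assms show ?thesis
    by (auto simp: C_k_Suc has_vector_derivative_def differentiable_def)
qed

lemma C_k_SucD:
  assumes "C_k (Suc n) f"
  shows "(f has_vector_derivative vector_derivative f (at x)) (at x)"
  using assms by (simp add: C_k_Suc vector_derivative_works)

lemma C_k_continuous: "C_k n f \<Longrightarrow> continuous_on UNIV f"
  by (cases n) (auto simp: C_k_0 C_k_Suc continuous_on_eq_continuous_at differentiable_imp_continuous_within)

lemma C_k_mono: "C_k n f \<Longrightarrow> m \<le> n \<Longrightarrow> C_k m f"
proof (induction m arbitrary: n f)
  case 0
  then show ?case by (simp add: C_k_0 C_k_continuous)
next
  case (Suc m)
  then obtain n' where "n = Suc n'" by (cases n) auto
  with Suc show ?case by (auto simp: C_k_Suc)
qed

lemma C_k_const: "C_k n (\<lambda>_. c)"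
proof (induction n arbitrary: c)
  case 0
  then show ?case by (simp add: C_k_0)
next
  case (Suc n)
  show ?case by (rule C_k_SucI[OF _ Suc[of 0]]) (auto intro!: derivative_eq_intros)
qed

lemma C_k_add: "C_k n f \<Longrightarrow> C_k n g \<Longrightarrow> C_k n (\<lambda>x. f x + g x)"
proof (induction n arbitrary: f g)
  case 0
  then show ?case by (auto simp: C_k_0 intro: continuous_intros)
next
  case (Suc n)
  show ?case
    by (rule C_k_SucI[OF has_vector_derivative_add[OF C_k_SucD[OF Suc(2)] C_k_SucD[OF Suc(3)]]])
       (use Suc in \<open>auto simp: C_k_Suc\<close>)
qed

lemma C_k_mult:
  fixes f g :: "real \<Rightarrow> 'a::real_normed_algebra"
  shows "C_k n f \<Longrightarrow> C_k n g \<Longrightarrow> C_k n (\<lambda>x. f x * g x)"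
proof (induction n arbitrary: f g)
  case 0
  then show ?case by (auto simp: C_k_0 intro: continuous_intros)
next
  case (Suc n)
  have "C_k n f" "C_k n g" using Suc C_k_mono[OF _ le_SucI[OF order_refl]] by blast+
  moreover have "C_k n (\<lambda>x. vector_derivative f (at x))" "C_k n (\<lambda>x. vector_derivative g (at x))"
    using Suc by (auto simp: C_k_Suc)
  ultimately show ?case
    by (intro C_k_SucI[OF has_vector_derivative_mult[OF C_k_SucD[OF Suc(2)] C_k_SucD[OF Suc(3)]]]
          C_k_add Suc.IH)
qed

lemma C_k_of_real:
  assumes "C_k n (f :: real \<Rightarrow> real)"
  shows "C_k n (\<lambda>x. of_real (f x) :: 'a::real_normed_algebra_1)"
  using assms
proof (induction n arbitrary: f)
  case 0
  then show ?case by (auto simp: C_k_0 intro: continuous_intros)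
next
  case (Suc n)
  show ?case
    by (rule C_k_SucI[OF has_vector_derivative_of_real[OF
            C_k_SucD[OF Suc(2), unfolded has_real_derivative_iff_has_vector_derivative[symmetric]]]])
       (use Suc in \<open>auto simp: C_k_Suc\<close>)
qed

text \<open>
  Induction works because the derivative of \<open>1/f\<close> is \<open>-f' \<cdot> (1/f) \<cdot> (1/f)\<close>: one order for \<open>1/f\<close> yields the next.
\<close>
lemma C_k_inverse:
  fixes f :: "real \<Rightarrow> real"
  assumes "C_k n f" and nz: "\<And>x. f x \<noteq> 0"
  shows "C_k n (\<lambda>x. inverse (f x))"
  using assms(1)
proof (induction n)
  case 0
  then show ?case using nz by (auto simp: C_k_0 intro: continuous_intros)
next
  case (Suc n)
  have d: "((\<lambda>x. inverse (f x)) has_vector_derivative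
      ((- 1) * vector_derivative f (at x)) * (inverse (f x) * inverse (f x))) (at x)" for x
    using C_k_SucD[OF Suc.prems, of x] nz[of x]
    unfolding has_real_derivative_iff_has_vector_derivative[symmetric]
    by (auto intro!: derivative_eq_intros simp: field_simps power2_eq_square)
  have "C_k n (\<lambda>x. inverse (f x))" using Suc C_k_mono[OF _ le_SucI[OF order_refl]] by blast
  then show ?case using Suc.prems
    by (intro C_k_SucI[OF d] C_k_mult C_k_const) (auto simp: C_k_Suc)
qed

lemma C_k_sum:
  "finite I \<Longrightarrow> (\<And>i. i \<in> I \<Longrightarrow> C_k n (f i)) \<Longrightarrow> C_k n (\<lambda>x. \<Sum>i\<in>I. f i x)"
  by (induction I rule: finite_induct) (auto intro: C_k_const C_k_add)

lemma C_k_affine: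
  fixes f :: "real \<Rightarrow> complex"
  shows "C_k n f \<Longrightarrow> C_k n (\<lambda>x. f (t + c * x))"
proof (induction n arbitrary: f)
  case 0
  then show ?case by (auto simp: C_k_0 intro!: continuous_on_compose2[of UNIV f] continuous_intros)
next
  case (Suc n)
  have "((\<lambda>x. f (t + c * x)) has_vector_derivative
      of_real c * vector_derivative f (at (t + c * x))) (at x)" for x
  proof -
    have "((\<lambda>x. t + c * x) has_vector_derivative c) (at x)"
      unfolding has_real_derivative_iff_has_vector_derivative[symmetric]
      by (auto intro!: derivative_eq_intros)
    from vector_diff_chain_at[OF this C_k_SucD[OF Suc(2)]] show ?thesis
      by (simp add: o_def scaleR_conv_of_real)
  qed
  then show ?case
    by (rule C_k_SucI) (use Suc in \<open>auto simp: C_k_Suc intro!: C_k_mult C_k_const\<close>)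
qed

lemma has_vector_derivative_D:
  assumes "C_k (Suc n) f"
  shows "(f has_vector_derivative - \<i> * D f x) (at x)"
  using C_k_SucD[OF assms, of x] by (simp add: D_def mult.assoc[symmetric])

lemma D_eqI: "(f has_vector_derivative f') (at x) \<Longrightarrow> D f x = \<i> * f'"
  by (simp add: D_def vector_derivative_at)

lemma C_k_D: "C_k (Suc n) f \<Longrightarrow> C_k n (D f)"
  unfolding D_def by (auto simp: C_k_Suc intro!: C_k_mult C_k_const)

lemma C_k_D_pow: "C_k n f \<Longrightarrow> k \<le> n \<Longrightarrow> C_k (n - k) ((D ^^ k) f)"
proof (induction k arbitrary: n f)
  case (Suc k)
  then obtain n' where "n = Suc n'" by (cases n) auto
  with Suc C_k_D[of n' f] show ?case by (simp add: funpow_swap1)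
qed auto

lemma D_pow_lincomb:
  "C_k n f \<Longrightarrow> C_k n g \<Longrightarrow> k \<le> n \<Longrightarrow>
    (D ^^ k) (\<lambda>x. a * f x + b * g x) x = a * (D ^^ k) f x + b * (D ^^ k) g x"
proof (induction k arbitrary: n f g)
  case (Suc k)
  then obtain n' where n: "n = Suc n'" by (cases n) auto
  have "D (\<lambda>x. a * f x + b * g x) = (\<lambda>x. a * D f x + b * D g x)"
  proof
    fix x
    have "((\<lambda>x. a * f x + b * g x) has_vector_derivative (a * (- \<i> * D f x) + b * (- \<i> * D g x))) (at x)"
      using Suc.prems unfolding n
      by (intro has_vector_derivative_add has_vector_derivative_mult_right has_vector_derivative_D)
    from D_eqI[OF this] show "D (\<lambda>x. a * f x + b * g x) x = a * D f x + b * D g x"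
      by (simp add: algebra_simps)
  qed
  then show ?case
    using Suc.IH[of n' "D f" "D g"] Suc.prems C_k_D[of n'] unfolding n by (simp add: funpow_swap1)
qed auto

lemma poly_D_altdef:
  "degree Q \<le> n \<Longrightarrow> poly_D Q f x = (\<Sum>k\<le>n. of_real (coeff Q k) * (D ^^ k) f x)"
  unfolding poly_D_def by (rule sum.mono_neutral_left) (auto simp: coeff_eq_0)

lemma continuous_D_pow: "C_k n f \<Longrightarrow> k \<le> n \<Longrightarrow> continuous_on UNIV ((D ^^ k) f)"
  by (rule C_k_continuous[OF C_k_D_pow])

lemma continuous_poly_D: "C_k (degree Q) f \<Longrightarrow> continuous_on UNIV (poly_D Q f)"
  unfolding poly_D_def by (intro continuous_intros continuous_D_pow) auto

lemma poly_D_lincomb: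
  assumes "C_k (degree Q) f" "C_k (degree Q) g"
  shows "poly_D Q (\<lambda>x. a * f x + b * g x) x = a * poly_D Q f x + b * poly_D Q g x"
  unfolding poly_D_def
  by (simp add: D_pow_lincomb[OF assms] sum_distrib_left sum.distrib[symmetric] algebra_simps)

lemma D_pow_outside:
  assumes "\<And>x. x \<notin> {a..b} \<Longrightarrow> f x = 0" and "x \<notin> {a..b}"
  shows "(D ^^ k) f x = 0"
  using assms
proof (induction k arbitrary: f x)
  case (Suc k)
  have "D f y = 0" if "y \<notin> {a..b}" for y
  proof -
    have "((\<lambda>_. 0) has_vector_derivative 0) (at y)" by (rule has_vector_derivative_const)
    then have "(f has_vector_derivative 0) (at y)"
      by (rule has_vector_derivative_transform_within_open[of _ _ _ "- {a..b}"])
         (use that Suc.prems in auto)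
    then show ?thesis by (simp add: D_eqI)
  qed
  with Suc.IH[of "D f" x] Suc.prems show ?case by (simp add: funpow_swap1)
qed auto

lemma poly_D_outside:
  assumes "\<And>x. x \<notin> {a..b} \<Longrightarrow> f x = 0" and "x \<notin> {a..b}"
  shows "poly_D Q f x = 0"
  unfolding poly_D_def using D_pow_outside[OF assms] by simp

section \<open>Square-integrable functions and symmetric operators\<close>

lemma L2_measurable: "f \<in> L2 \<Longrightarrow> f \<in> borel_measurable lborel"
  and L2_sq_integrable: "f \<in> L2 \<Longrightarrow> integrable lborel (\<lambda>x. (cmod (f x))\<^sup>2)"
  by (auto simp: L2_def)

lemma L2_mult_integrable:
  assumes "f \<in> L2" "g \<in> L2"
  shows "integrable lborel (\<lambda>x. f x * cnj (g x))"
proof (rule Bochner_Integration.integrable_bound)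
  show "integrable lborel (\<lambda>x. (cmod (f x))\<^sup>2 + (cmod (g x))\<^sup>2)"
    using assms by (intro Bochner_Integration.integrable_add L2_sq_integrable)
  show "(\<lambda>x. f x * cnj (g x)) \<in> borel_measurable lborel"
  proof -
    have "cnj \<in> borel_measurable borel"
      by (intro borel_measurable_continuous_onI continuous_intros)
    from measurable_compose[OF L2_measurable[OF assms(2)] this]
    show ?thesis using L2_measurable[OF assms(1)] by (intro borel_measurable_times)
  qed
  have "a * b \<le> a\<^sup>2 + b\<^sup>2" if "a \<ge> 0" "b \<ge> 0" for a b :: real
  proof -
    have "2 * (a * b) \<le> a\<^sup>2 + b\<^sup>2" using sum_squares_bound[of a b] by simp
    moreover have "0 \<le> a * b" using that by simp
    ultimately show ?thesis by linarith
  qed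
  then show "AE x in lborel. norm (f x * cnj (g x)) \<le> norm ((cmod (f x))\<^sup>2 + (cmod (g x))\<^sup>2)"
    by (simp add: norm_mult)
qed

lemma L2_lincomb:
  assumes "f \<in> L2" "g \<in> L2"
  shows "(\<lambda>x. a * f x + b * g x) \<in> L2"
proof -
  have [measurable]: "f \<in> borel_measurable lborel" "g \<in> borel_measurable lborel"
    using assms[THEN L2_measurable] .
  have "integrable lborel (\<lambda>x. (cmod (a * f x + b * g x))\<^sup>2)"
  proof (rule Bochner_Integration.integrable_bound)
    show "integrable lborel (\<lambda>x. 2 * (cmod a)\<^sup>2 * (cmod (f x))\<^sup>2 + 2 * (cmod b)\<^sup>2 * (cmod (g x))\<^sup>2)"
      using assms by (intro Bochner_Integration.integrable_add integrable_mult_right L2_sq_integrable)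
    have "(cmod (a * f x + b * g x))\<^sup>2 \<le> 2 * (cmod a)\<^sup>2 * (cmod (f x))\<^sup>2 + 2 * (cmod b)\<^sup>2 * (cmod (g x))\<^sup>2" for x
    proof -
      have "(cmod (a * f x + b * g x))\<^sup>2 \<le> (cmod (a * f x) + cmod (b * g x))\<^sup>2"
        by (intro power_mono norm_triangle_ineq) auto
      also have "\<dots> \<le> 2 * (cmod (a * f x))\<^sup>2 + 2 * (cmod (b * g x))\<^sup>2"
        using sum_squares_bound[of "cmod (a * f x)" "cmod (b * g x)"] by (simp add: power2_sum)
      finally show ?thesis by (simp add: norm_mult power_mult_distrib)
    qed
    then show "AE x in lborel. norm ((cmod (a * f x + b * g x))\<^sup>2) \<le>
        norm (2 * (cmod a)\<^sup>2 * (cmod (f x))\<^sup>2 + 2 * (cmod b)\<^sup>2 * (cmod (g x))\<^sup>2)" by simp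
  qed measurable
  then show ?thesis by (simp add: L2_def)
qed

lemma L2_diff: "f \<in> L2 \<Longrightarrow> g \<in> L2 \<Longrightarrow> (\<lambda>x. f x - g x) \<in> L2"
  using L2_lincomb[of f g 1 "-1"] by simp

lemma L2_diff_cmult: "f \<in> L2 \<Longrightarrow> g \<in> L2 \<Longrightarrow> (\<lambda>x. f x - c * g x) \<in> L2"
  using L2_lincomb[of f g 1 "-c"] by simp

lemma L2_inner_commute: "L2_inner g f = cnj (L2_inner f g)"
  unfolding L2_inner_def by (subst Bochner_Integration.integral_cnj[symmetric]) (simp add: mult.commute)

lemma L2_inner_lincomb_left:
  assumes "f \<in> L2" "g \<in> L2" "h \<in> L2"
  shows "L2_inner (\<lambda>x. a * f x + b * g x) h = a * L2_inner f h + b * L2_inner g h"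
  unfolding L2_inner_def using assms
  by (simp add: distrib_right mult.assoc L2_mult_integrable)

lemma L2_inner_lincomb_right:
  assumes "f \<in> L2" "g \<in> L2" "h \<in> L2"
  shows "L2_inner h (\<lambda>x. a * f x + b * g x) = cnj a * L2_inner h f + cnj b * L2_inner h g"
  using L2_inner_lincomb_left[OF assms, of a b] L2_inner_commute[of h]
  by simp

lemma L2_norm_sq: "(L2_norm f)\<^sup>2 = Re (L2_inner f f)"
proof -
  have "L2_inner f f = (LINT x|lborel. complex_of_real ((cmod (f x))\<^sup>2))"
    unfolding L2_inner_def complex_norm_square ..
  then show ?thesis
    by (simp add: L2_norm_def del: of_real_power)
qed

lemma L2_norm_nonneg [simp]: "L2_norm f \<ge> 0"
  by (simp add: L2_norm_def)

lemma L2_norm_sq_lincomb: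
  assumes "f \<in> L2" "g \<in> L2"
  shows "(L2_norm (\<lambda>x. of_real a * f x + of_real b * g x))\<^sup>2 =
    a\<^sup>2 * (L2_norm f)\<^sup>2 + 2 * a * b * Re (L2_inner f g) + b\<^sup>2 * (L2_norm g)\<^sup>2"
proof -
  have "Re (L2_inner g f) = Re (L2_inner f g)" by (subst L2_inner_commute) simp
  then show ?thesis
    using assms unfolding L2_norm_sq
    by (simp add: L2_inner_lincomb_left L2_inner_lincomb_right L2_lincomb)
       (simp add: algebra_simps power2_eq_square)
qed

lemma L2_norm_sq_diff_cmult:
  assumes "f \<in> L2" "g \<in> L2"
  shows "(L2_norm (\<lambda>x. f x - of_real c * g x))\<^sup>2 =
    (L2_norm f)\<^sup>2 - 2 * c * Re (L2_inner f g) + c\<^sup>2 * (L2_norm g)\<^sup>2"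
  using L2_norm_sq_lincomb[OF assms, of 1 "-c"] by simp

lemma L2_norm_cmult: "L2_norm (\<lambda>x. c * f x) = cmod c * L2_norm f"
  unfolding L2_norm_def by (simp add: norm_mult power_mult_distrib real_sqrt_mult)

text \<open>
  The quadratic form \<open>|a f - b g|\<^sup>2 \<ge> 0\<close> at \<open>a = |g|\<close>, \<open>b = |f|\<close>; if one of the norms vanishes, a coefficient large enough to contradict nonnegativity is used instead.
\<close>
lemma Re_L2_inner_le:
  assumes "f \<in> L2" "g \<in> L2"
  shows "Re (L2_inner f g) \<le> L2_norm f * L2_norm g"
proof -
  let ?a = "L2_norm g" and ?b = "L2_norm f" and ?r = "Re (L2_inner f g)"
  have q: "0 \<le> a\<^sup>2 * ?b\<^sup>2 - 2 * a * b * ?r + b\<^sup>2 * ?a\<^sup>2" for a b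
    using L2_norm_sq_lincomb[OF assms, of a "-b"]
      zero_le_power2[of "L2_norm (\<lambda>x. of_real a * f x + of_real (- b) * g x)"] by simp
  show ?thesis
  proof (cases "?a = 0 \<or> ?b = 0")
    case True
    have "?r \<le> 0"
    proof (rule ccontr)
      assume "\<not> ?r \<le> 0"
      then have r: "?r > 0" by simp
      from True show False
      proof
        assume "?a = 0"
        then have "0 \<le> ?b\<^sup>2 - 2 * ((?b\<^sup>2 + 1) / ?r) * ?r" using q[of 1 "(?b\<^sup>2 + 1) / ?r"] by simp
        also have "\<dots> = - (?b\<^sup>2) - 2" using r by (simp add: field_simps)
        finally show False using zero_le_power2[of ?b] by linarith
      next
        assume "?b = 0"
        then have "0 \<le> ?a\<^sup>2 - 2 * ((?a\<^sup>2 + 1) / ?r) * ?r" using q[of "(?a\<^sup>2 + 1) / ?r" 1] by simp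
        also have "\<dots> = - (?a\<^sup>2) - 2" using r by (simp add: field_simps)
        finally show False using zero_le_power2[of ?a] by linarith
      qed
    qed
    then show ?thesis using True by auto
  next
    case False
    then have pos: "?a > 0" "?b > 0" using L2_norm_nonneg[of f] L2_norm_nonneg[of g] by linarith+
    from q[of ?a ?b] have "0 \<le> 2 * (?a * ?b) * (?b * ?a - ?r)"
      by (simp add: algebra_simps power2_eq_square)
    moreover have "0 < 2 * (?a * ?b)" using pos by simp
    ultimately show ?thesis by (simp only: zero_le_mult_iff) (simp add: mult.commute)
  qed
qed

text \<open>
  Rotating \<open>f\<close> by a phase makes the inner product real.
\<close>
lemma cmod_L2_inner_le:
  assumes "f \<in> L2" "g \<in> L2"
  shows "cmod (L2_inner f g) \<le> L2_norm f * L2_norm g"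
proof (cases "L2_inner f g = 0")
  case False
  define u where "u = cnj (sgn (L2_inner f g))"
  have u: "cmod u = 1" using False by (simp add: u_def norm_sgn)
  have "u * L2_inner f g = cmod (L2_inner f g)"
    unfolding u_def sgn_eq using False complex_norm_square[of "L2_inner f g"]
    by (simp add: field_simps power2_eq_square)
  moreover have "L2_inner (\<lambda>x. u * f x) g = u * L2_inner f g"
    using L2_inner_lincomb_left[OF assms(1) assms(1) assms(2), of u 0] by simp
  ultimately have "cmod (L2_inner f g) = Re (L2_inner (\<lambda>x. u * f x) g)" by simp
  also have "\<dots> \<le> L2_norm (\<lambda>x. u * f x) * L2_norm g"
    using Re_L2_inner_le[OF _ assms(2)] L2_lincomb[OF assms(1) assms(1), of u 0] by simp
  finally show ?thesis by (simp add: L2_norm_cmult u)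
qed simp

lemma L2_norm_lincomb_le:
  assumes "f \<in> L2" "g \<in> L2"
  shows "L2_norm (\<lambda>x. a * f x + b * g x) \<le> cmod a * L2_norm f + cmod b * L2_norm g"
proof (rule power2_le_imp_le)
  have af: "(\<lambda>x. a * f x) \<in> L2" and bg: "(\<lambda>x. b * g x) \<in> L2"
    using L2_lincomb[OF assms(1,1), of a 0] L2_lincomb[OF assms(2,2), of b 0] by simp_all
  have "(L2_norm (\<lambda>x. a * f x + b * g x))\<^sup>2 =
      (L2_norm (\<lambda>x. a * f x))\<^sup>2 + 2 * Re (L2_inner (\<lambda>x. a * f x) (\<lambda>x. b * g x)) + (L2_norm (\<lambda>x. b * g x))\<^sup>2"
    using L2_norm_sq_lincomb[OF af bg, of 1 1] by simp
  also have "\<dots> \<le> (L2_norm (\<lambda>x. a * f x) + L2_norm (\<lambda>x. b * g x))\<^sup>2"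
    using Re_L2_inner_le[OF af bg] by (simp add: power2_sum)
  finally show "(L2_norm (\<lambda>x. a * f x + b * g x))\<^sup>2 \<le> (cmod a * L2_norm f + cmod b * L2_norm g)\<^sup>2"
    by (simp add: L2_norm_cmult)
qed simp

lemma L2_norm_cong_AE:
  assumes "AE x in lborel. f x = g x" "f \<in> L2" "g \<in> L2"
  shows "L2_norm f = L2_norm g"
  unfolding L2_norm_def using assms(1) L2_measurable[OF assms(2)] L2_measurable[OF assms(3)]
  by (intro arg_cong[where f = sqrt] integral_cong_AE) auto

lemma L2_inner_cong_AE:
  assumes "AE x in lborel. f x = g x" "f \<in> L2" "g \<in> L2" "h \<in> L2"
  shows "L2_inner f h = L2_inner g h"
  unfolding L2_inner_def
  using assms(1) L2_mult_integrable[OF assms(2,4)] L2_mult_integrable[OF assms(3,4)]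
  by (intro integral_cong_AE borel_measurable_integrable) auto

lemma tendsto_L2_inner:
  assumes L2: "\<And>n. u n \<in> L2" "\<And>n. w n \<in> L2" "g \<in> L2" "h \<in> L2"
    and u: "(\<lambda>n. L2_norm (\<lambda>x. u n x - g x)) \<longlonglongrightarrow> 0"
    and w: "(\<lambda>n. L2_norm (\<lambda>x. w n x - h x)) \<longlonglongrightarrow> 0"
  shows "(\<lambda>n. L2_inner (w n) (u n)) \<longlonglongrightarrow> L2_inner h g"
proof -
  let ?U = "\<lambda>n. L2_norm (\<lambda>x. u n x - g x)" and ?W = "\<lambda>n. L2_norm (\<lambda>x. w n x - h x)"
  have bound: "cmod (L2_inner (w n) (u n) - L2_inner h g) \<le> ?W n * ?U n + ?W n * L2_norm g + L2_norm h * ?U n" for n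
  proof -
    let ?u = "\<lambda>x. u n x - g x" and ?w = "\<lambda>x. w n x - h x"
    have m: "?u \<in> L2" "?w \<in> L2" by (intro L2_diff L2)+
    have 1: "L2_inner ?w f = L2_inner (w n) f - L2_inner h f" if "f \<in> L2" for f
      using L2_inner_lincomb_left[OF L2(2)[of n] L2(4) that, where a = 1 and b = "-1"] by simp
    have 2: "L2_inner f ?u = L2_inner f (u n) - L2_inner f g" if "f \<in> L2" for f
      using L2_inner_lincomb_right[OF L2(1)[of n] L2(3) that, where a = 1 and b = "-1"] by simp
    have split: "L2_inner (w n) (u n) - L2_inner h g = L2_inner ?w ?u + L2_inner ?w g + L2_inner h ?u"
      unfolding 1[OF m(1)] 1[OF L2(3)] 2[OF L2(2)] 2[OF L2(4)] by simp
    have "cmod (L2_inner (w n) (u n) - L2_inner h g)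
        \<le> cmod (L2_inner ?w ?u) + cmod (L2_inner ?w g) + cmod (L2_inner h ?u)"
      unfolding split using norm_triangle_ineq[of "L2_inner ?w ?u + L2_inner ?w g" "L2_inner h ?u"]
        norm_triangle_ineq[of "L2_inner ?w ?u" "L2_inner ?w g"] by linarith
    also have "\<dots> \<le> ?W n * ?U n + ?W n * L2_norm g + L2_norm h * ?U n"
      using cmod_L2_inner_le[OF m(2,1)] cmod_L2_inner_le[OF m(2) L2(3)] cmod_L2_inner_le[OF L2(4) m(1)]
      by (rule add_mono[OF add_mono])
    finally show ?thesis .
  qed
  have "(\<lambda>n. ?W n * ?U n + ?W n * L2_norm g + L2_norm h * ?U n) \<longlonglongrightarrow> 0 * 0 + 0 * L2_norm g + L2_norm h * 0"
    by (intro tendsto_add tendsto_mult tendsto_const u w)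
  then have "(\<lambda>n. ?W n * ?U n + ?W n * L2_norm g + L2_norm h * ?U n) \<longlonglongrightarrow> 0" by simp
  then have "(\<lambda>n. L2_inner (w n) (u n) - L2_inner h g) \<longlonglongrightarrow> 0"
    by (rule Lim_null_comparison[OF always_eventually[OF allI[OF bound]]])
  then show ?thesis by (rule LIM_zero_cancel)
qed

text \<open>
  Operators are graphs on representatives, so linearity means that the graph is closed under linear combinations.
\<close>
definition symmetric_op :: "L2_operator \<Rightarrow> bool" where
  "symmetric_op T \<longleftrightarrow> T \<subseteq> L2 \<times> L2 \<and>
     (\<forall>(g, h)\<in>T. \<forall>(g', h')\<in>T. \<forall>a b. (\<lambda>x. a * g x + b * g' x, \<lambda>x. a * h x + b * h' x) \<in> T) \<and>
     (\<forall>(g, h)\<in>T. \<forall>(g', h')\<in>T. L2_inner h g' = L2_inner g h')"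

lemma symmetric_op_L2: "symmetric_op T \<Longrightarrow> (g, h) \<in> T \<Longrightarrow> g \<in> L2 \<and> h \<in> L2"
  by (auto simp: symmetric_op_def)

lemma symmetric_op_lincomb:
  "symmetric_op T \<Longrightarrow> (g, h) \<in> T \<Longrightarrow> (g', h') \<in> T \<Longrightarrow>
     (\<lambda>x. a * g x + b * g' x, \<lambda>x. a * h x + b * h' x) \<in> T"
  unfolding symmetric_op_def by blast

lemma symmetric_op_inner:
  "symmetric_op T \<Longrightarrow> (g, h) \<in> T \<Longrightarrow> (g', h') \<in> T \<Longrightarrow> L2_inner h g' = L2_inner g h'"
  unfolding symmetric_op_def by blast

lemma op_closureI:
  assumes "g \<in> L2" "h \<in> L2" and "\<forall>n::nat. (u n, w n) \<in> T"
    and "(\<lambda>n. L2_norm (\<lambda>x. u n x - g x)) \<longlonglongrightarrow> 0" "(\<lambda>n. L2_norm (\<lambda>x. w n x - h x)) \<longlonglongrightarrow> 0"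
  shows "(g, h) \<in> op_closure T"
  unfolding op_closure_def using assms by blast

lemma subset_op_closure:
  assumes "T \<subseteq> L2 \<times> L2"
  shows "T \<subseteq> op_closure T"
proof (intro subrelI)
  fix g h assume "(g, h) \<in> T"
  moreover have "L2_norm (\<lambda>x. f x - f x) = 0" for f
    by (simp add: L2_norm_def)
  ultimately show "(g, h) \<in> op_closure T"
    using assms by (intro op_closureI[of g h "\<lambda>_. g" "\<lambda>_. h"]) auto
qed

lemma symmetric_op_closure:
  assumes T: "symmetric_op T"
  shows "symmetric_op (op_closure T)"
proof -
  have key: "L2_inner h g' = L2_inner g h' \<and>
      (\<forall>a b. (\<lambda>x. a * g x + b * g' x, \<lambda>x. a * h x + b * h' x) \<in> op_closure T)"
    if "(g, h) \<in> op_closure T" "(g', h') \<in> op_closure T" for g h g' h'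
  proof -
    from that obtain u w u' w' where L2: "g \<in> L2" "h \<in> L2" "g' \<in> L2" "h' \<in> L2"
      and uw: "\<And>n. (u n, w n) \<in> T" "\<And>n. (u' n, w' n) \<in> T"
      and lim: "(\<lambda>n. L2_norm (\<lambda>x. u n x - g x)) \<longlonglongrightarrow> 0" "(\<lambda>n. L2_norm (\<lambda>x. w n x - h x)) \<longlonglongrightarrow> 0"
        "(\<lambda>n. L2_norm (\<lambda>x. u' n x - g' x)) \<longlonglongrightarrow> 0" "(\<lambda>n. L2_norm (\<lambda>x. w' n x - h' x)) \<longlonglongrightarrow> 0"
      unfolding op_closure_def by auto
    have uwL2: "u n \<in> L2" "w n \<in> L2" "u' n \<in> L2" "w' n \<in> L2" for n
      using symmetric_op_L2[OF T uw(1)] symmetric_op_L2[OF T uw(2)] by auto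
    have "(\<lambda>n. L2_inner (w n) (u' n)) \<longlonglongrightarrow> L2_inner h g'"
      by (intro tendsto_L2_inner uwL2 L2 lim)
    moreover have "(\<lambda>n. L2_inner (u n) (w' n)) \<longlonglongrightarrow> L2_inner g h'"
      by (intro tendsto_L2_inner uwL2 L2 lim)
    ultimately have inner: "L2_inner h g' = L2_inner g h'"
      unfolding symmetric_op_inner[OF T uw] by (rule LIMSEQ_unique)
    have conv: "(\<lambda>n. L2_norm (\<lambda>x. (a * f n x + b * f' n x) - (a * k x + b * k' x))) \<longlonglongrightarrow> 0"
      if "\<And>n. f n \<in> L2" "\<And>n. f' n \<in> L2" "k \<in> L2" "k' \<in> L2"
        "(\<lambda>n. L2_norm (\<lambda>x. f n x - k x)) \<longlonglongrightarrow> 0" "(\<lambda>n. L2_norm (\<lambda>x. f' n x - k' x)) \<longlonglongrightarrow> 0"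
      for f f' :: "nat \<Rightarrow> real \<Rightarrow> complex" and k k' a b
    proof (rule tendsto_sandwich[OF _ _ tendsto_const])
      show "(\<lambda>n. cmod a * L2_norm (\<lambda>x. f n x - k x) + cmod b * L2_norm (\<lambda>x. f' n x - k' x)) \<longlonglongrightarrow> 0"
        using tendsto_add[OF tendsto_mult_left[OF that(5), of "cmod a"] tendsto_mult_left[OF that(6), of "cmod b"]]
        by simp
      have "L2_norm (\<lambda>x. (a * f n x + b * f' n x) - (a * k x + b * k' x))
          \<le> cmod a * L2_norm (\<lambda>x. f n x - k x) + cmod b * L2_norm (\<lambda>x. f' n x - k' x)" for n
      proof -
        have "(\<lambda>x. (a * f n x + b * f' n x) - (a * k x + b * k' x)) =
            (\<lambda>x. a * (f n x - k x) + b * (f' n x - k' x))"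
          by (rule ext) (simp add: algebra_simps)
        then show ?thesis
          using L2_norm_lincomb_le[OF L2_diff[OF that(1)[of n] that(3)] L2_diff[OF that(2)[of n] that(4)], of a b]
          by simp
      qed
      then show "\<forall>\<^sub>F n in sequentially. L2_norm (\<lambda>x. (a * f n x + b * f' n x) - (a * k x + b * k' x))
          \<le> cmod a * L2_norm (\<lambda>x. f n x - k x) + cmod b * L2_norm (\<lambda>x. f' n x - k' x)" by simp
    qed simp
    have "(\<lambda>x. a * g x + b * g' x, \<lambda>x. a * h x + b * h' x) \<in> op_closure T" for a b
    proof -
      have "\<forall>n. (\<lambda>x. a * u n x + b * u' n x, \<lambda>x. a * w n x + b * w' n x) \<in> T"
        by (intro allI symmetric_op_lincomb[OF T] uw)
      moreover have "(\<lambda>n. L2_norm (\<lambda>x. (a * u n x + b * u' n x) - (a * g x + b * g' x))) \<longlonglongrightarrow> 0"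
        by (rule conv[OF uwL2(1) uwL2(3) L2(1) L2(3) lim(1) lim(3)])
      moreover have "(\<lambda>n. L2_norm (\<lambda>x. (a * w n x + b * w' n x) - (a * h x + b * h' x))) \<longlonglongrightarrow> 0"
        by (rule conv[OF uwL2(2) uwL2(4) L2(2) L2(4) lim(2) lim(4)])
      moreover have "(\<lambda>x. a * g x + b * g' x) \<in> L2" "(\<lambda>x. a * h x + b * h' x) \<in> L2"
        using L2 L2_lincomb by blast+
      ultimately show ?thesis by (intro op_closureI)
    qed
    with inner show ?thesis by blast
  qed
  have "op_closure T \<subseteq> L2 \<times> L2" by (auto simp: op_closure_def)
  then show ?thesis
    unfolding symmetric_op_def using key by blast
qed

lemma op_positive_closure:
  assumes "T \<subseteq> L2 \<times> L2" and pos: "\<And>g h. (g, h) \<in> T \<Longrightarrow> L2_inner h g \<in> \<real>\<^sub>\<ge>\<^sub>0"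
  shows "op_positive (op_closure T)"
  unfolding op_positive_def
proof (intro ballI)
  fix p assume "p \<in> op_closure T"
  moreover obtain g h where [simp]: "p = (g, h)" by fastforce
  ultimately obtain u w where L2: "g \<in> L2" "h \<in> L2" and uw: "\<And>n. (u n, w n) \<in> T"
    and lim: "(\<lambda>n. L2_norm (\<lambda>x. u n x - g x)) \<longlonglongrightarrow> 0" "(\<lambda>n. L2_norm (\<lambda>x. w n x - h x)) \<longlonglongrightarrow> 0"
    unfolding op_closure_def by auto
  have uwL2: "u n \<in> L2" "w n \<in> L2" for n using uw[of n] assms(1) by auto
  have "(\<lambda>n. L2_inner (w n) (u n)) \<longlonglongrightarrow> L2_inner h g"
    by (intro tendsto_L2_inner uwL2 L2 lim)
  then have "L2_inner h g \<in> \<real>\<^sub>\<ge>\<^sub>0"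
    using closed_sequentially[OF closed_nonneg_Reals_complex, of "\<lambda>n. L2_inner (w n) (u n)"] pos[OF uw]
    by blast
  then show "case p of (g, h) \<Rightarrow> L2_inner h g \<in> \<real>\<^sub>\<ge>\<^sub>0" by simp
qed

section \<open>Gaps in the real spectrum of a symmetric operator\<close>

lemma resolvent_setD:
  assumes "z \<in> op_resolvent_set T"
  shows "\<exists>B. \<forall>g h. (g, h) \<in> T \<longrightarrow> L2_norm g \<le> B * L2_norm (\<lambda>x. h x - z * g x)"
    and "f \<in> L2 \<Longrightarrow> \<exists>g h. (g, h) \<in> T \<and> (AE x in lborel. h x - z * g x = f x)"
  using assms unfolding op_resolvent_set_def by blast+

text \<open>
  With \<open>R = (T - c)\<^sup>-\<^sup>1\<close> and \<open>f = (T - c) g\<close> this says that \<open>\<beta> - s R\<close> is bounded below. Indeed \<open>\<beta> f - s g = \<beta> (T - (c + s/\<beta>)) g\<close> for \<open>s = \<plusminus>1\<close>.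
\<close>
lemma resolvent_lower_bound:
  assumes T: "symmetric_op T" and \<beta>: "\<beta> > 0"
    and res: "of_real (c + s / \<beta>) \<in> op_resolvent_set T" and s: "\<bar>s\<bar> = 1"
  obtains E where "E > 0"
    "\<And>g h. (g, h) \<in> T \<Longrightarrow> L2_norm (\<lambda>x. h x - of_real c * g x) \<le>
       E * L2_norm (\<lambda>x. of_real \<beta> * (h x - of_real c * g x) - of_real s * g x)"
proof -
  obtain B where B: "\<And>g h. (g, h) \<in> T \<Longrightarrow>
      L2_norm g \<le> B * L2_norm (\<lambda>x. h x - of_real (c + s / \<beta>) * g x)"
    using resolvent_setD(1)[OF res] by blast
  define E where "E = 1 / \<beta> + \<bar>B\<bar> / \<beta>\<^sup>2"
  have "E > 0" using \<beta> by (auto simp: E_def intro!: add_pos_nonneg)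
  moreover have "L2_norm (\<lambda>x. h x - of_real c * g x) \<le>
       E * L2_norm (\<lambda>x. of_real \<beta> * (h x - of_real c * g x) - of_real s * g x)"
    if gh: "(g, h) \<in> T" for g h
  proof -
    let ?f = "\<lambda>x. h x - of_real c * g x"
    let ?p = "\<lambda>x. of_real \<beta> * (h x - of_real c * g x) - of_real s * g x"
    have L2: "g \<in> L2" "h \<in> L2" using symmetric_op_L2[OF T gh] by auto
    have f: "?f \<in> L2" using L2 by (intro L2_diff_cmult)
    have p: "?p \<in> L2" using L2_lincomb[OF f L2(1), of "of_real \<beta>" "- of_real s"] by simp
    have "L2_norm ?f = L2_norm (\<lambda>x. of_real (1 / \<beta>) * ?p x + of_real (s / \<beta>) * g x)"
      using \<beta> by (intro arg_cong[where f = L2_norm] ext) (simp add: field_simps)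
    also have "\<dots> \<le> cmod (of_real (1 / \<beta>)) * L2_norm ?p + cmod (of_real (s / \<beta>)) * L2_norm g"
      by (rule L2_norm_lincomb_le[OF p L2(1)])
    also have "\<dots> = 1 / \<beta> * L2_norm ?p + 1 / \<beta> * L2_norm g"
      unfolding norm_of_real using \<beta> s by simp
    also have "L2_norm g \<le> \<bar>B\<bar> / \<beta> * L2_norm ?p"
    proof -
      have "L2_norm g \<le> B * L2_norm (\<lambda>x. h x - of_real (c + s / \<beta>) * g x)" by (rule B[OF gh])
      also have "(\<lambda>x. h x - of_real (c + s / \<beta>) * g x) = (\<lambda>x. of_real (1 / \<beta>) * ?p x)"
        using \<beta> by (intro ext) (simp add: field_simps)
      also have "L2_norm \<dots> = 1 / \<beta> * L2_norm ?p"
        unfolding L2_norm_cmult norm_of_real using \<beta> by simp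
      also have "B * \<dots> \<le> \<bar>B\<bar> * \<dots>" using \<beta> by (intro mult_right_mono) auto
      finally show ?thesis by simp
    qed
    finally show ?thesis using \<beta> by (simp add: E_def field_simps power2_eq_square)
  qed
  ultimately show ?thesis using that by blast
qed

text \<open>
  The inverse \<open>R = (T - c)\<^sup>-\<^sup>1\<close> is symmetric and bounded; let \<open>\<beta>\<close> be its norm. Symmetry gives
  \<open>|(\<beta>\<^sup>2 - R\<^sup>2) f|\<^sup>2 \<le> \<beta>\<^sup>2 (\<beta>\<^sup>2 |f|\<^sup>2 - |R f|\<^sup>2)\<close>. If \<open>1/\<beta> < r\<close>, then \<open>c + 1/\<beta>\<close> and \<open>c - 1/\<beta>\<close> lie in the resolvent
  set, so both factors of \<open>\<beta>\<^sup>2 - R\<^sup>2 = (\<beta> - R)(\<beta> + R)\<close> are bounded below. Hence \<open>|R f|\<^sup>2 \<le> (\<beta>\<^sup>2 - \<kappa>) |f|\<^sup>2\<close> for some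
  \<open>\<kappa> > 0\<close>, which contradicts the choice of \<open>\<beta>\<close>. The values of \<open>R\<close> are used only up to null sets.
\<close>
lemma resolvent_gap_estimate:
  assumes T: "symmetric_op T" and r: "r > 0"
    and res: "\<And>t. \<bar>t - c\<bar> < r \<Longrightarrow> of_real t \<in> op_resolvent_set T"
    and gh: "(g, h) \<in> T"
  shows "r * L2_norm g \<le> L2_norm (\<lambda>x. h x - of_real c * g x)"
proof (rule ccontr)
  assume contra: "\<not> ?thesis"
  let ?N = "\<lambda>g h. L2_norm (\<lambda>x. h x - of_real c * g x)"
  define S where "S = {B. B \<ge> 0 \<and> (\<forall>g h. (g, h) \<in> T \<longrightarrow> L2_norm g \<le> B * ?N g h)}"
  have c: "of_real c \<in> op_resolvent_set T" using res[of c] r by simp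
  from resolvent_setD(1)[OF this] obtain B
    where B: "\<And>g h. (g, h) \<in> T \<Longrightarrow> L2_norm g \<le> B * ?N g h" by blast
  have "L2_norm g \<le> \<bar>B\<bar> * ?N g h" if "(g, h) \<in> T" for g h
    by (rule order_trans[OF B[OF that] mult_right_mono[OF abs_ge_self L2_norm_nonneg]])
  then have "\<bar>B\<bar> \<in> S" by (simp add: S_def)
  then have ne: "S \<noteq> {}" by blast
  have bdd: "bdd_below S" by (rule bdd_belowI[of _ 0]) (simp add: S_def)
  define \<beta> where "\<beta> = Inf S"
  have "\<beta> \<ge> 0" unfolding \<beta>_def using ne by (intro cInf_greatest) (auto simp: S_def)
  have \<beta>: "L2_norm g \<le> \<beta> * ?N g h" if "(g, h) \<in> T" for g h
  proof (cases "?N g h = 0")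
    case True
    then show ?thesis using B[OF that] by simp
  next
    case False
    then have pos: "?N g h > 0" using L2_norm_nonneg[of "\<lambda>x. h x - of_real c * g x"] by linarith
    then have "L2_norm g / ?N g h \<le> \<beta>" unfolding \<beta>_def
      using ne that by (intro cInf_greatest) (auto simp: S_def divide_le_eq)
    then show ?thesis using pos by (simp add: divide_le_eq)
  qed
  have r\<beta>: "r * \<beta> > 1"
  proof (rule ccontr)
    assume "\<not> r * \<beta> > 1"
    then have "r * \<beta> * ?N g h \<le> 1 * ?N g h" by (intro mult_right_mono) auto
    moreover have "r * L2_norm g \<le> r * (\<beta> * ?N g h)" using \<beta>[OF gh] r by simp
    ultimately show False using contra by (simp add: mult.assoc)
  qed
  then have \<beta>pos: "\<beta> > 0" using r \<open>\<beta> \<ge> 0\<close> by (cases "\<beta> = 0") auto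
  have "1 / \<beta> < r" using r\<beta> \<beta>pos by (simp add: field_simps)
  then have res': "of_real (c + s / \<beta>) \<in> op_resolvent_set T" if "\<bar>s\<bar> = 1" for s
    using that \<beta>pos by (intro res) simp
  obtain E1 where E1: "E1 > 0" "\<And>g h. (g, h) \<in> T \<Longrightarrow>
      ?N g h \<le> E1 * L2_norm (\<lambda>x. of_real \<beta> * (h x - of_real c * g x) - of_real 1 * g x)"
    using resolvent_lower_bound[OF T \<beta>pos res'[of 1]] by auto
  obtain E2 where E2: "E2 > 0" "\<And>g h. (g, h) \<in> T \<Longrightarrow>
      ?N g h \<le> E2 * L2_norm (\<lambda>x. of_real \<beta> * (h x - of_real c * g x) - of_real (-1) * g x)"
    using resolvent_lower_bound[OF T \<beta>pos res'[of "-1"]] by auto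
  define \<kappa> where "\<kappa> = 1 / ((E2 * E1)\<^sup>2 * \<beta>\<^sup>2)"
  have \<kappa>: "\<kappa> > 0" using E1(1) E2(1) \<beta>pos by (simp add: \<kappa>_def)
  \<comment> \<open>Here \<open>f = (T - c) g1\<close>, \<open>g1 = R f\<close> and \<open>g2 = R g1\<close>, so the estimate says \<open>|R f|\<^sup>2 \<le> (\<beta>\<^sup>2 - \<kappa>) |f|\<^sup>2\<close>.\<close>
  have improved: "(L2_norm g1)\<^sup>2 \<le> (\<beta>\<^sup>2 - \<kappa>) * (?N g1 h1)\<^sup>2" if g1: "(g1, h1) \<in> T" for g1 h1
  proof -
    define f where "f = (\<lambda>x. h1 x - of_real c * g1 x)"
    have L2: "g1 \<in> L2" "h1 \<in> L2" using symmetric_op_L2[OF T g1] by auto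
    have f: "f \<in> L2" unfolding f_def using L2 by (intro L2_diff_cmult)
    from resolvent_setD(2)[OF c L2(1)] obtain g2 h2 where g2: "(g2, h2) \<in> T"
      and ae: "AE x in lborel. h2 x - of_real c * g2 x = g1 x" by blast
    define f2 where "f2 = (\<lambda>x. h2 x - of_real c * g2 x)"
    have L2': "g2 \<in> L2" "h2 \<in> L2" using symmetric_op_L2[OF T g2] by auto
    have f2: "f2 \<in> L2" unfolding f2_def using L2' by (intro L2_diff_cmult)
    have ae': "AE x in lborel. f2 x = g1 x" using ae by (simp add: f2_def)
    have p1: "(\<lambda>x. of_real \<beta> * f x + 1 * g1 x) \<in> L2" "(\<lambda>x. of_real \<beta> * f x + 1 * f2 x) \<in> L2"
      by (intro L2_lincomb f L2 f2)+
    have p2: "(\<lambda>x. of_real \<beta> * f x + g1 x) \<in> L2" "(\<lambda>x. of_real \<beta> * f x + f2 x) \<in> L2"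
      using p1 by simp_all
    have p3: "(\<lambda>x. of_real (\<beta>\<^sup>2) * f x - g2 x) \<in> L2"
      using L2_lincomb[OF f L2'(1), of "of_real (\<beta>\<^sup>2)" "-1"] by simp
    have p4: "(\<lambda>x. of_real \<beta> * (of_real \<beta> * f x + f2 x) - (of_real \<beta> * g1 x + g2 x)) \<in> L2"
    proof -
      have "(\<lambda>x. of_real \<beta> * g1 x + 1 * g2 x) \<in> L2" by (intro L2_lincomb L2 L2')
      then have "(\<lambda>x. of_real \<beta> * g1 x + g2 x) \<in> L2" by simp
      moreover have "(\<lambda>x. of_real \<beta> * (of_real \<beta> * f x + f2 x)) \<in> L2"
        using L2_lincomb[OF p2(2) p2(2), of "of_real \<beta>" 0] by simp
      ultimately show ?thesis by (rule L2_diff[rotated])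
    qed
    have "L2_norm f \<le> E2 * L2_norm (\<lambda>x. of_real \<beta> * f x + g1 x)"
      using E2(2)[OF g1] by (simp add: f_def)
    also have "L2_norm (\<lambda>x. of_real \<beta> * f x + g1 x) = L2_norm (\<lambda>x. of_real \<beta> * f x + f2 x)"
      using ae' by (intro L2_norm_cong_AE p2) auto
    also have "\<dots> \<le> E1 * L2_norm (\<lambda>x. of_real \<beta> * (of_real \<beta> * f x + f2 x) - (of_real \<beta> * g1 x + g2 x))"
    proof -
      have "(\<lambda>x. of_real \<beta> * g1 x + 1 * g2 x, \<lambda>x. of_real \<beta> * h1 x + 1 * h2 x) \<in> T"
        by (rule symmetric_op_lincomb[OF T g1 g2])
      from E1(2)[OF this] show ?thesis
        by (simp add: f_def f2_def algebra_simps)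
    qed
    also have "L2_norm (\<lambda>x. of_real \<beta> * (of_real \<beta> * f x + f2 x) - (of_real \<beta> * g1 x + g2 x)) =
        L2_norm (\<lambda>x. of_real (\<beta>\<^sup>2) * f x - g2 x)"
      using ae' by (intro L2_norm_cong_AE p3 p4) (auto simp: algebra_simps power2_eq_square)
    finally have low: "L2_norm f \<le> E2 * (E1 * L2_norm (\<lambda>x. of_real (\<beta>\<^sup>2) * f x - g2 x))"
      using E2(1) by simp
    have "L2_inner f g2 = L2_inner h1 g2 - of_real c * L2_inner g1 g2"
      using L2_inner_lincomb_left[OF L2(2,1) L2'(1), of 1 "- of_real c"] by (simp add: f_def)
    also have "\<dots> = L2_inner g1 h2 - of_real c * L2_inner g1 g2"
      by (simp add: symmetric_op_inner[OF T g1 g2])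
    also have "\<dots> = L2_inner g1 f2"
      using L2_inner_lincomb_right[OF L2'(2,1) L2(1), of 1 "- of_real c"] by (simp add: f2_def)
    also have "\<dots> = L2_inner g1 g1"
      using L2_inner_cong_AE[OF ae' f2 L2(1) L2(1)] L2_inner_commute[of g1] by metis
    finally have inner: "Re (L2_inner f g2) = (L2_norm g1)\<^sup>2" by (simp add: L2_norm_sq)
    have "L2_norm g2 \<le> \<beta> * L2_norm f2" using \<beta>[OF g2] by (simp add: f2_def)
    also have "L2_norm f2 = L2_norm g1" by (rule L2_norm_cong_AE[OF ae' f2 L2(1)])
    finally have g2n: "(L2_norm g2)\<^sup>2 \<le> \<beta>\<^sup>2 * (L2_norm g1)\<^sup>2"
      using power_mono[of "L2_norm g2" "\<beta> * L2_norm g1" 2] by (simp add: power_mult_distrib)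
    have "(L2_norm f)\<^sup>2 \<le> (E2 * E1)\<^sup>2 * (L2_norm (\<lambda>x. of_real (\<beta>\<^sup>2) * f x - g2 x))\<^sup>2"
      using power_mono[OF low, of 2] by (simp add: power_mult_distrib)
    also have "(L2_norm (\<lambda>x. of_real (\<beta>\<^sup>2) * f x - g2 x))\<^sup>2 =
        (\<beta>\<^sup>2)\<^sup>2 * (L2_norm f)\<^sup>2 - 2 * \<beta>\<^sup>2 * (L2_norm g1)\<^sup>2 + (L2_norm g2)\<^sup>2"
      using L2_norm_sq_lincomb[OF f L2'(1), of "\<beta>\<^sup>2" "-1"] inner by simp
    also have "\<dots> \<le> \<beta>\<^sup>2 * (\<beta>\<^sup>2 * (L2_norm f)\<^sup>2 - (L2_norm g1)\<^sup>2)"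
      using g2n by (simp add: algebra_simps power2_eq_square)
    finally have "(L2_norm f)\<^sup>2 \<le> (E2 * E1)\<^sup>2 * (\<beta>\<^sup>2 * (\<beta>\<^sup>2 * (L2_norm f)\<^sup>2 - (L2_norm g1)\<^sup>2))"
      by (simp add: mult_left_mono)
    then have "\<kappa> * (L2_norm f)\<^sup>2 \<le> \<beta>\<^sup>2 * (L2_norm f)\<^sup>2 - (L2_norm g1)\<^sup>2"
      using E1(1) E2(1) \<beta>pos by (simp add: \<kappa>_def divide_le_eq mult_ac)
    then show ?thesis by (simp add: f_def algebra_simps)
  qed
  \<comment> \<open>The maximum covers the case \<open>\<beta>\<^sup>2 < \<kappa>\<close>, in which all \<open>g1\<close> have norm zero.\<close>
  define \<beta>' where "\<beta>' = sqrt (max 0 (\<beta>\<^sup>2 - \<kappa>))"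
  have "\<beta>' \<in> S"
  proof -
    have "L2_norm g1 \<le> \<beta>' * ?N g1 h1" if "(g1, h1) \<in> T" for g1 h1
    proof (rule power2_le_imp_le)
      have "(L2_norm g1)\<^sup>2 \<le> (\<beta>\<^sup>2 - \<kappa>) * (?N g1 h1)\<^sup>2" by (rule improved[OF that])
      also have "\<dots> \<le> max 0 (\<beta>\<^sup>2 - \<kappa>) * (?N g1 h1)\<^sup>2" by (intro mult_right_mono) auto
      finally show "(L2_norm g1)\<^sup>2 \<le> (\<beta>' * ?N g1 h1)\<^sup>2" by (simp add: \<beta>'_def power_mult_distrib)
    qed (simp add: \<beta>'_def)
    then show ?thesis by (simp add: S_def \<beta>'_def)
  qed
  then have "\<beta> \<le> \<beta>'" unfolding \<beta>_def by (rule cInf_lower[OF _ bdd])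
  moreover have "\<beta>' < \<beta>" unfolding \<beta>'_def
    using \<kappa> \<beta>pos by (intro real_less_lsqrt) (auto simp: max_def)
  ultimately show False by simp
qed

lemma Re_L2_inner_shift:
  assumes "g \<in> L2" "h \<in> L2"
  shows "Re (L2_inner (\<lambda>x. h x - of_real a * g x) (\<lambda>x. h x - of_real b * g x)) =
    (L2_norm h)\<^sup>2 - (a + b) * Re (L2_inner h g) + a * b * (L2_norm g)\<^sup>2"
proof -
  have eq: "L2_inner (\<lambda>x. h x - of_real a * g x) (\<lambda>x. h x - of_real b * g x) =
      L2_inner h h - of_real b * L2_inner h g - of_real a * (L2_inner g h - of_real b * L2_inner g g)"
    using L2_inner_lincomb_left[OF assms(2,1) L2_diff_cmult[OF assms(2,1), of "of_real b"], of 1 "- of_real a"]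
      L2_inner_lincomb_right[OF assms(2,1) assms(2), of 1 "- of_real b"]
      L2_inner_lincomb_right[OF assms(2,1) assms(1), of 1 "- of_real b"] by simp
  have "Re (L2_inner g h) = Re (L2_inner h g)" by (subst L2_inner_commute) simp
  then show ?thesis unfolding eq L2_norm_sq by (simp add: algebra_simps)
qed

text \<open>
  With \<open>c\<close> the midpoint and \<open>r\<close> half the length of the gap, \<open>(T - a)(T - b) = (T - c)\<^sup>2 - r\<^sup>2\<close>.
\<close>
lemma gap_form_nonneg:
  assumes T: "symmetric_op T" and ab: "a < b"
    and res: "\<And>t. a < t \<Longrightarrow> t < b \<Longrightarrow> of_real t \<in> op_resolvent_set T"
    and gh: "(g, h) \<in> T"
  shows "Re (L2_inner (\<lambda>x. h x - of_real a * g x) (\<lambda>x. h x - of_real b * g x)) \<ge> 0"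
proof -
  define c r where "c = (a + b) / 2" and "r = (b - a) / 2"
  have L2: "g \<in> L2" "h \<in> L2" using symmetric_op_L2[OF T gh] by auto
  have "r * L2_norm g \<le> L2_norm (\<lambda>x. h x - of_real c * g x)"
  proof (rule resolvent_gap_estimate[OF T _ _ gh])
    show "r > 0" using ab by (simp add: r_def)
    show "of_real t \<in> op_resolvent_set T" if "\<bar>t - c\<bar> < r" for t
      using that by (intro res) (auto simp: c_def r_def abs_less_iff field_simps)
  qed
  then have "(r * L2_norm g)\<^sup>2 \<le> (L2_norm (\<lambda>x. h x - of_real c * g x))\<^sup>2"
    using ab by (intro power_mono) (auto simp: r_def)
  also have "\<dots> = (L2_norm h)\<^sup>2 - 2 * c * Re (L2_inner h g) + c\<^sup>2 * (L2_norm g)\<^sup>2"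
    by (rule L2_norm_sq_diff_cmult[OF L2(2,1)])
  finally have "0 \<le> (L2_norm h)\<^sup>2 - 2 * c * Re (L2_inner h g) + (c\<^sup>2 - r\<^sup>2) * (L2_norm g)\<^sup>2"
    by (simp add: algebra_simps power_mult_distrib)
  moreover have "2 * c = a + b" "c\<^sup>2 - r\<^sup>2 = a * b"
    by (simp_all add: c_def r_def field_simps power2_eq_square)
  ultimately show ?thesis unfolding Re_L2_inner_shift[OF L2] by simp
qed

text \<open>
  The half-line is exhausted by gaps \<open>(a, l)\<close>; dividing the inequality for such a gap by \<open>-a\<close> and letting \<open>a \<rightarrow> -\<infinity>\<close> leaves the claim.
\<close>
lemma lower_bound_form_nonneg:
  assumes T: "symmetric_op T"
    and res: "\<And>t. t < l \<Longrightarrow> of_real t \<in> op_resolvent_set T"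
    and gh: "(g, h) \<in> T"
  shows "Re (L2_inner h g) \<ge> l * (L2_norm g)\<^sup>2"
proof (rule ccontr)
  assume "\<not> ?thesis"
  then have neg: "l * (L2_norm g)\<^sup>2 - Re (L2_inner h g) > 0" (is "?d > 0") by simp
  have L2: "g \<in> L2" "h \<in> L2" using symmetric_op_L2[OF T gh] by auto
  have b: "0 \<le> (L2_norm h)\<^sup>2 - (a + l) * Re (L2_inner h g) + a * l * (L2_norm g)\<^sup>2" if "a < l" for a
    using gap_form_nonneg[OF T that _ gh] res unfolding Re_L2_inner_shift[OF L2] by blast
  define n where "n = (L2_norm h)\<^sup>2 - l * Re (L2_inner h g)"
  have "0 \<le> n + a * ?d" if "a < l" for a
    using b[OF that] by (simp add: n_def algebra_simps)
  \<comment> \<open>This \<open>a\<close> is below \<open>l\<close> and so negative that the linear term outweighs \<open>n\<close>.\<close>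
  from this[of "min (l - 1) (- (\<bar>n\<bar> + 1) / ?d)"]
  have "0 \<le> n + min (l - 1) (- (\<bar>n\<bar> + 1) / ?d) * ?d" by simp
  also have "\<dots> \<le> n + (- (\<bar>n\<bar> + 1) / ?d) * ?d"
    using neg by (intro add_left_mono mult_right_mono) auto
  also have "\<dots> = n - (\<bar>n\<bar> + 1)" using neg by simp
  finally show False by simp
qed

section \<open>The minimal operator v Q(D) v\<close>

text \<open>
  Supports are handled as enclosing intervals.
\<close>
lemma C0_k_iff:
  "g \<in> C0_k n \<longleftrightarrow> C_k n g \<and> (\<exists>a b. \<forall>x. x \<notin> {a..b} \<longrightarrow> g x = 0)"
proof -
  have "compact (closure {x. g x \<noteq> 0}) \<longleftrightarrow> (\<exists>a b. \<forall>x. x \<notin> {a..b} \<longrightarrow> g x = 0)"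
  proof
    assume "compact (closure {x. g x \<noteq> 0})"
    then have "bounded {x. g x \<noteq> 0}" using bounded_subset[OF compact_imp_bounded closure_subset] by blast
    then obtain B where "\<And>x. g x \<noteq> 0 \<Longrightarrow> \<bar>x\<bar> \<le> B" by (auto simp: bounded_iff)
    then have "\<forall>x. x \<notin> {-B..B} \<longrightarrow> g x = 0" by (metis abs_le_D1 abs_le_D2 atLeastAtMost_iff minus_le_iff)
    then show "\<exists>a b. \<forall>x. x \<notin> {a..b} \<longrightarrow> g x = 0" by blast
  next
    assume "\<exists>a b. \<forall>x. x \<notin> {a..b} \<longrightarrow> g x = 0"
    then obtain a b where "{x. g x \<noteq> 0} \<subseteq> {a..b}" by blast
    then have "bounded {x. g x \<noteq> 0}" using bounded_subset[OF bounded_closed_interval] by blast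
    then show "compact (closure {x. g x \<noteq> 0})" by (simp add: compact_closure)
  qed
  then show ?thesis by (auto simp: C0_k_def)
qed

lemma C0_kI: "C_k n g \<Longrightarrow> (\<And>x. x \<notin> {a..b} \<Longrightarrow> g x = 0) \<Longrightarrow> g \<in> C0_k n"
  unfolding C0_k_iff by blast

lemma C0_kD: "g \<in> C0_k n \<Longrightarrow> C_k n g"
  by (simp add: C0_k_iff)

lemma C0_k_support:
  assumes "g \<in> C0_k n"
  obtains a b where "\<And>x. x \<notin> {a..b} \<Longrightarrow> g x = 0"
  using assms that unfolding C0_k_iff by blast

lemma C0_k_mono: "g \<in> C0_k n \<Longrightarrow> m \<le> n \<Longrightarrow> g \<in> C0_k m"
  unfolding C0_k_iff using C_k_mono by blast

lemma C0_k_mult: 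
  assumes "C_k n f" "g \<in> C0_k n"
  shows "(\<lambda>x. f x * g x) \<in> C0_k n"
proof -
  obtain a b where "\<And>x. x \<notin> {a..b} \<Longrightarrow> g x = 0" using C0_k_support[OF assms(2)] by blast
  then show ?thesis using C0_kI[of n "\<lambda>x. f x * g x" a b] C_k_mult[OF assms(1) C0_kD[OF assms(2)]] by simp
qed

lemma C0_k_lincomb:
  assumes "f \<in> C0_k n" "g \<in> C0_k n"
  shows "(\<lambda>x. a * f x + b * g x) \<in> C0_k n"
proof -
  obtain a1 b1 where 1: "\<And>x. x \<notin> {a1..b1} \<Longrightarrow> f x = 0" using C0_k_support[OF assms(1)] by blast
  obtain a2 b2 where 2: "\<And>x. x \<notin> {a2..b2} \<Longrightarrow> g x = 0" using C0_k_support[OF assms(2)] by blast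
  show ?thesis
  proof (rule C0_kI)
    show "C_k n (\<lambda>x. a * f x + b * g x)"
      by (intro C_k_add C_k_mult C_k_const C0_kD assms)
    show "a * f x + b * g x = 0" if "x \<notin> {min a1 a2..max b1 b2}" for x
    proof -
      have "x \<notin> {a1..b1}" "x \<notin> {a2..b2}" using that by auto
      then show ?thesis by (simp add: 1 2)
    qed
  qed
qed

lemma C0_k_sum:
  "finite I \<Longrightarrow> (\<And>i. i \<in> I \<Longrightarrow> f i \<in> C0_k n) \<Longrightarrow> (\<lambda>x. \<Sum>i\<in>I. c i * f i x) \<in> C0_k n"
proof (induction I rule: finite_induct)
  case empty
  show ?case by (rule C0_kI[of _ _ 0 0]) (auto intro: C_k_const)
next
  case (insert i I)
  then show ?case using C0_k_lincomb[of "f i" n "\<lambda>x. \<Sum>i\<in>I. c i * f i x" "c i" 1] by simp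
qed

lemma C0_k_D_pow:
  assumes "g \<in> C0_k n" "k \<le> n"
  shows "(D ^^ k) g \<in> C0_k (n - k)"
proof -
  obtain a b where "\<And>x. x \<notin> {a..b} \<Longrightarrow> g x = 0" using C0_k_support[OF assms(1)] by blast
  then show ?thesis
    using C_k_D_pow[OF C0_kD[OF assms(1)] assms(2)] D_pow_outside[of a b g] by (intro C0_kI[of _ _ a b]) auto
qed

lemma integrable_compact_support:
  fixes f :: "real \<Rightarrow> 'a::{banach, second_countable_topology}"
  assumes "continuous_on UNIV f" and "\<And>x. x \<notin> {a..b} \<Longrightarrow> f x = 0"
  shows "integrable lborel f"
proof -
  have "set_integrable lborel {a..b} f"
    using assms(1) by (intro borel_integrable_atLeastAtMost') (rule continuous_on_subset, auto)
  moreover have "(\<lambda>x. indicator {a..b} x *\<^sub>R f x) = f"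
    using assms(2) by (auto simp: fun_eq_iff indicator_def)
  ultimately show ?thesis by (simp add: set_integrable_def)
qed

lemma C0_k_in_L2:
  assumes "g \<in> C0_k n"
  shows "g \<in> L2"
proof -
  obtain a b where ab: "\<And>x. x \<notin> {a..b} \<Longrightarrow> g x = 0" using C0_k_support[OF assms] by blast
  have cont: "continuous_on UNIV g" using C0_kD[OF assms] by (rule C_k_continuous)
  then have "integrable lborel (\<lambda>x. (cmod (g x))\<^sup>2)"
    using ab by (intro integrable_compact_support[of _ a b] continuous_intros) auto
  then show ?thesis
    using borel_measurable_continuous_onI[OF cont] by (simp add: L2_def)
qed

lemma integral_derivative_compact_support:
  fixes f :: "real \<Rightarrow> complex"
  assumes "\<And>x. (f has_vector_derivative f' x) (at x)" and "continuous_on UNIV f'"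
    and supp: "\<And>x. x \<notin> {a..b} \<Longrightarrow> f x = 0"
  shows "(LINT x|lborel. f' x) = 0"
proof -
  define a' b' where "a' = min a b - 1" and "b' = max a b + 1"
  have z: "f x = 0" if "x \<le> a' \<or> b' \<le> x" for x
    using that by (intro supp) (auto simp: a'_def b'_def)
  have z': "f' x = 0" if "x \<notin> {a'..b'}" for x
  proof -
    have "((\<lambda>_. 0) has_vector_derivative 0) (at x)" by (rule has_vector_derivative_const)
    then have "(f has_vector_derivative 0) (at x)"
      by (rule has_vector_derivative_transform_within_open[of _ _ _ "- {a'..b'}"]) (use that z in auto)
    then show ?thesis using vector_derivative_unique_at[OF assms(1)] by blast
  qed
  have "(LINT x|lborel. indicator {a'..b'} x *\<^sub>R f' x) = f b' - f a'"
    using assms(1,2)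
    by (intro integral_FTC_Icc) (auto simp: a'_def b'_def intro: has_vector_derivative_at_within continuous_on_subset)
  moreover have "(\<lambda>x. indicator {a'..b'} x *\<^sub>R f' x) = f'"
    using z' by (auto simp: fun_eq_iff indicator_def)
  ultimately show ?thesis using z[of a'] z[of b'] by simp
qed

text \<open>
  Integration by parts: the difference of the two integrands is the derivative of \<open>\<i> f g\<^sup>*\<close>, which has compact support.
\<close>
lemma D_symmetric:
  assumes f: "f \<in> C0_k 1" and g: "g \<in> C0_k 1"
  shows "L2_inner (D f) g = L2_inner f (D g)"
proof -
  obtain a b where ab: "\<And>x. x \<notin> {a..b} \<Longrightarrow> f x = 0" using C0_k_support[OF f] by blast
  have cf: "C_k (Suc 0) f" and cg: "C_k (Suc 0) g" using C0_kD[OF f] C0_kD[OF g] by simp_all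
  have Df: "D f \<in> L2" and Dg: "D g \<in> L2"
    using C0_k_in_L2[OF C0_k_D_pow[OF f, of 1]] C0_k_in_L2[OF C0_k_D_pow[OF g, of 1]] by simp_all
  have fg: "f \<in> L2" "g \<in> L2" using C0_k_in_L2[OF f] C0_k_in_L2[OF g] .
  let ?h = "\<lambda>x. \<i> * (f x * cnj (g x))" and ?h' = "\<lambda>x. D f x * cnj (g x) - f x * cnj (D g x)"
  have "(?h has_vector_derivative ?h' x) (at x)" for x
  proof -
    have "(?h has_vector_derivative \<i> * (f x * cnj (- \<i> * D g x) + (- \<i> * D f x) * cnj (g x))) (at x)"
      by (intro has_vector_derivative_mult_right has_vector_derivative_mult has_vector_derivative_cnj
          has_vector_derivative_D[OF cf] has_vector_derivative_D[OF cg])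
    then show ?thesis by (simp add: algebra_simps)
  qed
  moreover have "continuous_on UNIV ?h'"
    using C_k_continuous[OF cf] C_k_continuous[OF cg] C_k_continuous[OF C_k_D[OF cf]] C_k_continuous[OF C_k_D[OF cg]]
    by (intro continuous_intros)
  ultimately have "(LINT x|lborel. ?h' x) = 0"
    using ab by (intro integral_derivative_compact_support[of ?h ?h' a b]) auto
  then show ?thesis unfolding L2_inner_def
    by (subst (asm) Bochner_Integration.integral_diff) (auto intro: L2_mult_integrable Df Dg fg)
qed

text \<open>
  The factors \<open>D\<close> are moved one at a time, so that neither function is ever differentiated more than \<open>n\<close> times.
\<close>
lemma D_pow_symmetric:
  assumes "f \<in> C0_k n" "g \<in> C0_k n"
  shows "j + k \<le> n \<Longrightarrow> L2_inner ((D ^^ (j + k)) f) g = L2_inner ((D ^^ j) f) ((D ^^ k) g)"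
proof (induction k arbitrary: j)
  case (Suc k)
  have "L2_inner ((D ^^ (j + Suc k)) f) g = L2_inner (D ((D ^^ j) f)) ((D ^^ k) g)"
    using Suc.IH[of "Suc j"] Suc.prems by simp
  also have "\<dots> = L2_inner ((D ^^ j) f) (D ((D ^^ k) g))"
    using Suc.prems C0_k_D_pow[OF assms(1), of j] C0_k_D_pow[OF assms(2), of k]
    by (intro D_symmetric) (auto intro: C0_k_mono)
  finally show ?case by simp
qed simp

lemma L2_sum:
  "finite I \<Longrightarrow> (\<And>i. i \<in> I \<Longrightarrow> f i \<in> L2) \<Longrightarrow> (\<lambda>x. \<Sum>i\<in>I. c i * f i x) \<in> L2"
proof (induction I rule: finite_induct)
  case empty
  show ?case by (simp add: L2_def)
next
  case (insert i I)
  then show ?case using L2_lincomb[of "f i" "\<lambda>x. \<Sum>i\<in>I. c i * f i x" "c i" 1] by simp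
qed

lemma L2_inner_sum_left:
  assumes "finite I" "\<And>i. i \<in> I \<Longrightarrow> f i \<in> L2" "g \<in> L2"
  shows "L2_inner (\<lambda>x. \<Sum>i\<in>I. c i * f i x) g = (\<Sum>i\<in>I. c i * L2_inner (f i) g)"
  using assms(1,2)
proof (induction I rule: finite_induct)
  case empty
  show ?case by (simp add: L2_inner_def)
next
  case (insert i I)
  have "L2_inner (\<lambda>x. c i * f i x + 1 * (\<Sum>i\<in>I. c i * f i x)) g =
      c i * L2_inner (f i) g + 1 * L2_inner (\<lambda>x. \<Sum>i\<in>I. c i * f i x) g"
    using insert assms(3) by (intro L2_inner_lincomb_left L2_sum) auto
  then show ?case using insert by simp
qed

lemma L2_inner_sum_right:
  assumes "finite I" "\<And>i. i \<in> I \<Longrightarrow> f i \<in> L2" "g \<in> L2"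
  shows "L2_inner g (\<lambda>x. \<Sum>i\<in>I. c i * f i x) = (\<Sum>i\<in>I. cnj (c i) * L2_inner g (f i))"
proof -
  have "L2_inner g (\<lambda>x. \<Sum>i\<in>I. c i * f i x) = cnj (\<Sum>i\<in>I. c i * L2_inner (f i) g)"
    using L2_inner_sum_left[OF assms, where c = c] by (subst L2_inner_commute) simp
  also have "\<dots> = (\<Sum>i\<in>I. cnj (c i) * L2_inner g (f i))"
    by (simp flip: L2_inner_commute)
  finally show ?thesis .
qed

lemma D_pow_L2: "w \<in> C0_k n \<Longrightarrow> k \<le> n \<Longrightarrow> (D ^^ k) w \<in> L2"
  using C0_k_in_L2 C0_k_D_pow by blast

lemma L2_inner_poly_D_left:
  assumes "w \<in> C0_k (degree Q)" "g \<in> L2"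
  shows "L2_inner (poly_D Q w) g = (\<Sum>k\<le>degree Q. of_real (coeff Q k) * L2_inner ((D ^^ k) w) g)"
  unfolding poly_D_def using assms by (intro L2_inner_sum_left) (auto intro: D_pow_L2)

lemma poly_D_symmetric:
  assumes w: "w \<in> C0_k (degree Q)" and u: "u \<in> C0_k (degree Q)"
  shows "L2_inner (poly_D Q w) u = L2_inner w (poly_D Q u)"
proof -
  have "L2_inner (poly_D Q w) u = (\<Sum>k\<le>degree Q. of_real (coeff Q k) * L2_inner ((D ^^ k) w) u)"
    using w C0_k_in_L2[OF u] by (rule L2_inner_poly_D_left)
  also have "\<dots> = (\<Sum>k\<le>degree Q. cnj (of_real (coeff Q k)) * L2_inner w ((D ^^ k) u))"
    using D_pow_symmetric[OF w u, of 0] by simp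
  also have "\<dots> = L2_inner w (poly_D Q u)"
    unfolding poly_D_def using u C0_k_in_L2[OF w]
    by (intro L2_inner_sum_right[symmetric]) (auto intro: D_pow_L2)
  finally show ?thesis .
qed

definition weighted_op :: "(real \<Rightarrow> real) \<Rightarrow> real poly \<Rightarrow> (real \<Rightarrow> complex) \<Rightarrow> real \<Rightarrow> complex" where
  "weighted_op v Q g = (\<lambda>\<xi>. of_real (v \<xi>) * poly_D Q (\<lambda>\<eta>. of_real (v \<eta>) * g \<eta>) \<xi>)"

lemma A0_eq: "A0 v Q = {(g, weighted_op v Q g) | g. g \<in> C0_k (degree Q)}"
  unfolding A0_def weighted_op_def by auto

lemma C0_k_weight:
  assumes "C_k n v" "g \<in> C0_k n"
  shows "(\<lambda>\<eta>. of_real (v \<eta>) * g \<eta> :: complex) \<in> C0_k n"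
  by (rule C0_k_mult[OF C_k_of_real[OF assms(1)] assms(2)])

lemma weighted_op_C0:
  assumes "C_k (degree Q) v" "g \<in> C0_k (degree Q)"
  shows "weighted_op v Q g \<in> C0_k 0"
proof -
  let ?w = "\<lambda>\<eta>. of_real (v \<eta>) * g \<eta> :: complex"
  have w: "?w \<in> C0_k (degree Q)" by (rule C0_k_weight[OF assms])
  obtain a b where ab: "\<And>x. x \<notin> {a..b} \<Longrightarrow> ?w x = 0" using C0_k_support[OF w] by blast
  show ?thesis
  proof (rule C0_kI)
    show "C_k 0 (weighted_op v Q g)" unfolding C_k_0 weighted_op_def
      using C_k_continuous[OF assms(1)] continuous_poly_D[OF C0_kD[OF w]] by (intro continuous_intros)
    show "weighted_op v Q g x = 0" if "x \<notin> {a..b}" for x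
      using poly_D_outside[OF ab that] by (simp add: weighted_op_def)
  qed
qed

lemma weighted_op_lincomb:
  assumes "C_k (degree Q) v" "f \<in> C0_k (degree Q)" "g \<in> C0_k (degree Q)"
  shows "weighted_op v Q (\<lambda>x. a * f x + b * g x) = (\<lambda>x. a * weighted_op v Q f x + b * weighted_op v Q g x)"
proof
  fix x
  have "(\<lambda>x. of_real (v x) * (a * f x + b * g x)) = (\<lambda>x. a * (of_real (v x) * f x) + b * (of_real (v x) * g x))"
    by (simp add: algebra_simps)
  then show "weighted_op v Q (\<lambda>x. a * f x + b * g x) x = a * weighted_op v Q f x + b * weighted_op v Q g x"
    using poly_D_lincomb[OF C0_kD[OF C0_k_weight[OF assms(1,2)]] C0_kD[OF C0_k_weight[OF assms(1,3)]], of a b x]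
    by (simp add: weighted_op_def algebra_simps)
qed

text \<open>
  The substitution \<open>w = v g\<close> removes the weight from the quadratic form.
\<close>
lemma L2_inner_weighted_op:
  "L2_inner (weighted_op v Q f) g = L2_inner (poly_D Q (\<lambda>x. of_real (v x) * f x)) (\<lambda>x. of_real (v x) * g x)"
  "L2_inner f (weighted_op v Q g) = L2_inner (\<lambda>x. of_real (v x) * f x) (poly_D Q (\<lambda>x. of_real (v x) * g x))"
  unfolding L2_inner_def weighted_op_def by (simp_all add: mult_ac)

lemma symmetric_op_A0:
  assumes v: "C_k (degree Q) v"
  shows "symmetric_op (A0 v Q)"
proof -
  have "L2_inner (weighted_op v Q f) g = L2_inner f (weighted_op v Q g)"
    if "f \<in> C0_k (degree Q)" "g \<in> C0_k (degree Q)" for f g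
    unfolding L2_inner_weighted_op using poly_D_symmetric[OF C0_k_weight[OF v] C0_k_weight[OF v]] that by blast
  moreover have "A0 v Q \<subseteq> L2 \<times> L2"
    using C0_k_in_L2 weighted_op_C0[OF v] unfolding A0_eq by blast
  ultimately show ?thesis
    unfolding symmetric_op_def using C0_k_lincomb weighted_op_lincomb[OF v]
    by (auto simp: A0_eq)
qed

lemma symmetric_op_A: "C_k (degree Q) v \<Longrightarrow> symmetric_op (A v Q)"
  unfolding A_def by (intro symmetric_op_closure symmetric_op_A0)

lemma weighted_op_in_A:
  assumes "C_k (degree Q) v" "g \<in> C0_k (degree Q)"
  shows "(g, weighted_op v Q g) \<in> A v Q"
  using subset_op_closure[of "A0 v Q"] symmetric_op_A0[OF assms(1)] assms(2)
  unfolding A_def symmetric_op_def by (auto simp: A0_eq)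

section \<open>Nonnegative polynomials\<close>

abbreviation cpoly :: "real poly \<Rightarrow> complex \<Rightarrow> complex" where
  "cpoly p z \<equiv> poly (map_poly of_real p) z"

lemma cpoly_simps:
  "cpoly 0 z = 0" "cpoly (pCons a p) z = of_real a + z * cpoly p z"
  by (simp_all add: map_poly_pCons)

lemma cpoly_add: "cpoly (p + q) z = cpoly p z + cpoly q z"
  by (induction p q rule: poly_induct2) (simp_all add: cpoly_simps algebra_simps)

lemma cpoly_smult: "cpoly (smult a p) z = of_real a * cpoly p z"
  by (induction p) (simp_all add: cpoly_simps algebra_simps)

lemma cpoly_mult: "cpoly (p * q) z = cpoly p z * cpoly q z"
  by (induction p) (simp_all add: cpoly_simps cpoly_add cpoly_smult algebra_simps)

lemma cpoly_of_real: "cpoly p (of_real x) = of_real (poly p x)"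
  by (induction p) (simp_all add: cpoly_simps)

lemma real_quadratic_of_root:
  fixes z :: complex
  defines "R \<equiv> [:(cmod z)\<^sup>2, - 2 * Re z, 1:]"
  shows "poly R x = (x - Re z)\<^sup>2 + (Im z)\<^sup>2" and "cpoly R z = 0"
proof -
  show "poly R x = (x - Re z)\<^sup>2 + (Im z)\<^sup>2"
    using cmod_power2[of z] by (simp add: R_def power2_eq_square algebra_simps)
  show "cpoly R z = 0"
    using cmod_power2[of z] by (simp add: R_def cpoly_simps complex_eq_iff power2_eq_square algebra_simps)
qed

text \<open>
  A complex root \<open>z\<close> of \<open>Q\<close> gives the real quadratic \<open>R = (x - Re z)\<^sup>2 + (Im z)\<^sup>2\<close>, and the remainder of \<open>Q\<close> modulo
  \<open>R\<close> is linear and vanishes at \<open>z\<close>. For nonreal \<open>z\<close> it is therefore zero; for real \<open>z\<close> its slope is \<open>Q'(z)\<close>, which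
  vanishes because \<open>Q\<close> has a minimum there.
\<close>
lemma nonneg_poly_quadratic_factor:
  assumes nonneg: "\<And>x. poly Q x \<ge> 0" and deg: "degree Q > 0"
  obtains a b :: real and S where
    "Q = ([:- a, 1:]\<^sup>2 + [:b:]\<^sup>2) * S" "\<And>x. poly S x \<ge> 0" "degree Q = degree S + 2"
proof -
  have "degree (map_poly complex_of_real Q) > 0"
    using deg by (simp add: degree_map_poly)
  then have "\<not> constant (poly (map_poly complex_of_real Q))"
    by (simp add: constant_degree)
  then obtain z where z: "cpoly Q z = 0" using fundamental_theorem_of_algebra by blast
  define R where "R = [:(cmod z)\<^sup>2, - 2 * Re z, 1:]"
  define S T where "S = Q div R" and "T = Q mod R"
  have Q: "Q = R * S + T" by (simp add: S_def T_def)
  have R: "poly R x = (x - Re z)\<^sup>2 + (Im z)\<^sup>2" "cpoly R z = 0" for x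
    using real_quadratic_of_root[of z] by (simp_all add: R_def)
  have "degree T \<le> 1"
    using degree_mod_less[of R Q] by (auto simp: T_def R_def)
  have "\<exists>c d. T = [:c, d:]"
  proof (cases "degree T = 0")
    case True
    then obtain c where "T = [:c:]" by (rule degree_eq_zeroE)
    then show ?thesis by (intro exI[of _ c] exI[of _ 0]) simp
  next
    case False
    then have "degree T = 1" using \<open>degree T \<le> 1\<close> by simp
    then show ?thesis by (rule degree1_coeffs) blast
  qed
  then obtain c d where T: "T = [:c, d:]" by blast
  have Tz: "of_real c + z * of_real d = 0"
    using z unfolding Q cpoly_add cpoly_mult R(2) T by (simp add: cpoly_simps)
  have d: "d = 0"
  proof (cases "Im z = 0")
    case False
    from arg_cong[OF Tz, of Im] False show ?thesis by simp
  next
    case True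
    then have "poly Q (Re z) = 0" using z cpoly_of_real[of Q "Re z"]
      by (simp add: complex_is_Real_iff[symmetric])
    then have "poly (pderiv Q) (Re z) = 0"
      using nonneg DERIV_local_min[OF poly_DERIV[of Q "Re z"], of 1] by simp
    moreover have "poly (pderiv R) (Re z) = 0" by (simp add: R_def pderiv_pCons)
    moreover have "poly R (Re z) = 0" using True R(1) by simp
    ultimately show ?thesis
      unfolding Q by (simp add: pderiv_add pderiv_mult T pderiv_pCons)
  qed
  then have "c = 0" using arg_cong[OF Tz, of Re] by simp
  with d T Q have QRS: "Q = R * S" by simp
  have "poly S x \<ge> 0" for x
  proof -
    have *: "poly S x \<ge> 0" if "x \<noteq> Re z" for x
    proof -
      have "poly R x > 0" using that R(1)[of x] by (simp add: sum_power2_gt_zero_iff add_pos_nonneg)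
      moreover have "poly R x * poly S x \<ge> 0" using nonneg[of x] QRS by simp
      ultimately show ?thesis by (simp add: zero_le_mult_iff)
    qed
    have "closed {x. poly S x \<ge> 0}" by (intro closed_Collect_le continuous_intros)
    then have "closure (- {Re z}) \<subseteq> {x. poly S x \<ge> 0}" using * by (intro closure_minimal) auto
    then show ?thesis by (auto simp: closure_complement)
  qed
  moreover have "R = [:- Re z, 1:]\<^sup>2 + [:Im z:]\<^sup>2"
    using cmod_power2[of z] by (simp add: R_def power2_eq_square)
  moreover have "degree Q = degree S + 2"
  proof -
    have "R \<noteq> 0" "S \<noteq> 0" using QRS deg by auto
    then have "degree (R * S) = degree R + degree S" by (rule degree_mult_eq)
    moreover have "degree R = 2" by (simp add: R_def)
    ultimately show ?thesis using QRS by simp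
  qed
  ultimately show ?thesis using that QRS by blast
qed

text \<open>
  Sums of two squares are closed under multiplication, so the quadratic factors can be collected one at a time. The
  degree bounds ensure that \<open>p(D) w\<close> still has enough derivatives left to move \<open>p(D)\<close> across the inner product.
\<close>
lemma nonneg_poly_sum_of_squares:
  assumes "\<And>x. poly Q x \<ge> (0::real)"
  shows "\<exists>p r. Q = p\<^sup>2 + r\<^sup>2 \<and> 2 * degree p \<le> degree Q \<and> 2 * degree r \<le> degree Q"
  using assms
proof (induction "degree Q" arbitrary: Q rule: less_induct)
  case less
  show ?case
  proof (cases "degree Q = 0")
    case True
    then obtain c where c: "Q = [:c:]" by (rule degree_eq_zeroE)
    then have "c \<ge> 0" using less(2)[of 0] by simp
    then have "Q = [:sqrt c:]\<^sup>2 + 0\<^sup>2" by (simp add: c power2_eq_square)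
    then show ?thesis by (intro exI[of _ "[:sqrt c:]"] exI[of _ 0]) simp
  next
    case False
    then obtain a b S where S: "Q = ([:- a, 1:]\<^sup>2 + [:b:]\<^sup>2) * S" "\<And>x. poly S x \<ge> 0"
      "degree Q = degree S + 2"
      using nonneg_poly_quadratic_factor[OF less(2)] by auto
    then obtain p r where pr: "S = p\<^sup>2 + r\<^sup>2" "2 * degree p \<le> degree S" "2 * degree r \<le> degree S"
      using less(1)[of S] by auto
    have deg: "degree ([:- a, 1:] * u) \<le> degree u + 1" "degree ([:b:] * u) \<le> degree u" for u
      using degree_mult_le[of "[:- a, 1:]" u] degree_mult_le[of "[:b:]" u] by simp_all
    have "Q = ([:- a, 1:] * p - [:b:] * r)\<^sup>2 + ([:b:] * p + [:- a, 1:] * r)\<^sup>2"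
    proof -
      have "(s\<^sup>2 + t\<^sup>2) * (p\<^sup>2 + r\<^sup>2) = (s * p - t * r)\<^sup>2 + (t * p + s * r)\<^sup>2" for s t :: "real poly"
        by (simp add: power2_eq_square algebra_simps)
      then show ?thesis unfolding S(1) pr(1) .
    qed
    moreover have "2 * degree ([:- a, 1:] * p - [:b:] * r) \<le> degree Q"
      using degree_diff_le[of "[:- a, 1:] * p" "degree S div 2 + 1" "[:b:] * r"] deg[of p] deg[of r] pr(2,3) S(3)
      by linarith
    moreover have "2 * degree ([:b:] * p + [:- a, 1:] * r) \<le> degree Q"
      using degree_add_le[of "[:b:] * p" "degree S div 2 + 1" "[:- a, 1:] * r"] deg[of p] deg[of r] pr(2,3) S(3)
      by linarith
    ultimately show ?thesis by blast
  qed
qed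

lemma poly_D_0 [simp]: "poly_D 0 f x = 0"
  by (simp add: poly_D_def)

text \<open>
  Horner form of the functional calculus, which turns its algebraic properties into inductions over the coefficients.
\<close>
lemma poly_D_pCons: "poly_D (pCons a p) f x = of_real a * f x + poly_D p (D f) x"
proof -
  have "poly_D (pCons a p) f x = (\<Sum>k\<le>Suc (degree p). of_real (coeff (pCons a p) k) * (D ^^ k) f x)"
    by (rule poly_D_altdef) (simp add: degree_pCons_le)
  also have "\<dots> = of_real a * f x + (\<Sum>k\<le>degree p. of_real (coeff p k) * (D ^^ k) (D f) x)"
    by (subst sum.atMost_Suc_shift) (simp add: funpow_swap1)
  finally show ?thesis by (simp add: poly_D_def)
qed

lemma poly_D_add: "poly_D (p + q) f x = poly_D p f x + poly_D q f x"
proof -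
  let ?n = "max (degree p) (degree q)"
  have "degree (p + q) \<le> ?n" by (rule degree_add_le_max)
  then show ?thesis
    by (subst (1 2 3) poly_D_altdef[where n = ?n]) (auto simp: sum.distrib algebra_simps)
qed

lemma poly_D_smult: "poly_D (smult a p) f x = of_real a * poly_D p f x"
  by (subst (1 2) poly_D_altdef[where n = "degree p"]) (auto simp: sum_distrib_left mult_ac degree_smult_le)

lemma C_k_poly_D:
  assumes "C_k n f" "degree q \<le> n"
  shows "C_k (n - degree q) (poly_D q f)"
  unfolding poly_D_def using assms
  by (intro C_k_sum C_k_mult C_k_const) (auto intro: C_k_mono[OF C_k_D_pow])

lemma D_lincomb:
  assumes "C_k (Suc n) f" "C_k (Suc n) g"
  shows "D (\<lambda>x. a * f x + b * g x) = (\<lambda>x. a * D f x + b * D g x)"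
  using D_pow_lincomb[OF assms, of 1 a b] by auto

lemma D_poly_D:
  "C_k (Suc (degree q)) f \<Longrightarrow> D (poly_D q f) = poly_D q (D f)"
proof (induction q arbitrary: f)
  case 0
  have "D (\<lambda>_. 0) = (\<lambda>_. 0)" by (rule ext) (simp add: D_def)
  then show ?case by (simp add: fun_eq_iff[of "poly_D 0 _"] poly_D_def)
next
  case (pCons a q)
  show ?case
  proof (cases "q = 0")
    case True
    have "poly_D (pCons a q) g = (\<lambda>x. of_real a * g x + 0 * g x)" for g
      using True by (simp add: fun_eq_iff poly_D_pCons)
    then show ?thesis using D_lincomb[of 0 f f "of_real a" 0] pCons.prems True by simp
  next
    case False
    then have n: "C_k (Suc (Suc (degree q))) f" using pCons.prems by simp
    have "D (poly_D (pCons a q) f) = D (\<lambda>x. of_real a * f x + 1 * poly_D q (D f) x)"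
      by (intro arg_cong[where f = D] ext) (simp add: poly_D_pCons)
    also have "\<dots> = (\<lambda>x. of_real a * D f x + 1 * D (poly_D q (D f)) x)"
      using C_k_poly_D[OF C_k_D[OF n], of q] C_k_mono[OF n, of 1]
      by (intro D_lincomb[of 0]) auto
    also have "\<dots> = poly_D (pCons a q) (D f)"
      using pCons.IH[OF C_k_D[OF n]] by (auto simp: poly_D_pCons)
    finally show ?thesis .
  qed
qed

lemma poly_D_mult:
  "C_k (degree p + degree q) f \<Longrightarrow> poly_D (p * q) f x = poly_D p (poly_D q f) x"
proof (induction p arbitrary: f)
  case (pCons a p)
  show ?case
  proof (cases "p = 0")
    case True
    then show ?thesis by (simp add: poly_D_pCons poly_D_smult)
  next
    case False
    then have n: "C_k (Suc (degree p + degree q)) f" using pCons.prems by simp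
    have "poly_D (pCons a p * q) f x = of_real a * poly_D q f x + poly_D (p * q) (D f) x"
      by (simp add: poly_D_add poly_D_smult poly_D_pCons)
    also have "poly_D (p * q) (D f) x = poly_D p (D (poly_D q f)) x"
      using pCons.IH[OF C_k_D[OF n]] D_poly_D[OF C_k_mono[OF n, of "Suc (degree q)"]] by simp
    finally show ?thesis by (simp add: poly_D_pCons)
  qed
qed simp

lemma C0_k_poly_D:
  assumes "w \<in> C0_k n" "degree q \<le> n"
  shows "poly_D q w \<in> C0_k (n - degree q)"
proof -
  obtain a b where ab: "\<And>x. x \<notin> {a..b} \<Longrightarrow> w x = 0" using C0_k_support[OF assms(1)] by blast
  then show ?thesis
    using C_k_poly_D[OF C0_kD[OF assms(1)] assms(2)] poly_D_outside[OF ab] by (intro C0_kI[of _ _ a b])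
qed

lemma L2_inner_poly_D_square:
  assumes "w \<in> C0_k n" "2 * degree p \<le> n"
  shows "L2_inner (poly_D (p\<^sup>2) w) w = of_real ((L2_norm (poly_D p w))\<^sup>2)"
proof -
  have "L2_inner (poly_D (p\<^sup>2) w) w = L2_inner (poly_D p (poly_D p w)) w"
    using poly_D_mult[of p p w] C_k_mono[OF C0_kD[OF assms(1)], of "degree p + degree p"] assms(2)
    by (simp add: power2_eq_square L2_inner_def)
  also have "\<dots> = L2_inner (poly_D p w) (poly_D p w)"
    using C0_k_mono[OF C0_k_poly_D[OF assms(1), of p], of "degree p"] C0_k_mono[OF assms(1), of "degree p"] assms(2)
    by (intro poly_D_symmetric) auto
  also have "\<dots> = of_real ((L2_norm (poly_D p w))\<^sup>2)"
    unfolding L2_norm_sq using L2_inner_commute[of "poly_D p w" "poly_D p w"]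
    by (simp add: complex_eq_iff)
  finally show ?thesis .
qed

lemma L2_inner_poly_D_nonneg:
  assumes nonneg: "\<And>x. poly Q x \<ge> 0" and w: "w \<in> C0_k (degree Q)"
  shows "L2_inner (poly_D Q w) w \<in> \<real>\<^sub>\<ge>\<^sub>0"
proof -
  obtain p r where pr: "Q = p\<^sup>2 + r\<^sup>2" "2 * degree p \<le> degree Q" "2 * degree r \<le> degree Q"
    using nonneg_poly_sum_of_squares[OF nonneg] by blast
  have deg: "degree (u\<^sup>2) \<le> degree Q" if "2 * degree u \<le> degree Q" for u :: "real poly"
    using that degree_mult_le[of u u] by (simp add: power2_eq_square)
  have L2: "poly_D (u\<^sup>2) w \<in> L2" if "2 * degree u \<le> degree Q" for u
    using C0_k_in_L2[OF C0_k_poly_D[OF w deg[OF that]]] .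
  have "L2_inner (poly_D Q w) w = L2_inner (\<lambda>x. 1 * poly_D (p\<^sup>2) w x + 1 * poly_D (r\<^sup>2) w x) w"
    by (subst pr(1)) (simp add: poly_D_add L2_inner_def)
  also have "\<dots> = of_real ((L2_norm (poly_D p w))\<^sup>2 + (L2_norm (poly_D r w))\<^sup>2)"
    using L2_inner_lincomb_left[OF L2[OF pr(2)] L2[OF pr(3)] C0_k_in_L2[OF w], of 1 1]
      L2_inner_poly_D_square[OF w pr(2)] L2_inner_poly_D_square[OF w pr(3)] by simp
  finally show ?thesis by (simp del: of_real_add of_real_power)
qed

section \<open>Negative wave packets\<close>

text \<open>
  Used both for building a bump function and for cutting off solutions of differential equations.
\<close>
lemma has_vector_derivative_cut:
  fixes f :: "real \<Rightarrow> complex"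
  assumes f: "\<And>x. (f has_vector_derivative f' x) (at x)" and b: "f b = 0" "f' b = 0"
  shows "((\<lambda>x. if x \<le> b then f x else 0) has_vector_derivative (if x \<le> b then f' x else 0)) (at x)"
proof -
  have "((\<lambda>x. if x \<in> {..b} then f x else (\<lambda>_. 0) x) has_vector_derivative
      (if x \<in> {..b} then f' x else (\<lambda>_. 0) x)) (at x within UNIV)"
    using b by (intro has_vector_derivative_If_within_closures[where T = "{b<..}"])
      (auto intro: has_vector_derivative_at_within[OF f])
  then show ?thesis by simp
qed

text \<open>
  The power \<open>max(0, -x)\<close> to the \<open>n + 1\<close>, which is of class \<open>C\<^sup>n\<close>.
\<close>
definition half_power :: "nat \<Rightarrow> real \<Rightarrow> complex" where
  "half_power n x = (if x \<le> 0 then (of_real (- x)) ^ Suc n else 0)"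

lemma C_k_half_power: "C_k n (half_power n)"
proof (induction n)
  case 0
  have "half_power 0 = (\<lambda>x. of_real (max 0 (- x)))" by (auto simp: half_power_def max_def)
  then show ?case by (simp add: C_k_0) (intro continuous_intros)
next
  case (Suc n)
  have "(half_power (Suc n) has_vector_derivative - of_nat (Suc (Suc n)) * half_power n x) (at x)" for x
  proof -
    have "((\<lambda>x. of_real ((- x) ^ Suc (Suc n)) :: complex) has_vector_derivative
        of_real (- (real (Suc (Suc n)) * (- x) ^ Suc n))) (at x)" for x
      by (intro has_vector_derivative_of_real) (auto intro!: derivative_eq_intros simp del: power_Suc)
    from has_vector_derivative_cut[OF this, of 0]
    have "((\<lambda>x. if x \<le> 0 then of_real ((- x) ^ Suc (Suc n)) else (0::complex)) has_vector_derivative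
        (if x \<le> 0 then of_real (- (real (Suc (Suc n)) * (- x) ^ Suc n)) else 0)) (at x)" by simp
    moreover have "(\<lambda>x. if x \<le> 0 then of_real ((- x) ^ Suc (Suc n)) else (0::complex)) = half_power (Suc n)"
      by (auto simp: half_power_def)
    moreover have "(if x \<le> 0 then of_real (- (real (Suc (Suc n)) * (- x) ^ Suc n)) else 0) =
        - of_nat (Suc (Suc n)) * half_power n x" by (simp add: half_power_def algebra_simps)
    ultimately show ?thesis by simp
  qed
  then show ?case by (rule C_k_SucI) (intro C_k_mult C_k_const Suc)
qed

text \<open>
  The function \<open>(x (1 - x))\<^sup>n\<^sup>+\<^sup>1\<close> on the unit interval, extended by zero.
\<close>
lemma bump_exists:
  obtains \<phi> where "C_k n \<phi>" "\<And>x. x \<notin> {0..1} \<Longrightarrow> \<phi> x = 0" "L2_norm \<phi> > 0"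
proof
  define \<phi> where "\<phi> x = half_power n (0 + (-1) * x) * half_power n (- 1 + 1 * x)" for x
  show C: "C_k n \<phi>" unfolding \<phi>_def by (intro C_k_mult C_k_affine C_k_half_power)
  show supp: "\<phi> x = 0" if "x \<notin> {0..1}" for x using that by (auto simp: \<phi>_def half_power_def)
  have "\<phi> \<in> C0_k n" by (rule C0_kI[OF C supp])
  then have L2: "\<phi> \<in> L2" by (rule C0_k_in_L2)
  \<comment> \<open>On \<open>[1/4, 3/4]\<close> both factors \<open>x\<close> and \<open>1 - x\<close> are at least \<open>1/4\<close>.\<close>
  define m :: real where "m = (1 / 4) ^ (4 * Suc n)"
  have "0 < m / 2" by (simp add: m_def)
  also have "m / 2 = (LINT x|lborel. m * indicator {1/4..3/4} (x::real))" by simp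
  also have "\<dots> \<le> (LINT x|lborel. (cmod (\<phi> x))\<^sup>2)"
  proof (rule integral_mono)
    show "integrable lborel (\<lambda>x. (cmod (\<phi> x))\<^sup>2)" by (rule L2_sq_integrable[OF L2])
    show "m * indicator {1/4..3/4} x \<le> (cmod (\<phi> x))\<^sup>2" for x
    proof (cases "x \<in> {1/4..3/4}")
      case True
      then have "(1 / 4) ^ Suc n * (1 / 4) ^ Suc n \<le> x ^ Suc n * (1 - x) ^ Suc n"
        by (intro mult_mono power_mono) auto
      also have "\<dots> = cmod (\<phi> x)"
        using True by (simp add: \<phi>_def half_power_def norm_mult norm_power flip: of_real_diff)
      finally have "((1 / 4) ^ Suc n * (1 / 4) ^ Suc n)\<^sup>2 \<le> (cmod (\<phi> x))\<^sup>2"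
        by (intro power_mono) auto
      moreover have "((1 / 4 :: real) ^ Suc n * (1 / 4) ^ Suc n)\<^sup>2 = m"
      proof -
        have "(Suc n + Suc n) * 2 = 4 * Suc n" by simp
        then show ?thesis unfolding m_def by (simp only: power_add[symmetric] power_mult[symmetric])
      qed
      ultimately have "m \<le> (cmod (\<phi> x))\<^sup>2" by (simp only:)
      then show ?thesis using True by simp
    qed simp
  next
    show "integrable lborel (\<lambda>x. m * indicator {1/4..3/4} (x::real))"
      using borel_integrable_atLeastAtMost'[of "1/4" "3/4" "\<lambda>_. m"]
      by (simp add: set_integrable_def mult.commute)
  qed
  finally show "L2_norm \<phi> > 0" by (simp add: L2_norm_def)
qed

text \<open>
  The eigenfunction of \<open>D = \<i> d/dx\<close> with eigenvalue \<open>x0\<close>.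
\<close>
definition wave :: "real \<Rightarrow> real \<Rightarrow> complex" where
  "wave x0 x = exp (- \<i> * of_real (x0 * x))"

lemma wave_derivative: "(wave x0 has_vector_derivative - \<i> * of_real x0 * wave x0 x) (at x)"
proof -
  have "((\<lambda>x. - \<i> * of_real (x0 * x)) has_vector_derivative - \<i> * of_real x0) (at x)"
    by (intro has_vector_derivative_mult_right has_vector_derivative_of_real) (auto intro!: derivative_eq_intros)
  from field_vector_diff_chain_at[OF this DERIV_exp] show ?thesis
    by (simp add: wave_def[abs_def] o_def)
qed

lemma C_k_wave: "C_k n (wave x0)"
proof (induction n)
  case 0
  then show ?case unfolding C_k_0 wave_def by (intro continuous_intros)
next
  case (Suc n)
  show ?case by (rule C_k_SucI[OF wave_derivative]) (intro C_k_mult C_k_const Suc)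
qed

lemma wave_unimodular: "wave x0 x * cnj (wave x0 x) = 1"
  by (simp add: wave_def exp_cnj flip: exp_add)

lemma D_wave_mult:
  assumes "C_k (Suc n) f"
  shows "D (\<lambda>x. wave x0 x * f x) x = wave x0 x * (of_real x0 * f x + D f x)"
proof -
  have "((\<lambda>x. wave x0 x * f x) has_vector_derivative
      (wave x0 x * (- \<i> * D f x) + (- \<i> * of_real x0 * wave x0 x) * f x)) (at x)"
    by (intro has_vector_derivative_mult wave_derivative has_vector_derivative_D[OF assms])
  from D_eqI[OF this] show ?thesis by (simp add: algebra_simps)
qed

text \<open>
  Conjugation by the plane wave shifts \<open>D\<close> to \<open>D + x0\<close>.
\<close>
lemma poly_D_wave_mult:
  "C_k (degree Q) f \<Longrightarrow>
    poly_D Q (\<lambda>x. wave x0 x * f x) x = wave x0 x * poly_D (pcompose Q [:x0, 1:]) f x"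
proof (induction Q arbitrary: f x)
  case (pCons a p)
  show ?case
  proof (cases "p = 0")
    case True
    then show ?thesis by (simp add: poly_D_pCons pcompose_pCons)
  next
    case False
    define p' where "p' = pcompose p [:x0, 1:]"
    have n: "C_k (Suc (degree p)) f" using pCons.prems False by simp
    have m: "C_k (degree p) (\<lambda>x. of_real x0 * f x + D f x)"
      using C_k_mono[OF n, of "degree p"] by (intro C_k_add C_k_mult C_k_const C_k_D[OF n]) auto
    have deg: "degree p' = degree p" by (simp add: p'_def degree_pcompose)
    have "D (\<lambda>x. wave x0 x * f x) = (\<lambda>x. wave x0 x * (of_real x0 * f x + D f x))"
      by (rule ext) (rule D_wave_mult[OF n])
    then have "poly_D (pCons a p) (\<lambda>x. wave x0 x * f x) x =
        of_real a * (wave x0 x * f x) + poly_D p (\<lambda>x. wave x0 x * (of_real x0 * f x + D f x)) x"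
      by (simp add: poly_D_pCons)
    also have "\<dots> = wave x0 x * (of_real a * f x + poly_D p' (\<lambda>x. of_real x0 * f x + 1 * D f x) x)"
      using pCons.IH[OF m] by (simp add: p'_def algebra_simps)
    also have "poly_D p' (\<lambda>x. of_real x0 * f x + 1 * D f x) x = of_real x0 * poly_D p' f x + 1 * poly_D p' (D f) x"
      using C_k_mono[OF n, of "degree p"] C_k_D[OF n] by (intro poly_D_lincomb) (auto simp: deg)
    also have "of_real a * f x + (of_real x0 * poly_D p' f x + 1 * poly_D p' (D f) x) =
        poly_D (pcompose (pCons a p) [:x0, 1:]) f x"
      by (simp add: pcompose_pCons p'_def[symmetric] poly_D_add poly_D_smult poly_D_pCons)
    finally show ?thesis .
  qed
qed simp

lemma D_pow_affine:
  "C_k n f \<Longrightarrow> k \<le> n \<Longrightarrow> (D ^^ k) (\<lambda>x. f (t + c * x)) x = of_real c ^ k * (D ^^ k) f (t + c * x)"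
proof (induction k arbitrary: n f x)
  case (Suc k)
  then obtain n' where n: "n = Suc n'" by (cases n) auto
  have cf: "C_k (Suc n') f" using Suc.prems(1) unfolding n .
  have "D (\<lambda>x. f (t + c * x)) = (\<lambda>x. of_real c * D f (t + c * x) + 0 * D f (t + c * x))"
  proof
    fix x
    have "((\<lambda>x. t + c * x) has_vector_derivative c) (at x)"
      unfolding has_real_derivative_iff_has_vector_derivative[symmetric]
      by (auto intro!: derivative_eq_intros)
    from vector_diff_chain_at[OF this has_vector_derivative_D[OF cf]]
    have "((\<lambda>x. f (t + c * x)) has_vector_derivative c *\<^sub>R (- \<i> * D f (t + c * x))) (at x)"
      by (simp add: o_def)
    from D_eqI[OF this] show "D (\<lambda>x. f (t + c * x)) x = of_real c * D f (t + c * x) + 0 * D f (t + c * x)"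
      by (simp add: complex_eq_iff)
  qed
  then have "(D ^^ Suc k) (\<lambda>x. f (t + c * x)) x =
      (D ^^ k) (\<lambda>x. of_real c * D f (t + c * x) + 0 * D f (t + c * x)) x"
    by (simp add: funpow_swap1)
  also have "\<dots> = of_real c * (D ^^ k) (\<lambda>x. D f (t + c * x)) x + 0 * (D ^^ k) (\<lambda>x. D f (t + c * x)) x"
    using Suc.prems(2) n by (intro D_pow_lincomb[of n'] C_k_affine C_k_D cf) auto
  also have "\<dots> = of_real c ^ Suc k * (D ^^ Suc k) f (t + c * x)"
    using Suc.IH[OF C_k_D[OF cf]] Suc.prems(2) n by (simp add: funpow_swap1)
  finally show ?case .
qed simp

text \<open>
  For small \<open>\<epsilon>\<close> the term with \<open>k = 0\<close> dominates, and its coefficient is \<open>Q(x0)\<close>.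
\<close>
lemma L2_inner_poly_D_packet:
  fixes \<phi> :: "real \<Rightarrow> complex" and \<epsilon> t x0 :: real
  assumes \<phi>: "\<phi> \<in> C0_k (degree Q)" and \<epsilon>: "\<epsilon> > 0"
  defines "w \<equiv> \<lambda>x. wave x0 x * \<phi> (t + \<epsilon> * x)"
  shows "L2_inner (poly_D Q w) w = (\<Sum>k\<le>degree Q.
    of_real (coeff (pcompose Q [:x0, 1:]) k * \<epsilon> ^ k) * L2_inner ((D ^^ k) \<phi>) \<phi>) / of_real \<epsilon>"
proof -
  let ?P = "pcompose Q [:x0, 1:]"
  have deg: "degree ?P = degree Q" by (simp add: degree_pcompose)
  let ?F = "\<lambda>x. (\<Sum>k\<le>degree Q. of_real (coeff ?P k * \<epsilon> ^ k) * (D ^^ k) \<phi> x) * cnj (\<phi> x)"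
  have "poly_D Q w x * cnj (w x) = ?F (t + \<epsilon> * x)" for x
  proof -
    have "poly_D Q w x * cnj (w x) =
        poly_D ?P (\<lambda>x. \<phi> (t + \<epsilon> * x)) x * cnj (\<phi> (t + \<epsilon> * x)) * (wave x0 x * cnj (wave x0 x))"
      using poly_D_wave_mult[OF C_k_affine[OF C0_kD[OF \<phi>]]] by (simp add: w_def)
    then show ?thesis unfolding wave_unimodular
      using D_pow_affine[OF C0_kD[OF \<phi>], of _ t \<epsilon> x]
      by (simp add: poly_D_def deg mult.assoc)
  qed
  then have "L2_inner (poly_D Q w) w = (LINT x|lborel. ?F (t + \<epsilon> * x))"
    by (simp add: L2_inner_def)
  moreover have "(LINT x|lborel. ?F x) = \<epsilon> *\<^sub>R (LINT x|lborel. ?F (t + \<epsilon> * x))"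
    using lborel_integral_real_affine[of \<epsilon> ?F t] \<epsilon> by simp
  moreover have "(LINT x|lborel. ?F x) =
      (\<Sum>k\<le>degree Q. of_real (coeff ?P k * \<epsilon> ^ k) * L2_inner ((D ^^ k) \<phi>) \<phi>)"
    using L2_inner_sum_left[of "{..degree Q}" "\<lambda>k. (D ^^ k) \<phi>" \<phi> "\<lambda>k. of_real (coeff ?P k * \<epsilon> ^ k)"]
      D_pow_L2[OF \<phi>] C0_k_in_L2[OF \<phi>] by (simp add: L2_inner_def)
  ultimately show ?thesis using \<epsilon> by (simp add: scaleR_conv_of_real field_simps)
qed

text \<open>
  The packets \<open>w\<^sub>j = exp(-\<i> x0 x) \<phi>(\<epsilon> x - 2 j)\<close> all have the same form value, negative for small \<open>\<epsilon>\<close>, and pairwise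
  disjoint supports; dividing by \<open>v\<close> turns them into test functions for the weighted operator.
\<close>
lemma negative_wave_packets:
  fixes v :: "real \<Rightarrow> real"
  assumes neg: "poly Q x0 < 0" and v: "C_k (degree Q) v" and vpos: "\<And>x. v x > 0"
  shows "\<exists>(f :: nat \<Rightarrow> real \<Rightarrow> complex) a b. (\<forall>j. f j \<in> C0_k (degree Q)) \<and>
    (\<forall>j x. x \<notin> {a j..b j} \<longrightarrow> f j x = 0) \<and> (\<forall>j. a j \<le> b j) \<and> (\<forall>j. b j < a (Suc j)) \<and>
    (\<forall>j. Re (L2_inner (weighted_op v Q (f j)) (f j)) < 0)"
proof -
  obtain \<phi> where \<phi>: "C_k (degree Q) \<phi>" "\<And>x. x \<notin> {0..1} \<Longrightarrow> \<phi> x = 0" "L2_norm \<phi> > 0"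
    using bump_exists[of "degree Q"] by blast
  have \<phi>0: "\<phi> \<in> C0_k (degree Q)" by (rule C0_kI[OF \<phi>(1,2)])
  let ?P = "pcompose Q [:x0, 1:]"
  define I where "I k = Re (L2_inner ((D ^^ k) \<phi>) \<phi>)" for k
  define S where "S \<epsilon> = (\<Sum>k\<le>degree Q. coeff ?P k * \<epsilon> ^ k * I k)" for \<epsilon>
  have "S 0 = (\<Sum>k\<in>{0}. coeff ?P k * 0 ^ k * I k)"
    unfolding S_def by (rule sum.mono_neutral_right) (auto simp: power_0_left)
  also have "\<dots> = poly ?P 0 * (L2_norm \<phi>)\<^sup>2"
    by (simp add: I_def L2_norm_sq poly_0_coeff_0)
  also have "poly ?P 0 = poly Q x0" by (simp add: poly_pcompose)
  finally have "S 0 < 0" using neg \<phi>(3) by (simp add: mult_neg_pos)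
  moreover have "continuous_on UNIV S" unfolding S_def by (intro continuous_intros)
  then have "(S \<longlongrightarrow> S 0) (at_right 0)"
    unfolding continuous_on_eq_continuous_at[OF open_UNIV] by (auto simp: continuous_at intro: tendsto_mono[OF at_le])
  ultimately have "eventually (\<lambda>\<epsilon>. S \<epsilon> < 0) (at_right 0)" by (intro order_tendstoD)
  then obtain \<epsilon> where \<epsilon>: "\<epsilon> > 0" "S \<epsilon> < 0"
    using eventually_at_right_field[of "\<lambda>\<epsilon>. S \<epsilon> < 0" 0] dense[of 0] by auto
  define w where "w j x = wave x0 x * \<phi> (- 2 * real j + \<epsilon> * x)" for j x
  define f where "f j x = of_real (inverse (v x)) * w j x" for j x
  define a b where "a j = 2 * real j / \<epsilon>" and "b j = (2 * real j + 1) / \<epsilon>" for j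
  have w: "C_k (degree Q) (w j)" for j
    unfolding w_def by (intro C_k_mult C_k_wave C_k_affine \<phi>)
  have supp: "w j x = 0" if "x \<notin> {a j..b j}" for j x
  proof -
    have "- 2 * real j + \<epsilon> * x \<notin> {0..1}" using that \<epsilon>(1) by (auto simp: a_def b_def field_simps)
    then show ?thesis using \<phi>(2) by (simp add: w_def)
  qed
  have w0: "w j \<in> C0_k (degree Q)" for j by (rule C0_kI[OF w supp])
  have C: "f j \<in> C0_k (degree Q)" for j
    unfolding f_def using vpos
    by (intro C0_k_mult w0 C_k_of_real C_k_inverse v) (auto simp: less_le)
  have "Re (L2_inner (weighted_op v Q (f j)) (f j)) < 0" for j
  proof -
    have "(\<lambda>x. of_real (v x) * f j x) = w j" using vpos by (auto simp: f_def less_le)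
    then have "L2_inner (weighted_op v Q (f j)) (f j) = L2_inner (poly_D Q (w j)) (w j)"
      by (simp add: L2_inner_weighted_op)
    also have "\<dots> = (\<Sum>k\<le>degree Q. of_real (coeff ?P k * \<epsilon> ^ k) * L2_inner ((D ^^ k) \<phi>) \<phi>) / of_real \<epsilon>"
      unfolding w_def by (rule L2_inner_poly_D_packet[OF \<phi>0 \<epsilon>(1)])
    also have "Re \<dots> = S \<epsilon> / \<epsilon>"
      by (simp add: S_def I_def flip: of_real_power of_real_mult)
    finally show ?thesis using \<epsilon> by (simp add: divide_neg_pos)
  qed
  moreover have "b j < a (Suc j)" "a j \<le> b j" for j
    using \<epsilon>(1) by (auto simp: a_def b_def divide_strict_right_mono divide_right_mono)
  moreover have "f j x = 0" if "x \<notin> {a j..b j}" for j x using supp[OF that] by (simp add: f_def)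
  ultimately show ?thesis using C by (intro exI[of _ f] exI[of _ a] exI[of _ b]) simp
qed

section \<open>A Volterra equation and linear differential equations\<close>

text \<open>
  Integrals over empty intervals are zero, so the primitive vanishes to the left of \<open>a\<close>. Starting the integration at a
  point left of both \<open>a\<close> and \<open>x\<close> does not change it and makes \<open>x\<close> an interior point.
\<close>
lemma has_vector_derivative_primitive:
  fixes g :: "real \<Rightarrow> complex"
  assumes g: "continuous_on UNIV g" and z: "\<And>x. x \<le> a \<Longrightarrow> g x = 0"
  shows "((\<lambda>x. integral {a..x} g) has_vector_derivative g x) (at x)"
proof -
  define c where "c = min a x - 1"
  have cx: "c < x" by (simp add: c_def)
  have eq: "integral {c..y} g = integral {a..y} g" if "c < y" for y
  proof (cases "a \<le> y")
    case True
    have "integral {c..a} g + integral {a..y} g = integral {c..y} g"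
      using True by (intro Henstock_Kurzweil_Integration.integral_combine integrable_continuous_real
          continuous_on_subset[OF g]) (auto simp: c_def)
    moreover have "integral {c..a} g = integral {c..a} (\<lambda>_. 0)"
      by (intro Henstock_Kurzweil_Integration.integral_cong z) auto
    ultimately show ?thesis by simp
  next
    case False
    then have "integral {c..y} g = integral {c..y} (\<lambda>_. 0)"
      by (intro Henstock_Kurzweil_Integration.integral_cong z) auto
    then show ?thesis using False by simp
  qed
  have "((\<lambda>u. integral {c..u} g) has_vector_derivative g x) (at x within {c..x + 1})"
    by (intro integral_has_vector_derivative continuous_on_subset[OF g]) (auto simp: c_def)
  then have "((\<lambda>u. integral {c..u} g) has_vector_derivative g x) (at x within {c<..<x + 1})"
    by (rule has_vector_derivative_within_subset) auto
  then have "((\<lambda>u. integral {c..u} g) has_vector_derivative g x) (at x)"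
    by (subst (asm) at_within_open) (auto simp: c_def)
  then show ?thesis
    by (rule has_vector_derivative_transform_within_open[where S = "{c<..}"]) (use cx in \<open>auto simp: eq\<close>)
qed

text \<open>
  The primitive from \<open>a\<close>, conjugated by the weight \<open>exp(M x)\<close>. The weight makes the operator bounded on bounded functions
  on the whole line, with norm at most \<open>1/M\<close>, so that Volterra equations become contractions for large \<open>M\<close>.
\<close>
definition volterra_fun :: "real \<Rightarrow> real \<Rightarrow> (real \<Rightarrow> complex) \<Rightarrow> real \<Rightarrow> complex" where
  "volterra_fun M a h x = exp (- M * x) *\<^sub>R integral {a..x} (\<lambda>s. exp (M * s) *\<^sub>R h s)"

lemma volterra_fun_le [simp]: "x \<le> a \<Longrightarrow> volterra_fun M a h x = 0"
  by (cases "x = a") (auto simp: volterra_fun_def)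

lemma continuous_volterra_fun:
  assumes "continuous_on UNIV h"
  shows "continuous_on UNIV (volterra_fun M a h)"
proof -
  have "continuous_on {a..b} (volterra_fun M a h)" for b
  proof -
    have "(\<lambda>s. exp (M * s) *\<^sub>R h s) integrable_on {a..b}"
      by (intro integrable_continuous_real continuous_intros continuous_on_subset[OF assms]) auto
    from indefinite_integral_continuous_1[OF this] show ?thesis
      unfolding volterra_fun_def[abs_def] by (intro continuous_intros)
  qed
  then have "isCont (\<lambda>x. volterra_fun M a h (max a x)) y" for y
  proof -
    assume *: "\<And>b. continuous_on {a..b} (volterra_fun M a h)"
    have "continuous_on {..<y + 1} (\<lambda>x. volterra_fun M a h (max a x))"
      by (rule continuous_on_compose2[OF *[of "max a (y + 1)"]]) (auto intro!: continuous_intros)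
    then show ?thesis
      by (simp add: continuous_on_eq_continuous_at)
  qed
  moreover have "(\<lambda>x. volterra_fun M a h (max a x)) = volterra_fun M a h"
    by (auto simp: fun_eq_iff max_def)
  ultimately show ?thesis by (simp add: continuous_at_imp_continuous_on)
qed

lemma norm_volterra_fun_le:
  assumes h: "continuous_on UNIV h" and B: "\<And>x. cmod (h x) \<le> B" and M: "M > 0"
  shows "cmod (volterra_fun M a h x) \<le> B / M"
proof (cases "a \<le> x")
  case False
  have "0 \<le> B" using B[of 0] norm_ge_zero order_trans by blast
  then show ?thesis using False M by simp
next
  case True
  have "B \<ge> 0" using B[of 0] norm_ge_zero order_trans by blast
  have int: "((\<lambda>s. exp (M * s) * B) has_integral (exp (M * x) * B / M - exp (M * a) * B / M)) {a..x}"
  proof (rule fundamental_theorem_of_calculus[OF True])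
    show "((\<lambda>s. exp (M * s) * B / M) has_vector_derivative exp (M * s) * B) (at s within {a..x})" for s
      unfolding has_real_derivative_iff_has_vector_derivative[symmetric]
      using M by (auto intro!: derivative_eq_intros)
  qed
  have "cmod (integral {a..x} (\<lambda>s. exp (M * s) *\<^sub>R h s)) \<le> integral {a..x} (\<lambda>s. exp (M * s) * B)"
    using B int
    by (intro integral_norm_bound_integral integrable_continuous_real continuous_intros
        continuous_on_subset[OF h]) (auto simp: has_integral_integrable)
  also have "\<dots> = exp (M * x) * B / M - exp (M * a) * B / M" using int by (rule integral_unique)
  also have "\<dots> \<le> exp (M * x) * B / M" using M \<open>B \<ge> 0\<close> by simp
  finally have "exp (- M * x) * cmod (integral {a..x} (\<lambda>s. exp (M * s) *\<^sub>R h s)) \<le>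
      exp (- M * x) * (exp (M * x) * B / M)" by (intro mult_left_mono) auto
  also have "\<dots> = B / M" by (simp add: exp_minus field_simps)
  finally show ?thesis by (simp add: volterra_fun_def)
qed

definition volterra :: "real \<Rightarrow> real \<Rightarrow> (real \<Rightarrow>\<^sub>C complex) \<Rightarrow> (real \<Rightarrow>\<^sub>C complex)" where
  "volterra M a h = Bcontfun (volterra_fun M a h)"

lemma apply_volterra:
  assumes "M > 0"
  shows "apply_bcontfun (volterra M a h) = volterra_fun M a h"
  unfolding volterra_def
proof (rule Bcontfun_inverse, rule bcontfun_normI)
  show "cmod (volterra_fun M a (apply_bcontfun h) x) \<le> norm h / M" for x
    by (intro norm_volterra_fun_le norm_bounded assms) auto
qed (intro continuous_volterra_fun, auto)

lemma volterra_diff: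
  assumes "M > 0"
  shows "volterra M a h - volterra M a h' = volterra M a (h - h')"
proof (rule bcontfun_eqI)
  fix x
  have int: "(\<lambda>s. exp (M * s) *\<^sub>R apply_bcontfun u s) integrable_on {a..x}" for u :: "real \<Rightarrow>\<^sub>C complex"
    by (intro integrable_continuous_real continuous_intros) auto
  show "apply_bcontfun (volterra M a h - volterra M a h') x = apply_bcontfun (volterra M a (h - h')) x"
    using Henstock_Kurzweil_Integration.integral_diff[OF int[of h] int[of h']]
    by (simp add: apply_volterra[OF assms] volterra_fun_def scaleR_diff_right)
qed

lemma norm_volterra_le: "M > 0 \<Longrightarrow> norm (volterra M a h) \<le> norm h / M"
  by (rule norm_bound) (auto simp: apply_volterra intro!: norm_volterra_fun_le norm_bounded)

lemma dist_volterra_pow_le: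
  assumes "M \<ge> 1"
  shows "dist ((volterra M a ^^ Suc j) h) ((volterra M a ^^ Suc j) h') \<le> dist h h' / M"
proof (induction j)
  case 0
  then show ?case
    using norm_volterra_le[of M a "h - h'"] assms by (simp add: dist_norm volterra_diff)
next
  case (Suc j)
  have "dist ((volterra M a ^^ Suc (Suc j)) h) ((volterra M a ^^ Suc (Suc j)) h') \<le>
      dist ((volterra M a ^^ Suc j) h) ((volterra M a ^^ Suc j) h') / M"
    using norm_volterra_le[of M a "(volterra M a ^^ Suc j) h - (volterra M a ^^ Suc j) h'"] assms
    by (simp add: dist_norm volterra_diff)
  also have "\<dots> \<le> dist ((volterra M a ^^ Suc j) h) ((volterra M a ^^ Suc j) h')"
    using assms by (simp add: divide_le_eq mult_right_mono mult_le_cancel_left1)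
  finally show ?case using Suc by simp
qed

text \<open>
  The right-hand side, divided by \<open>q K\<close>, is a contraction of the space of bounded continuous functions: \<open>z\<close> enters it
  only through at least one application of the Volterra operator.
\<close>
lemma volterra_equation_solvable:
  fixes q :: "nat \<Rightarrow> complex" and P F :: "real \<Rightarrow>\<^sub>C complex"
  assumes K: "K \<ge> 1" and M: "M \<ge> 1" and qK: "q K \<noteq> 0"
    and M': "norm P + (\<Sum>k<K. cmod (q k)) < M * cmod (q K)"
  obtains z where "\<And>x. q K * apply_bcontfun z x = apply_bcontfun P x * apply_bcontfun ((volterra M a ^^ K) z) x
      + apply_bcontfun F x - (\<Sum>k<K. q k * apply_bcontfun ((volterra M a ^^ (K - k)) z) x)"
proof -
  let ?V = "\<lambda>j z. apply_bcontfun ((volterra M a ^^ j) z)"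
  define T where "T z x = (apply_bcontfun P x * ?V K z x + apply_bcontfun F x - (\<Sum>k<K. q k * ?V (K - k) z x)) / q K" for z x
  have qT: "q K * T z x = apply_bcontfun P x * ?V K z x + apply_bcontfun F x - (\<Sum>k<K. q k * ?V (K - k) z x)" for z x
    using qK by (simp add: T_def)
  define c where "c = (norm P + (\<Sum>k<K. cmod (q k))) / (M * cmod (q K))"
  have pos: "M * cmod (q K) > 0" using M qK by simp
  have c: "0 \<le> c" "c < 1" using M' pos by (auto simp: c_def sum_nonneg intro!: divide_nonneg_pos add_nonneg_nonneg)
  have V_le: "cmod (?V j z x - ?V j z' x) \<le> dist z z' / M" if j: "j \<ge> 1" for j z z' x
  proof -
    obtain j' where "j = Suc j'" using j by (cases j) auto
    then have "cmod (?V j z x - ?V j z' x) \<le> dist ((volterra M a ^^ j) z) ((volterra M a ^^ j) z')"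
      by (metis dist_bounded dist_norm)
    also have "\<dots> \<le> dist z z' / M" using dist_volterra_pow_le[OF M, where a = a and j = j' and h = z and h' = z'] \<open>j = Suc j'\<close> by simp
    finally show ?thesis .
  qed
  have T_le: "cmod (T z x - T z' x) \<le> c * dist z z'" for z z' x
  proof -
    have "q K * (T z x - T z' x) = apply_bcontfun P x * (?V K z x - ?V K z' x) - (\<Sum>k<K. q k * (?V (K - k) z x - ?V (K - k) z' x))"
      by (simp add: right_diff_distrib qT sum_subtractf)
    then have "cmod (q K) * cmod (T z x - T z' x) =
        cmod (apply_bcontfun P x * (?V K z x - ?V K z' x) - (\<Sum>k<K. q k * (?V (K - k) z x - ?V (K - k) z' x)))"
      by (simp flip: norm_mult)
    also have "\<dots> \<le> cmod (apply_bcontfun P x * (?V K z x - ?V K z' x)) +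
        cmod (\<Sum>k<K. q k * (?V (K - k) z x - ?V (K - k) z' x))"
      by (rule norm_triangle_ineq4)
    also have "\<dots> \<le> norm P * (dist z z' / M) + (\<Sum>k<K. cmod (q k) * (dist z z' / M))"
      unfolding norm_mult
      by (intro add_mono mult_mono norm_bounded V_le K sum_norm_le order_trans[OF eq_refl[OF norm_mult]])
         (auto intro!: V_le)
    also have "\<dots> = (norm P + (\<Sum>k<K. cmod (q k))) * (dist z z' / M)"
      by (simp only: sum_distrib_right distrib_right)
    also have "\<dots> = cmod (q K) * (c * dist z z')"
      using M qK by (simp add: c_def)
    finally show ?thesis using qK by simp
  qed
  have T_bcont: "T z \<in> bcontfun" for z
  proof (rule bcontfun_normI)
    show "continuous_on UNIV (T z)" unfolding T_def using qK by (intro continuous_intros) auto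
    show "cmod (T z x) \<le> c * dist z 0 + norm F / cmod (q K)" for x
    proof -
      have "(volterra M a ^^ j) 0 = 0" for j
      proof (induction j)
        case (Suc j)
        then show ?case using norm_volterra_le[of M a 0] M by simp
      qed simp
      then have "T 0 x = apply_bcontfun F x / q K" by (simp add: T_def)
      then have "cmod (T 0 x) \<le> norm F / cmod (q K)"
        using norm_bounded[of F x] by (simp add: norm_divide divide_right_mono)
      moreover have "cmod (T z x) \<le> cmod (T z x - T 0 x) + cmod (T 0 x)"
        by (metis diff_add_cancel norm_triangle_ineq)
      ultimately show ?thesis using T_le[of z x 0] by linarith
    qed
  qed
  have "\<exists>!z. Bcontfun (T z) = z"
  proof (rule banach_fix_type[OF c], intro allI dist_bound)
    fix z z' x
    show "dist (apply_bcontfun (Bcontfun (T z)) x) (apply_bcontfun (Bcontfun (T z')) x) \<le> c * dist z z'"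
      using T_le[of z x z'] by (simp add: Bcontfun_inverse[OF T_bcont] dist_norm)
  qed
  then obtain z where "Bcontfun (T z) = z" by blast
  then have "apply_bcontfun z x = T z x" for x using Bcontfun_inverse[OF T_bcont, of z] by simp
  then have "q K * apply_bcontfun z x = q K * T z x" for x by simp
  then show ?thesis using that[of z] unfolding qT by blast
qed

text \<open>
  Taking the highest derivative as the unknown turns the initial value problem with zero data at \<open>a\<close> into a Volterra
  equation, since the lower derivatives are iterated primitives of it. The unknown is weighted by \<open>exp(-M x)\<close>, and
  \<open>p\<close> is replaced by its values on \<open>[a, b]\<close>, extended by constants, to have a bounded coefficient.
\<close>
lemma linear_ode_solvable:
  fixes q :: "nat \<Rightarrow> complex" and p F :: "real \<Rightarrow> complex"
  assumes K: "K \<ge> 1" and qK: "q K \<noteq> 0" and ab: "a \<le> b"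
    and p: "continuous_on UNIV p" and F: "continuous_on UNIV F" "\<And>x. x \<notin> {a..b} \<Longrightarrow> F x = 0"
  obtains y :: "nat \<Rightarrow> real \<Rightarrow> complex" where
    "\<And>k x. k < K \<Longrightarrow> (y k has_vector_derivative y (Suc k) x) (at x)"
    "\<And>k. continuous_on UNIV (y k)"
    "\<And>k x. k \<le> K \<Longrightarrow> x \<le> a \<Longrightarrow> y k x = 0"
    "\<And>x. a \<le> x \<Longrightarrow> x \<le> b \<Longrightarrow> (\<Sum>k\<le>K. q k * y k x) = p x * y 0 x + F x"
proof -
  have Fa: "F a = 0"
  proof -
    have "closed {x. F x = 0}" using F(1) by (intro closed_Collect_eq continuous_intros)
    moreover have "{..<a} \<subseteq> {x. F x = 0}" using F(2) by auto
    ultimately have "closure {..<a} \<subseteq> {x. F x = 0}" by (intro closure_minimal)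
    then show ?thesis by auto
  qed
  define pt where "pt x = p (max a (min b x))" for x
  have "compact (p ` {a..b})" by (intro compact_continuous_image continuous_on_subset[OF p]) auto
  then obtain B where B: "\<And>x. x \<in> {a..b} \<Longrightarrow> cmod (p x) \<le> B"
    using compact_imp_bounded[THEN bounded_iff[THEN iffD1]] by fastforce
  have "pt \<in> bcontfun"
  proof (rule bcontfun_normI)
    show "continuous_on UNIV pt" unfolding pt_def
      by (rule continuous_on_compose2[OF p]) (auto intro!: continuous_intros)
    show "cmod (pt x) \<le> B" for x unfolding pt_def using ab by (intro B) auto
  qed
  then obtain P where P: "apply_bcontfun P = pt" by (metis Bcontfun_inverse)
  \<comment> \<open>Large enough for the contraction condition.\<close>
  define M where "M = max 1 ((norm P + (\<Sum>k<K. cmod (q k)) + 1) / cmod (q K))"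
  have M: "M \<ge> 1" by (simp add: M_def)
  then have Mpos: "M > 0" by simp
  have "(norm P + (\<Sum>k<K. cmod (q k)) + 1) / cmod (q K) \<le> M" by (simp add: M_def)
  then have M': "norm P + (\<Sum>k<K. cmod (q k)) < M * cmod (q K)"
    using qK by (simp add: divide_le_eq)
  define Ft where "Ft x = exp (- M * x) *\<^sub>R F x" for x
  have Ftc: "continuous_on UNIV Ft" unfolding Ft_def by (intro continuous_intros F(1))
  have "compact (Ft ` {a..b})" by (intro compact_continuous_image continuous_on_subset[OF Ftc]) auto
  then obtain B' where B': "\<And>x. x \<in> {a..b} \<Longrightarrow> cmod (Ft x) \<le> B'"
    using compact_imp_bounded[THEN bounded_iff[THEN iffD1]] by fastforce
  have "Ft \<in> bcontfun"
  proof (rule bcontfun_normI[OF Ftc])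
    show "cmod (Ft x) \<le> max 0 B'" for x
      using B'[of x] F(2)[of x] by (cases "x \<in> {a..b}") (auto simp: Ft_def)
  qed
  then obtain G where G: "apply_bcontfun G = Ft" by (metis Bcontfun_inverse)
  obtain z where z: "\<And>x. q K * apply_bcontfun z x = apply_bcontfun P x * apply_bcontfun ((volterra M a ^^ K) z) x
      + apply_bcontfun G x - (\<Sum>k<K. q k * apply_bcontfun ((volterra M a ^^ (K - k)) z) x)"
    using volterra_equation_solvable[OF K M qK M'] by blast
  define V where "V j = apply_bcontfun ((volterra M a ^^ j) z)" for j
  have V_Suc: "V (Suc j) = volterra_fun M a (V j)" for j
    by (simp add: V_def apply_volterra[OF Mpos])
  have Vc: "continuous_on UNIV (V j)" for j by (auto simp: V_def)
  have eq: "q K * V 0 x = pt x * V K x + Ft x - (\<Sum>k<K. q k * V (K - k) x)" for x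
    using z[of x] by (simp add: V_def P G)
  have V_le: "V j x = 0" if "x \<le> a" for j x
  proof -
    have Suc: "V (Suc i) x = 0" for i using that by (simp add: V_Suc)
    then have pos: "V i x = 0" if "i \<ge> 1" for i using that by (cases i) auto
    have "Ft x = 0" using that Fa F(2)[of x] by (cases "x = a") (auto simp: Ft_def)
    then have "V 0 x = 0" using eq[of x] pos K qK by simp
    then show ?thesis using Suc by (cases j) auto
  qed
  define y where "y k x = exp (M * x) *\<^sub>R V (K - k) x" for k x
  show ?thesis
  proof (rule that[of y])
    fix k x assume k: "k < K"
    then obtain j where j: "K - k = Suc j" "K - Suc k = j" by (metis Suc_diff_Suc)
    have "y k = (\<lambda>x. integral {a..x} (\<lambda>s. exp (M * s) *\<^sub>R V j s))"
      by (auto simp: y_def j V_Suc volterra_fun_def exp_minus)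
    moreover have "((\<lambda>x. integral {a..x} (\<lambda>s. exp (M * s) *\<^sub>R V j s)) has_vector_derivative exp (M * x) *\<^sub>R V j x) (at x)"
      by (intro has_vector_derivative_primitive continuous_intros Vc) (simp add: V_le)
    ultimately show "(y k has_vector_derivative y (Suc k) x) (at x)" by (simp add: y_def j)
  next
    show "continuous_on UNIV (y k)" for k unfolding y_def by (intro continuous_intros Vc)
    show "y k x = 0" if "x \<le> a" for k x using that by (simp add: y_def V_le)
    fix x assume x: "a \<le> x" "x \<le> b"
    then have "pt x = p x" by (simp add: pt_def)
    then have "(\<Sum>k<K. q k * V (K - k) x) + q K * V 0 x = p x * V K x + Ft x"
      using eq[of x] by simp
    then have "exp (M * x) *\<^sub>R ((\<Sum>k<K. q k * V (K - k) x) + q K * V 0 x) = exp (M * x) *\<^sub>R (p x * V K x + Ft x)"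
      by simp
    then show "(\<Sum>k\<le>K. q k * y k x) = p x * y 0 x + F x"
      by (simp add: y_def Ft_def exp_minus scaleR_add_right scaleR_sum_right flip: lessThan_Suc_atMost)
  qed
qed

section \<open>Compactly supported solutions\<close>

text \<open>
  Fewer equations than unknowns: Gaussian elimination of one equation and one unknown at a time.
\<close>
lemma nontrivial_linear_relation:
  fixes M :: "'i \<Rightarrow> 'j \<Rightarrow> 'a::field"
  assumes "finite J" "finite I" "card J < card I"
  shows "\<exists>c. (\<exists>i\<in>I. c i \<noteq> 0) \<and> (\<forall>j\<in>J. (\<Sum>i\<in>I. c i * M i j) = 0)"
  using assms
proof (induction J arbitrary: I M rule: finite_induct)
  case empty
  then have "I \<noteq> {}" by auto
  then show ?case by (intro exI[of _ "\<lambda>_. 1"]) auto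
next
  case (insert k J)
  show ?case
  proof (cases "\<forall>i\<in>I. M i k = 0")
    case True
    obtain c where "\<exists>i\<in>I. c i \<noteq> 0" "\<forall>j\<in>J. (\<Sum>i\<in>I. c i * M i j) = 0"
      using insert.IH[of I M] insert.prems insert.hyps by auto
    then show ?thesis using True by (intro exI[of _ c]) auto
  next
    case False
    then obtain i0 where i0: "i0 \<in> I" "M i0 k \<noteq> 0" by blast
    \<comment> \<open>Subtracting a multiple of the pivot row \<open>i0\<close> removes equation \<open>k\<close>.\<close>
    define M' where "M' i j = M i j - M i k / M i0 k * M i0 j" for i j
    have "card J < card (I - {i0})" using insert.prems insert.hyps i0 by simp
    then obtain c where c: "\<exists>i\<in>I - {i0}. c i \<noteq> 0" "\<forall>j\<in>J. (\<Sum>i\<in>I - {i0}. c i * M' i j) = 0"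
      using insert.IH[of "I - {i0}" M'] insert.prems by auto
    define d where "d i = (if i = i0 then - (\<Sum>i\<in>I - {i0}. c i * M i k / M i0 k) else c i)" for i
    have "(\<Sum>i\<in>I. d i * M i j) = (\<Sum>i\<in>I - {i0}. c i * M' i j)" for j
    proof -
      have "(\<Sum>i\<in>I. d i * M i j) = d i0 * M i0 j + (\<Sum>i\<in>I - {i0}. d i * M i j)"
        using insert.prems i0 by (simp add: sum.remove)
      also have "(\<Sum>i\<in>I - {i0}. d i * M i j) = (\<Sum>i\<in>I - {i0}. c i * M i j)"
        by (intro sum.cong) (auto simp: d_def)
      also have "d i0 * M i0 j = - (\<Sum>i\<in>I - {i0}. c i * M i k / M i0 k * M i0 j)"
        by (simp add: d_def sum_distrib_right)
      finally show ?thesis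
        by (simp add: M'_def right_diff_distrib sum_subtractf mult.assoc)
    qed
    moreover have "M' i k = 0" for i using i0 by (simp add: M'_def)
    moreover have "\<exists>i\<in>I. d i \<noteq> 0" using c(1) by (auto simp: d_def)
    ultimately show ?thesis using c(2) by (intro exI[of _ d]) auto
  qed
qed

text \<open>
  A function is of class \<open>C\<^sup>K\<close> as soon as some sequence \<open>y\<close> plays the role of its derivatives.
\<close>
lemma C_k_chain:
  assumes "\<And>k x. k < K \<Longrightarrow> (y k has_vector_derivative y (Suc k) x) (at x)" "continuous_on UNIV (y K)"
  shows "C_k K (y 0)"
proof -
  have "C_k n (y (K - n))" if "n \<le> K" for n
    using that
  proof (induction n)
    case 0
    then show ?case using assms(2) by (simp add: C_k_0)
  next
    case (Suc n)
    then have "K - Suc n < K" "Suc (K - Suc n) = K - n" by auto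
    with assms(1)[of "K - Suc n"] Suc show ?case by (intro C_k_SucI[of _ "y (K - n)"]) auto
  qed
  from this[of K] show ?thesis by simp
qed

lemma D_pow_chain:
  assumes "\<And>k x. k < K \<Longrightarrow> (y k has_vector_derivative y (Suc k) x) (at x)"
  shows "k \<le> K \<Longrightarrow> (D ^^ k) (y 0) = (\<lambda>x. \<i> ^ k * y k x)"
proof (induction k)
  case (Suc k)
  have "((\<lambda>x. \<i> ^ k * y k x) has_vector_derivative \<i> ^ k * y (Suc k) x) (at x)" for x
    using Suc.prems by (intro has_vector_derivative_mult_right assms) simp
  from D_eqI[OF this] have "D (\<lambda>x. \<i> ^ k * y k x) = (\<lambda>x. \<i> ^ Suc k * y (Suc k) x)"
    by (intro ext) simp
  then show ?case using Suc by simp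
qed simp

text \<open>
  In terms of \<open>w = v g\<close> the equation is \<open>Q(D) w = (l / v\<^sup>2) w + \<Sum>\<^sub>i c\<^sub>i F\<^sub>i / v\<close>, a linear equation of order \<open>K\<close>. For each
  \<open>F\<^sub>i\<close> it has a solution with zero data at \<open>a\<close>. Such a solution can be continued by zero beyond \<open>b\<close> when its
  derivatives of order below \<open>K\<close> vanish at \<open>b\<close>. These are \<open>K\<close> linear conditions on the \<open>K + 1\<close> coefficients \<open>c\<^sub>i\<close>. This
  is the way in which the order of the equation limits the multiplicity of eigenvalues.
\<close>
lemma compactly_supported_solution:
  fixes F :: "nat \<Rightarrow> real \<Rightarrow> complex" and l :: real
  assumes K: "degree Q \<ge> 1" and v: "C_k (degree Q) v" and vpos: "\<And>x. v x > 0" and ab: "a \<le> b"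
    and I: "finite I" "card I = Suc (degree Q)"
    and F: "\<And>i. i \<in> I \<Longrightarrow> continuous_on UNIV (F i)" "\<And>i x. i \<in> I \<Longrightarrow> x \<notin> {a..b} \<Longrightarrow> F i x = 0"
  obtains c g where "\<exists>i\<in>I. c i \<noteq> 0" "g \<in> C0_k (degree Q)" "\<And>x. x \<notin> {a..b} \<Longrightarrow> g x = 0"
    "(\<lambda>x. weighted_op v Q g x - of_real l * g x) = (\<lambda>x. \<Sum>i\<in>I. c i * F i x)"
proof -
  let ?K = "degree Q"
  define q where "q k = of_real (coeff Q k) * \<i> ^ k" for k
  define p where "p x = (of_real (l / (v x)\<^sup>2) :: complex)" for x
  have vc: "continuous_on UNIV v" by (rule C_k_continuous[OF v])
  have vnz: "v x \<noteq> 0" for x using vpos[of x] by simp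
  have qK: "q ?K \<noteq> 0" using K by (auto simp: q_def)
  have pc: "continuous_on UNIV p" unfolding p_def using vc vnz by (intro continuous_intros) auto
  define G where "G i x = F i x / of_real (v x)" for i x
  have Gc: "continuous_on UNIV (G i)" if "i \<in> I" for i
    unfolding G_def using vc vnz F(1)[OF that] by (intro continuous_intros) auto
  have G0: "G i x = 0" if "i \<in> I" "x \<notin> {a..b}" for i x using F(2)[OF that] by (simp add: G_def)
  have "\<forall>i\<in>I. \<exists>y. (\<forall>k x. k < ?K \<longrightarrow> (y k has_vector_derivative y (Suc k) x) (at x)) \<and>
      (\<forall>k. continuous_on UNIV (y k)) \<and> (\<forall>k x. k \<le> ?K \<longrightarrow> x \<le> a \<longrightarrow> y k x = 0) \<and>
      (\<forall>x. a \<le> x \<longrightarrow> x \<le> b \<longrightarrow> (\<Sum>k\<le>?K. q k * y k x) = p x * y 0 x + G i x)"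
  proof
    fix i assume i: "i \<in> I"
    obtain y where "\<And>k x. k < ?K \<Longrightarrow> (y k has_vector_derivative y (Suc k) x) (at x)"
      "\<And>k. continuous_on UNIV (y k)" "\<And>k x. k \<le> ?K \<Longrightarrow> x \<le> a \<Longrightarrow> y k x = 0"
      "\<And>x. a \<le> x \<Longrightarrow> x \<le> b \<Longrightarrow> (\<Sum>k\<le>?K. q k * y k x) = p x * y 0 x + G i x"
      using linear_ode_solvable[of ?K q a b p "G i", OF K qK ab pc Gc[OF i] G0[OF i]] by blast
    then show "\<exists>y. (\<forall>k x. k < ?K \<longrightarrow> (y k has_vector_derivative y (Suc k) x) (at x)) \<and>
      (\<forall>k. continuous_on UNIV (y k)) \<and> (\<forall>k x. k \<le> ?K \<longrightarrow> x \<le> a \<longrightarrow> y k x = 0) \<and>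
      (\<forall>x. a \<le> x \<longrightarrow> x \<le> b \<longrightarrow> (\<Sum>k\<le>?K. q k * y k x) = p x * y 0 x + G i x)"
      by blast
  qed
  then obtain Y where Y: "\<And>i k x. i \<in> I \<Longrightarrow> k < ?K \<Longrightarrow> (Y i k has_vector_derivative Y i (Suc k) x) (at x)"
      "\<And>i k. i \<in> I \<Longrightarrow> continuous_on UNIV (Y i k)"
      "\<And>i k x. i \<in> I \<Longrightarrow> k \<le> ?K \<Longrightarrow> x \<le> a \<Longrightarrow> Y i k x = 0"
      "\<And>i x. i \<in> I \<Longrightarrow> a \<le> x \<Longrightarrow> x \<le> b \<Longrightarrow> (\<Sum>k\<le>?K. q k * Y i k x) = p x * Y i 0 x + G i x"
    by (subst (asm) bchoice_iff) blast
  obtain c where c: "\<exists>i\<in>I. c i \<noteq> 0" "\<And>k. k < ?K \<Longrightarrow> (\<Sum>i\<in>I. c i * Y i k b) = 0"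
    using nontrivial_linear_relation[of "{..<?K}" I "\<lambda>i k. Y i k b"] I by auto
  define y where "y k x = (\<Sum>i\<in>I. c i * Y i k x)" for k x
  have yd: "(y k has_vector_derivative y (Suc k) x) (at x)" if "k < ?K" for k x
    unfolding y_def using Y(1) that by (intro has_vector_derivative_sum has_vector_derivative_mult_right)
  have yc: "continuous_on UNIV (y k)" for k
    unfolding y_def by (intro continuous_intros Y(2))
  have ya: "y k x = 0" if "k \<le> ?K" "x \<le> a" for k x
    using Y(3) that by (simp add: y_def)
  have ode: "(\<Sum>k\<le>?K. q k * y k x) = p x * y 0 x + (\<Sum>i\<in>I. c i * G i x)" if "a \<le> x" "x \<le> b" for x
  proof -
    have "(\<Sum>k\<le>?K. q k * y k x) = (\<Sum>i\<in>I. c i * (\<Sum>k\<le>?K. q k * Y i k x))"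
      unfolding y_def sum_distrib_left by (subst sum.swap) (simp add: mult_ac)
    also have "\<dots> = (\<Sum>i\<in>I. c i * (p x * Y i 0 x + G i x))"
      using Y(4) that by simp
    also have "\<dots> = p x * y 0 x + (\<Sum>i\<in>I. c i * G i x)"
      by (simp add: y_def distrib_left sum.distrib sum_distrib_left mult_ac)
    finally show ?thesis .
  qed
  have Gb: "G i b = 0" if i: "i \<in> I" for i
  proof -
    have "closed {x. G i x = 0}" using Gc[OF i] by (intro closed_Collect_eq continuous_intros)
    moreover have "{b<..} \<subseteq> {x. G i x = 0}" using G0[OF i] by auto
    ultimately have "closure {b<..} \<subseteq> {x. G i x = 0}" by (intro closure_minimal)
    then show ?thesis by auto
  qed
  \<comment> \<open>The conditions on \<open>c\<close> give this for \<open>k < K\<close>; the equation at \<open>b\<close> then gives it for \<open>k = K\<close>.\<close>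
  have yb: "y k b = 0" if "k \<le> ?K" for k
  proof (cases "k < ?K")
    case True
    then show ?thesis using c(2) by (simp add: y_def)
  next
    case False
    have "(\<Sum>k<?K. q k * y k b) = 0" using c(2) by (intro sum.neutral) (simp add: y_def)
    moreover have "p b * y 0 b = 0" using c(2)[of 0] K by (simp add: y_def)
    ultimately have "q ?K * y ?K b = 0"
      using ode[OF ab] Gb by (simp flip: lessThan_Suc_atMost)
    then show ?thesis using qK that False by simp
  qed
  define w where "w k x = (if x \<le> b then y k x else 0)" for k x
  have wd: "(w k has_vector_derivative w (Suc k) x) (at x)" if "k < ?K" for k x
    unfolding w_def using that yb by (intro has_vector_derivative_cut yd) auto
  have wK: "continuous_on UNIV (w ?K)"
  proof -
    have "continuous_on ({..b} \<union> {b..}) (\<lambda>x. if x \<le> b then y ?K x else 0)"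
      using yb[of ?K] by (intro continuous_on_If continuous_on_subset[OF yc] continuous_intros) auto
    moreover have "{..b} \<union> {b..} = UNIV" by auto
    ultimately show ?thesis by (simp add: w_def)
  qed
  have w0: "w k x = 0" if "k \<le> ?K" "x \<notin> {a..b}" for k x using ya that by (auto simp: w_def)
  have wC: "w 0 \<in> C0_k ?K" by (rule C0_kI[OF C_k_chain[of ?K w, OF wd wK] w0]) auto
  define g where "g x = of_real (inverse (v x)) * w 0 x" for x
  have vg: "(\<lambda>x. of_real (v x) * g x) = w 0" using vnz by (simp add: g_def fun_eq_iff)
  have gC: "g \<in> C0_k ?K"
    unfolding g_def by (intro C0_k_mult wC C_k_of_real C_k_inverse v vnz)
  have "weighted_op v Q g x - of_real l * g x = (\<Sum>i\<in>I. c i * F i x)" for x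
  proof -
    have poly: "poly_D Q (w 0) x = (\<Sum>k\<le>?K. q k * w k x)"
      unfolding poly_D_def using D_pow_chain[of ?K w, OF wd] by (intro sum.cong) (auto simp: q_def mult.assoc)
    have weighted_op_g: "weighted_op v Q g x = of_real (v x) * poly_D Q (w 0) x"
      by (simp only: weighted_op_def vg)
    have F_sum: "of_real (v x) * (\<Sum>i\<in>I. c i * G i x) = (\<Sum>i\<in>I. c i * F i x)"
      using vnz[of x] by (simp add: G_def sum_distrib_left)
    show ?thesis
    proof (cases "x \<in> {a..b}")
      case True
      then have "poly_D Q (w 0) x = p x * w 0 x + (\<Sum>i\<in>I. c i * G i x)"
        unfolding poly using ode[of x] by (simp add: w_def)
      then have "weighted_op v Q g x = of_real (v x) * (p x * w 0 x) + (\<Sum>i\<in>I. c i * F i x)"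
        by (simp add: weighted_op_g distrib_left F_sum)
      moreover have "of_real (v x) * (p x * w 0 x) = of_real l * g x"
        using vnz[of x] by (simp add: p_def g_def power2_eq_square field_simps)
      ultimately show ?thesis by simp
    next
      case False
      then have "poly_D Q (w 0) x = 0" unfolding poly using w0 by simp
      moreover have "(\<Sum>i\<in>I. c i * F i x) = 0" using F(2) False by simp
      moreover have "w 0 x = 0" using w0 False by simp
      ultimately show ?thesis by (simp add: weighted_op_g g_def)
    qed
  qed
  moreover have "g x = 0" if "x \<notin> {a..b}" for x using w0 that by (simp add: g_def)
  ultimately show ?thesis using that[of c g] c(1) gC by blast
qed

section \<open>Infinite negative spectrum\<close>

definition shifted_op :: "(real \<Rightarrow> real) \<Rightarrow> real poly \<Rightarrow> real \<Rightarrow> (real \<Rightarrow> complex) \<Rightarrow> real \<Rightarrow> complex" where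
  "shifted_op v Q l g = (\<lambda>x. weighted_op v Q g x - of_real l * g x)"

text \<open>
  The product of \<open>B - \<Lambda> j\<close> over \<open>j < k\<close>, where \<open>B\<close> is the weighted operator.
\<close>
primrec shifted_prod :: "(real \<Rightarrow> real) \<Rightarrow> real poly \<Rightarrow> (nat \<Rightarrow> real) \<Rightarrow> nat \<Rightarrow> (real \<Rightarrow> complex) \<Rightarrow> real \<Rightarrow> complex" where
  "shifted_prod v Q \<Lambda> 0 g = g"
| "shifted_prod v Q \<Lambda> (Suc k) g = shifted_op v Q (\<Lambda> k) (shifted_prod v Q \<Lambda> k g)"

text \<open>
  The functions \<open>g\<close> for which all of \<open>g, B g, \<dots>, B\<^sup>m g\<close> are test functions. Since \<open>v\<close> is only of class \<open>C\<^sup>K\<close>, this is a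
  real restriction even for smooth \<open>g\<close>.
\<close>
primrec power_domain :: "(real \<Rightarrow> real) \<Rightarrow> real poly \<Rightarrow> nat \<Rightarrow> (real \<Rightarrow> complex) \<Rightarrow> bool" where
  "power_domain v Q 0 g \<longleftrightarrow> g \<in> C0_k (degree Q)"
| "power_domain v Q (Suc m) g \<longleftrightarrow> g \<in> C0_k (degree Q) \<and> power_domain v Q m (weighted_op v Q g)"

lemma power_domain_SucD: "power_domain v Q (Suc m) g \<Longrightarrow> power_domain v Q m g"
  by (induction m arbitrary: g) auto

lemma power_domain_lincomb:
  assumes v: "C_k (degree Q) v"
  shows "power_domain v Q m f \<Longrightarrow> power_domain v Q m g \<Longrightarrow> power_domain v Q m (\<lambda>x. a * f x + b * g x)"
  by (induction m arbitrary: f g) (auto simp: C0_k_lincomb weighted_op_lincomb[OF v])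

text \<open>
  Puts the shifted operator into the shape in which the rules on linear combinations apply.
\<close>
lemma shifted_op_lincomb_form: "shifted_op v Q l g = (\<lambda>x. 1 * weighted_op v Q g x + (- of_real l) * g x)"
  by (simp add: shifted_op_def)

lemma power_domain_shifted_op:
  assumes v: "C_k (degree Q) v" and "power_domain v Q (Suc m) g"
  shows "power_domain v Q m (shifted_op v Q l g)"
  unfolding shifted_op_lincomb_form using assms power_domain_SucD[OF assms(2)] by (intro power_domain_lincomb) auto

lemma power_domain_SucI:
  assumes v: "C_k (degree Q) v"
  shows "g \<in> C0_k (degree Q) \<Longrightarrow> power_domain v Q m (shifted_op v Q l g) \<Longrightarrow> power_domain v Q (Suc m) g"
proof (induction m)
  case 0
  have "(\<lambda>x. 1 * shifted_op v Q l g x + of_real l * g x) \<in> C0_k (degree Q)"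
    using 0 by (intro C0_k_lincomb) auto
  then show ?case using 0 by (simp add: shifted_op_def)
next
  case (Suc m)
  have "power_domain v Q (Suc m) g" using Suc.IH[OF Suc.prems(1)] power_domain_SucD[OF Suc.prems(2)] by blast
  then have "power_domain v Q (Suc m) (\<lambda>x. 1 * shifted_op v Q l g x + of_real l * g x)"
    using Suc.prems(2) by (intro power_domain_lincomb[OF v])
  moreover have "(\<lambda>x. 1 * shifted_op v Q l g x + of_real l * g x) = weighted_op v Q g"
    by (simp add: shifted_op_def)
  ultimately have "power_domain v Q (Suc m) (weighted_op v Q g)" by (simp only:)
  with Suc.prems(1) show ?case by simp
qed

lemma power_domain_shifted_prod:
  assumes v: "C_k (degree Q) v"
  shows "power_domain v Q (m + k) g \<Longrightarrow> power_domain v Q m (shifted_prod v Q \<Lambda> k g)"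
proof (induction k arbitrary: m)
  case (Suc k)
  then show ?case using power_domain_shifted_op[OF v Suc.IH[of "Suc m"]] by simp
qed simp

lemma power_domainI:
  assumes v: "C_k (degree Q) v"
    and "\<And>k. k \<le> m \<Longrightarrow> shifted_prod v Q \<Lambda> k g \<in> C0_k (degree Q)"
  shows "power_domain v Q m g"
proof -
  have "power_domain v Q j (shifted_prod v Q \<Lambda> (m - j) g)" if "j \<le> m" for j
    using that
  proof (induction j)
    case 0
    then show ?case using assms(2)[of m] by simp
  next
    case (Suc j)
    have "m - j = Suc (m - Suc j)" using Suc.prems by simp
    then have "power_domain v Q j (shifted_op v Q (\<Lambda> (m - Suc j)) (shifted_prod v Q \<Lambda> (m - Suc j) g))"
      using Suc by simp
    then show ?case using assms(2)[of "m - Suc j"] by (intro power_domain_SucI[OF v]) auto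
  qed
  from this[of m] show ?thesis by simp
qed

lemma shifted_op_commute:
  assumes v: "C_k (degree Q) v" and g: "power_domain v Q (Suc (Suc 0)) g"
  shows "shifted_op v Q a (shifted_op v Q b g) = shifted_op v Q b (shifted_op v Q a g)"
proof -
  have C: "g \<in> C0_k (degree Q)" "weighted_op v Q g \<in> C0_k (degree Q)" using g by auto
  have form: "shifted_op v Q a (shifted_op v Q b g) = (\<lambda>x. weighted_op v Q (weighted_op v Q g) x - of_real b * weighted_op v Q g x
      - of_real a * (weighted_op v Q g x - of_real b * g x))" for a b
  proof -
    have "weighted_op v Q (shifted_op v Q b g) = (\<lambda>x. 1 * weighted_op v Q (weighted_op v Q g) x + (- of_real b) * weighted_op v Q g x)"
      unfolding shifted_op_lincomb_form by (rule weighted_op_lincomb[OF v C(2,1)])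
    then show ?thesis unfolding shifted_op_def[of v Q a] by (simp add: shifted_op_def fun_eq_iff)
  qed
  show ?thesis unfolding form[of a b] form[of b a] by (simp add: algebra_simps)
qed

lemma shifted_prod_shifted_op:
  assumes v: "C_k (degree Q) v"
  shows "power_domain v Q (Suc k) g \<Longrightarrow> shifted_prod v Q \<Lambda> k (shifted_op v Q l g) = shifted_op v Q l (shifted_prod v Q \<Lambda> k g)"
proof (induction k)
  case (Suc k)
  have "power_domain v Q (Suc (Suc 0)) (shifted_prod v Q \<Lambda> k g)"
    using Suc.prems by (intro power_domain_shifted_prod[OF v]) simp
  then show ?case using Suc.IH[OF power_domain_SucD[OF Suc.prems]] shifted_op_commute[OF v] by simp
qed simp

lemma weighted_op_sum:
  assumes v: "C_k (degree Q) v" and "finite I" "\<And>i. i \<in> I \<Longrightarrow> g i \<in> C0_k (degree Q)"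
  shows "weighted_op v Q (\<lambda>x. \<Sum>i\<in>I. c i * g i x) = (\<lambda>x. \<Sum>i\<in>I. c i * weighted_op v Q (g i) x)"
  using assms(2,3)
proof (induction I rule: finite_induct)
  case empty
  have "(\<lambda>_. 0) \<in> C0_k (degree Q)" by (rule C0_kI[of _ _ 0 0]) (auto intro: C_k_const)
  from weighted_op_lincomb[OF v this this, of 0 0] show ?case by simp
next
  case (insert i I)
  have "weighted_op v Q (\<lambda>x. c i * g i x + 1 * (\<Sum>i\<in>I. c i * g i x)) =
      (\<lambda>x. c i * weighted_op v Q (g i) x + 1 * weighted_op v Q (\<lambda>x. \<Sum>i\<in>I. c i * g i x) x)"
    using insert by (intro weighted_op_lincomb[OF v] C0_k_sum) auto
  then show ?case using insert by simp
qed

lemma ordered_intervals: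
  fixes a b :: "nat \<Rightarrow> real"
  assumes "\<And>j. a j \<le> b j" "\<And>j. b j < a (Suc j)"
  shows "i < j \<Longrightarrow> b i < a j" and "i \<le> j \<Longrightarrow> a i \<le> a j" and "i \<le> j \<Longrightarrow> b i \<le> b j"
proof -
  have aS: "a k \<le> a (Suc k)" and bS: "b k \<le> b (Suc k)" for k
    using assms(1)[of k] assms(2)[of k] assms(1)[of "Suc k"] by linarith+
  show mono: "i \<le> j \<Longrightarrow> a i \<le> a j" "i \<le> j \<Longrightarrow> b i \<le> b j" for i j
    using lift_Suc_mono_le[of a, OF aS] lift_Suc_mono_le[of b, OF bS] by blast+
  show "i < j \<Longrightarrow> b i < a j"
    using assms(2)[of i] mono(1)[of "Suc i" j] by linarith
qed

text \<open>
  The product of the \<open>m\<close> factors is inverted from the outside inwards. Group the \<open>f j\<close> into blocks of \<open>K + 1\<close>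
  consecutive functions. In each block some nontrivial combination has a preimage under the outermost factor, supported
  in the hull of the block. These preimages are again supported in disjoint ordered intervals, so the remaining factors
  are handled by induction.
\<close>
lemma shifted_prod_range_meets_span:
  fixes f :: "nat \<Rightarrow> real \<Rightarrow> complex" and a b :: "nat \<Rightarrow> real"
  assumes K: "degree Q \<ge> 1" and v: "C_k (degree Q) v" and vpos: "\<And>x. v x > 0"
    and "\<And>j. f j \<in> C0_k (degree Q)" "\<And>j x. x \<notin> {a j..b j} \<Longrightarrow> f j x = 0"
      "\<And>j. a j \<le> b j" "\<And>j. b j < a (Suc j)"
  shows "\<exists>g n c. (\<forall>k\<le>m. shifted_prod v Q \<Lambda> k g \<in> C0_k (degree Q)) \<and> (\<exists>j<n. c j \<noteq> 0) \<and>
    shifted_prod v Q \<Lambda> m g = (\<lambda>x. \<Sum>j<n. c j * f j x)"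
  using assms(4-7)
proof (induction m arbitrary: f a b)
  case 0
  then show ?case by (intro exI[of _ "f 0"] exI[of _ 1] exI[of _ "\<lambda>_. 1"]) auto
next
  case (Suc m)
  define N where "N = Suc (degree Q)"
  have N: "N > 0" by (simp add: N_def)
  define I where "I j = {j * N..<j * N + N}" for j
  define a' b' where "a' j = a (j * N)" and "b' j = b (j * N + (N - 1))" for j
  have mono: "i < j \<Longrightarrow> b i < a j" "i \<le> j \<Longrightarrow> a i \<le> a j" "i \<le> j \<Longrightarrow> b i \<le> b j" for i j
    using ordered_intervals[of a b, OF Suc.prems(3,4)] by blast+
  have ab': "a' j \<le> b' j" for j
    using mono(3)[of "j * N" "j * N + (N - 1)"] Suc.prems(3)[of "j * N"] by (simp add: a'_def b'_def)
  have ab'': "b' j < a' (Suc j)" for j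
    unfolding a'_def b'_def using N by (intro mono) simp
  define sol where "sol j c g \<longleftrightarrow> (\<exists>i\<in>I j. c i \<noteq> 0) \<and> g \<in> C0_k (degree Q) \<and>
      (\<forall>x. x \<notin> {a' j..b' j} \<longrightarrow> g x = 0) \<and>
      shifted_op v Q (\<Lambda> m) g = (\<lambda>x. \<Sum>i\<in>I j. c i * f i x)" for j c g
  have ex: "\<exists>c g. sol j c g" for j
  proof -
    have supp: "f i x = 0" if "i \<in> I j" "x \<notin> {a' j..b' j}" for i x
    proof -
      have "a' j \<le> a i" "b i \<le> b' j" using that(1) by (auto simp: a'_def b'_def I_def intro!: mono)
      then have "x \<notin> {a i..b i}" using that(2) by auto
      then show ?thesis by (rule Suc.prems(2))
    qed
    have I: "finite (I j)" "card (I j) = Suc (degree Q)" by (auto simp: I_def N_def)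
    have fc: "continuous_on UNIV (f i)" for i by (rule C_k_continuous[OF C0_kD[OF Suc.prems(1)]])
    show ?thesis
    proof (rule compactly_supported_solution[OF K v vpos ab' I fc supp, where l = "\<Lambda> m"])
      fix c g
      assume "\<exists>i\<in>I j. c i \<noteq> 0" "g \<in> C0_k (degree Q)" "\<And>x. x \<notin> {a' j..b' j} \<Longrightarrow> g x = 0"
        "(\<lambda>x. weighted_op v Q g x - of_real (\<Lambda> m) * g x) = (\<lambda>x. \<Sum>i\<in>I j. c i * f i x)"
      then have "sol j c g" by (simp add: sol_def shifted_op_def)
      then show ?thesis by blast
    qed
  qed
  obtain c where c: "\<And>j. \<exists>g. sol j (c j) g"
    using choice[of "\<lambda>j c. \<exists>g. sol j c g"] ex by blast
  obtain g where g: "\<And>j. sol j (c j) (g j)"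
    using choice[of "\<lambda>j. sol j (c j)"] c by blast
  have cg: "\<And>j. \<exists>i\<in>I j. c j i \<noteq> 0" "\<And>j. g j \<in> C0_k (degree Q)"
      "\<And>j x. x \<notin> {a' j..b' j} \<Longrightarrow> g j x = 0"
      "\<And>j. shifted_op v Q (\<Lambda> m) (g j) = (\<lambda>x. \<Sum>i\<in>I j. c j i * f i x)"
    using g by (simp_all add: sol_def)
  from Suc.IH[where f = g and a = a' and b = b', OF cg(2,3) ab' ab''] obtain \<phi> n d where
    \<phi>: "\<And>k. k \<le> m \<Longrightarrow> shifted_prod v Q \<Lambda> k \<phi> \<in> C0_k (degree Q)" "\<exists>j<n. d j \<noteq> 0"
      "shifted_prod v Q \<Lambda> m \<phi> = (\<lambda>x. \<Sum>j<n. d j * g j x)" by blast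
  define e where "e i = d (i div N) * c (i div N) i" for i
  have div: "i div N = j" if "i \<in> I j" for i j
    using that N unfolding I_def by (intro div_nat_eqI) (auto simp: algebra_simps)
  have prod: "shifted_prod v Q \<Lambda> (Suc m) \<phi> = (\<lambda>x. \<Sum>i<n * N. e i * f i x)"
  proof
    fix x
    have "shifted_prod v Q \<Lambda> (Suc m) \<phi> x = (\<Sum>j<n. d j * shifted_op v Q (\<Lambda> m) (g j) x)"
      unfolding shifted_prod.simps \<phi>(3) shifted_op_def weighted_op_sum[OF v finite_lessThan cg(2)]
      by (simp add: right_diff_distrib sum_subtractf sum_distrib_left mult_ac)
    also have "\<dots> = (\<Sum>j<n. \<Sum>i\<in>I j. e i * f i x)"
      unfolding cg(4) sum_distrib_left by (intro sum.cong) (auto simp: e_def div mult.assoc)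
    also have "\<dots> = (\<Sum>i<n * N. e i * f i x)"
      unfolding I_def by (rule sum.nat_group)
    finally show "shifted_prod v Q \<Lambda> (Suc m) \<phi> x = (\<Sum>i<n * N. e i * f i x)" .
  qed
  obtain j i where ji: "j < n" "d j \<noteq> 0" "i \<in> I j" "c j i \<noteq> 0" using \<phi>(2) cg(1) by blast
  have "i < n * N"
  proof -
    have "i < Suc j * N" using ji(3) by (simp add: I_def)
    also have "\<dots> \<le> n * N" using ji(1) by (intro mult_right_mono) auto
    finally show ?thesis .
  qed
  moreover have "e i \<noteq> 0" using ji div[OF ji(3)] by (simp add: e_def)
  moreover have "shifted_prod v Q \<Lambda> (Suc m) \<phi> \<in> C0_k (degree Q)"
    unfolding prod by (intro C0_k_sum Suc.prems(1)) auto
  then have "\<forall>k\<le>Suc m. shifted_prod v Q \<Lambda> k \<phi> \<in> C0_k (degree Q)"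
    using \<phi>(1) by (metis le_Suc_eq)
  ultimately show ?case using prod by blast
qed

text \<open>
  The form of \<open>(B - \<Lambda> k) \<Prod>\<^sub>j\<^sub><\<^sub>k (B - \<Lambda> j)\<^sup>2\<close> is nonnegative. With \<open>s = B - \<Lambda> k\<close> and \<open>d = \<Lambda> (k + 1) - \<Lambda> k\<close> the step from \<open>k\<close>
  to \<open>k + 1\<close> is the identity \<open>s\<^sup>2 (s - d) = s (s - d)\<^sup>2 + d s (s - d)\<close>, whose first term is covered by the induction
  hypothesis applied to \<open>(s - d) g\<close> and whose second term is covered by the gap inequality.
\<close>
lemma shifted_prod_form_nonneg:
  assumes v: "C_k (degree Q) v"
    and base: "\<And>g. g \<in> C0_k (degree Q) \<Longrightarrow> Re (L2_inner (shifted_op v Q (\<Lambda> 0) g) g) \<ge> 0"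
    and gap: "\<And>k g. k < m \<Longrightarrow> g \<in> C0_k (degree Q) \<Longrightarrow>
      Re (L2_inner (shifted_op v Q (\<Lambda> k) g) (shifted_op v Q (\<Lambda> (Suc k)) g)) \<ge> 0"
    and mono: "\<And>k. k < m \<Longrightarrow> \<Lambda> k \<le> \<Lambda> (Suc k)"
  shows "k \<le> m \<Longrightarrow> power_domain v Q k g \<Longrightarrow>
    Re (L2_inner (shifted_op v Q (\<Lambda> k) (shifted_prod v Q \<Lambda> k g)) (shifted_prod v Q \<Lambda> k g)) \<ge> 0"
proof (induction k arbitrary: g)
  case 0
  then show ?case using base by simp
next
  case (Suc k)
  define \<psi> where "\<psi> = shifted_prod v Q \<Lambda> k g"
  define \<psi>' where "\<psi>' = shifted_op v Q (\<Lambda> k) \<psi>"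
  define d where "d = \<Lambda> (Suc k) - \<Lambda> k"
  define \<eta> where "\<eta> = shifted_op v Q (\<Lambda> (Suc k)) \<psi>"
  let ?B = "shifted_op v Q (\<Lambda> k)"
  have \<psi>: "power_domain v Q (Suc 0) \<psi>"
    unfolding \<psi>_def using Suc.prems(2) by (intro power_domain_shifted_prod[OF v]) simp
  have C: "\<psi> \<in> C0_k (degree Q)" "\<psi>' \<in> C0_k (degree Q)"
    using \<psi> power_domain_shifted_op[OF v \<psi>, of "\<Lambda> k"] by (simp_all add: \<psi>'_def)
  have L2: "\<psi> \<in> L2" "\<psi>' \<in> L2" using C C0_k_in_L2 by auto
  have weighted_op_L2: "weighted_op v Q u \<in> L2" if "u \<in> C0_k (degree Q)" for u
    using weighted_op_C0[OF v that] by (rule C0_k_in_L2)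
  have BL2: "?B u \<in> L2" if "u \<in> C0_k (degree Q)" for u
    unfolding shifted_op_def using that by (intro L2_diff_cmult weighted_op_L2 C0_k_in_L2)
  have \<eta>: "\<eta> = (\<lambda>x. 1 * \<psi>' x + (- of_real d) * \<psi> x)"
    by (auto simp: \<eta>_def \<psi>'_def d_def shifted_op_def algebra_simps)
  have "\<eta> = shifted_prod v Q \<Lambda> k (shifted_op v Q (\<Lambda> (Suc k)) g)"
    unfolding \<eta>_def \<psi>_def by (rule shifted_prod_shifted_op[OF v Suc.prems(2), symmetric])
  then have IH: "Re (L2_inner (?B \<eta>) \<eta>) \<ge> 0"
    using Suc.IH[OF _ power_domain_shifted_op[OF v Suc.prems(2)]] Suc.prems(1) by simp
  have gap': "Re (L2_inner \<psi>' \<eta>) \<ge> 0"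
    unfolding \<psi>'_def \<eta>_def using Suc.prems(1) by (intro gap C) simp
  have B\<eta>: "?B \<eta> = (\<lambda>x. 1 * ?B \<psi>' x + (- of_real d) * \<psi>' x)"
    unfolding shifted_op_def[of v Q "\<Lambda> k" \<eta>] unfolding \<eta> weighted_op_lincomb[OF v C(2,1)]
    by (auto simp: \<psi>'_def shifted_op_def algebra_simps)
  have sym: "L2_inner (?B \<psi>') \<psi> = L2_inner \<psi>' \<psi>'"
  proof -
    have "L2_inner (weighted_op v Q \<psi>') \<psi> = L2_inner \<psi>' (weighted_op v Q \<psi>)"
      using symmetric_op_inner[OF symmetric_op_A0[OF v]] C by (auto simp: A0_eq)
    then show ?thesis
      using L2_inner_lincomb_left[OF weighted_op_L2[OF C(2)] L2(2,1), of 1 "- of_real (\<Lambda> k)"]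
        L2_inner_lincomb_right[OF weighted_op_L2[OF C(1)] L2(1,2), of 1 "- of_real (\<Lambda> k)"]
      unfolding shifted_op_lincomb_form[of v Q "\<Lambda> k" \<psi>, symmetric] \<psi>'_def[symmetric]
        shifted_op_lincomb_form[of v Q "\<Lambda> k" \<psi>', symmetric] by simp
  qed
  have \<eta>L2: "\<eta> \<in> L2" unfolding \<eta> by (intro L2_lincomb L2)
  have "shifted_op v Q (\<Lambda> (Suc k)) \<psi>' = ?B \<eta>"
    unfolding B\<eta> by (auto simp: shifted_op_def d_def algebra_simps)
  then have "L2_inner (shifted_op v Q (\<Lambda> (Suc k)) \<psi>') \<psi>' = L2_inner (?B \<eta>) \<psi>'" by simp
  also have "\<dots> = L2_inner (?B \<eta>) (\<lambda>x. 1 * \<eta> x + of_real d * \<psi> x)"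
    unfolding \<eta> by simp
  also have "\<dots> = L2_inner (?B \<eta>) \<eta> + of_real d * L2_inner (?B \<eta>) \<psi>"
  proof -
    have "?B \<eta> \<in> L2" unfolding B\<eta> by (intro L2_lincomb BL2 C L2)
    from L2_inner_lincomb_right[OF \<eta>L2 L2(1) this, of 1 "of_real d"] show ?thesis by simp
  qed
  also have "L2_inner (?B \<eta>) \<psi> = L2_inner \<psi>' \<psi>' - of_real d * L2_inner \<psi>' \<psi>"
    using L2_inner_lincomb_left[OF BL2[OF C(2)] L2(2) L2(1), of 1 "- of_real d"] sym
    unfolding B\<eta> by simp
  also have "\<dots> = L2_inner \<psi>' \<eta>"
    using L2_inner_lincomb_right[OF L2(2,1) L2(2), of 1 "- of_real d"] unfolding \<eta> by simp
  finally have "Re (L2_inner (shifted_op v Q (\<Lambda> (Suc k)) \<psi>') \<psi>') = Re (L2_inner (?B \<eta>) \<eta>) + d * Re (L2_inner \<psi>' \<eta>)"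
    by simp
  moreover have "d \<ge> 0" using mono[of k] Suc.prems(1) by (simp add: d_def)
  ultimately have "Re (L2_inner (shifted_op v Q (\<Lambda> (Suc k)) \<psi>') \<psi>') \<ge> 0" using IH gap' by simp
  then show ?case by (simp add: \<psi>'_def \<psi>_def)
qed

text \<open>
  The operator is local, so mixed terms vanish.
\<close>
lemma weighted_op_form_orthogonal_sum:
  fixes f :: "nat \<Rightarrow> real \<Rightarrow> complex" and a b :: "nat \<Rightarrow> real"
  assumes v: "C_k (degree Q) v" and f: "\<And>j. f j \<in> C0_k (degree Q)"
    and supp: "\<And>j x. x \<notin> {a j..b j} \<Longrightarrow> f j x = 0"
    and ab: "\<And>j. a j \<le> b j" "\<And>j. b j < a (Suc j)"
  shows "Re (L2_inner (weighted_op v Q (\<lambda>x. \<Sum>j<n. c j * f j x)) (\<lambda>x. \<Sum>j<n. c j * f j x)) =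
    (\<Sum>j<n. (cmod (c j))\<^sup>2 * Re (L2_inner (weighted_op v Q (f j)) (f j)))"
proof -
  have L2: "weighted_op v Q (f j) \<in> L2" "f j \<in> L2" for j
    using C0_k_in_L2[OF weighted_op_C0[OF v f]] C0_k_in_L2[OF f] by auto
  have off: "L2_inner (weighted_op v Q (f j)) (f i) = 0" if "i \<noteq> j" for i j
  proof -
    have zero: "weighted_op v Q (f j) x * cnj (f i x) = 0" for x
    proof (cases "x \<in> {a i..b i}")
      case True
      then have "x \<notin> {a j..b j}"
        using that ordered_intervals(1)[of a b i j, OF ab] ordered_intervals(1)[of a b j i, OF ab]
        by (cases "i < j") auto
      then show ?thesis
        using poly_D_outside[of "a j" "b j" "\<lambda>x. of_real (v x) * f j x" x Q] supp by (simp add: weighted_op_def)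
    qed (simp add: supp)
    show ?thesis unfolding L2_inner_def zero by simp
  qed
  have "L2_inner (weighted_op v Q (\<lambda>x. \<Sum>j<n. c j * f j x)) (\<lambda>x. \<Sum>j<n. c j * f j x) =
      (\<Sum>j<n. c j * (\<Sum>i<n. cnj (c i) * L2_inner (weighted_op v Q (f j)) (f i)))"
    unfolding weighted_op_sum[OF v finite_lessThan f]
    using L2_inner_sum_left[OF finite_lessThan L2(1) L2_sum[OF finite_lessThan L2(2)]]
      L2_inner_sum_right[OF finite_lessThan L2(2) L2(1)] by simp
  also have "\<dots> = (\<Sum>j<n. c j * (\<Sum>i<n. if i = j then cnj (c j) * L2_inner (weighted_op v Q (f j)) (f j) else 0))"
    using off by (intro sum.cong arg_cong2[where f = "(*)"]) auto
  also have "\<dots> = (\<Sum>j<n. of_real ((cmod (c j))\<^sup>2) * L2_inner (weighted_op v Q (f j)) (f j))"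
    by (intro sum.cong) (auto simp: complex_norm_square mult.assoc simp del: of_real_power)
  finally show ?thesis by (simp del: of_real_power)
qed

text \<open>
  If the negative spectrum were \<open>{\<Lambda> 0 < \<dots> < \<Lambda> (m - 1)}\<close>, put \<open>\<Lambda> m = 0\<close>. The form of the operator would then be nonnegative on
  the range of the product of all \<open>B - \<Lambda> k\<close>, \<open>k < m\<close>; but this range contains a nontrivial combination of negative
  wave packets with disjoint supports.
\<close>
lemma infinite_negative_spectrum:
  assumes K: "degree Q \<ge> 1" and v: "C_k (degree Q) v" and vpos: "\<And>x. v x > 0"
    and neg: "poly Q x0 < 0"
  shows "infinite {t::real. t < 0 \<and> complex_of_real t \<in> op_spectrum (A v Q)}" (is "infinite ?S")
proof
  assume fin: "finite ?S"
  define xs where "xs = sorted_list_of_set ?S"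
  define m where "m = length xs"
  \<comment> \<open>The final point \<open>0\<close> closes the list of spectral points, and the last gap is the one below zero.\<close>
  define \<Lambda> where "\<Lambda> k = (if k < m then xs ! k else 0)" for k
  have set_xs: "set xs = ?S" using fin by (simp add: xs_def)
  have sorted: "sorted xs" and strict: "sorted_wrt (<) xs" by (simp_all add: xs_def)
  have \<Lambda>m: "\<Lambda> m = 0" by (simp add: \<Lambda>_def)
  have less: "\<Lambda> k < \<Lambda> (Suc k)" if "k < m" for k
  proof (cases "Suc k < m")
    case True
    then show ?thesis using sorted_wrt_nth_less[OF strict, of k "Suc k"] by (simp add: \<Lambda>_def m_def)
  next
    case False
    have "xs ! k \<in> set xs" using that by (simp add: m_def)
    then show ?thesis using False that set_xs by (simp add: \<Lambda>_def)
  qed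
  have res: "complex_of_real t \<in> op_resolvent_set (A v Q)" if "t < 0" "t \<notin> set xs" for t
    using that unfolding set_xs by (simp add: op_spectrum_def)
  note T = symmetric_op_A[OF v] and graph = weighted_op_in_A[OF v]
  have \<Lambda>_le: "\<Lambda> k \<le> 0" if "k \<le> m" for k
    using less[of k] set_xs nth_mem[of k xs] that by (cases "k < m") (auto simp: \<Lambda>_def m_def less_imp_le)
  have base: "Re (L2_inner (shifted_op v Q (\<Lambda> 0) g) g) \<ge> 0" if g: "g \<in> C0_k (degree Q)" for g
  proof -
    have "Re (L2_inner (weighted_op v Q g) g) \<ge> \<Lambda> 0 * (L2_norm g)\<^sup>2"
    proof (rule lower_bound_form_nonneg[OF T res graph[OF g]])
      fix t assume t: "t < \<Lambda> 0"
      then show "t < 0" using \<Lambda>_le[of 0] by simp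
      show "t \<notin> set xs"
      proof
        assume "t \<in> set xs"
        then obtain j where "j < m" "t = xs ! j" by (auto simp: in_set_conv_nth m_def)
        then show False using t sorted_nth_mono[OF sorted, of 0 j] by (simp add: \<Lambda>_def m_def split: if_splits)
      qed
    qed
    moreover have "L2_inner (shifted_op v Q (\<Lambda> 0) g) g = L2_inner (weighted_op v Q g) g - of_real (\<Lambda> 0) * L2_inner g g"
      unfolding shifted_op_lincomb_form
      using L2_inner_lincomb_left[OF C0_k_in_L2[OF weighted_op_C0[OF v g]] C0_k_in_L2[OF g] C0_k_in_L2[OF g],
          of 1 "- of_real (\<Lambda> 0)"] by simp
    ultimately show ?thesis by (simp add: L2_norm_sq)
  qed
  have gap: "Re (L2_inner (shifted_op v Q (\<Lambda> k) g) (shifted_op v Q (\<Lambda> (Suc k)) g)) \<ge> 0"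
    if k: "k < m" and g: "g \<in> C0_k (degree Q)" for k g
    unfolding shifted_op_def
  proof (rule gap_form_nonneg[OF T less[OF k] res graph[OF g]])
    fix t assume t: "\<Lambda> k < t" "t < \<Lambda> (Suc k)"
    then show "t < 0" using \<Lambda>_le[of "Suc k"] k by simp
    show "t \<notin> set xs"
    proof
      assume "t \<in> set xs"
      then obtain j where j: "j < m" "t = xs ! j" by (auto simp: in_set_conv_nth m_def)
      have "k < j"
      proof (rule ccontr)
        assume "\<not> k < j"
        then show False using t(1) j k sorted_nth_mono[OF sorted, of j k] by (simp add: \<Lambda>_def m_def)
      qed
      then have "Suc k < m" "xs ! Suc k \<le> xs ! j"
        using j sorted_nth_mono[OF sorted, of "Suc k" j] by (auto simp: m_def)
      then show False using t(2) j by (simp add: \<Lambda>_def)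
    qed
  qed
  obtain f :: "nat \<Rightarrow> real \<Rightarrow> complex" and a b where f: "\<And>j. f j \<in> C0_k (degree Q)"
    "\<And>j x. x \<notin> {a j..b j} \<Longrightarrow> f j x = 0" "\<And>j. a j \<le> b j" "\<And>j. b j < a (Suc j)"
    and fneg: "\<And>j. Re (L2_inner (weighted_op v Q (f j)) (f j)) < 0"
    using negative_wave_packets[OF neg v vpos] by blast
  obtain g n c where g: "\<And>k. k \<le> m \<Longrightarrow> shifted_prod v Q \<Lambda> k g \<in> C0_k (degree Q)"
    and c: "\<exists>j<n. c j \<noteq> 0" and sum: "shifted_prod v Q \<Lambda> m g = (\<lambda>x. \<Sum>j<n. c j * f j x)"
    using shifted_prod_range_meets_span[where f = f and a = a and b = b and m = m and \<Lambda> = \<Lambda>, OF K v vpos f] by blast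
  have "0 \<le> Re (L2_inner (shifted_op v Q (\<Lambda> m) (shifted_prod v Q \<Lambda> m g)) (shifted_prod v Q \<Lambda> m g))"
    by (rule shifted_prod_form_nonneg[OF v base gap less_imp_le[OF less] order_refl power_domainI[OF v g]])
  also have "\<dots> = Re (L2_inner (weighted_op v Q (shifted_prod v Q \<Lambda> m g)) (shifted_prod v Q \<Lambda> m g))"
    by (simp add: \<Lambda>m shifted_op_def)
  also have "\<dots> = (\<Sum>j<n. (cmod (c j))\<^sup>2 * Re (L2_inner (weighted_op v Q (f j)) (f j)))"
    unfolding sum by (rule weighted_op_form_orthogonal_sum[where f = f and a = a and b = b, OF v f])
  also have "\<dots> < 0"
  proof -
    obtain j where j: "j < n" "c j \<noteq> 0" using c by blast
    have "(\<Sum>j<n. (cmod (c j))\<^sup>2 * Re (L2_inner (weighted_op v Q (f j)) (f j))) < (\<Sum>j<n. 0)"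
    proof (rule sum_strict_mono_ex1)
      show "\<forall>j\<in>{..<n}. (cmod (c j))\<^sup>2 * Re (L2_inner (weighted_op v Q (f j)) (f j)) \<le> 0"
        by (intro ballI mult_nonneg_nonpos less_imp_le[OF fneg]) simp
      show "\<exists>j\<in>{..<n}. (cmod (c j))\<^sup>2 * Re (L2_inner (weighted_op v Q (f j)) (f j)) < 0"
        using j fneg by (intro bexI[of _ j]) (auto intro!: mult_pos_neg)
    qed simp
    then show ?thesis by simp
  qed
  finally show False by simp
qed

lemma op_positive_A_iff:
  assumes v: "C_k (degree Q) v" and vpos: "\<And>x. v x > 0"
  shows "op_positive (A v Q) \<longleftrightarrow> (\<forall>x. poly Q x \<ge> 0)"
proof
  assume pos: "op_positive (A v Q)"
  show "\<forall>x. poly Q x \<ge> 0"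
  proof (rule ccontr)
    assume "\<not> ?thesis"
    then obtain x0 where "poly Q x0 < 0" by (auto simp: not_le)
    from negative_wave_packets[OF this v vpos] obtain f :: "nat \<Rightarrow> real \<Rightarrow> complex"
      where f: "f 0 \<in> C0_k (degree Q)" and fneg: "Re (L2_inner (weighted_op v Q (f 0)) (f 0)) < 0"
      by blast
    have "(f 0, weighted_op v Q (f 0)) \<in> A v Q" by (rule weighted_op_in_A[OF v f])
    with pos have "L2_inner (weighted_op v Q (f 0)) (f 0) \<in> \<real>\<^sub>\<ge>\<^sub>0" by (auto simp: op_positive_def)
    with fneg show False by (auto simp: complex_nonneg_Reals_iff)
  qed
next
  assume nonneg: "\<forall>x. poly Q x \<ge> 0"
  show "op_positive (A v Q)"
    unfolding A_def
  proof (rule op_positive_closure)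
    show "A0 v Q \<subseteq> L2 \<times> L2" using symmetric_op_A0[OF v] by (simp add: symmetric_op_def)
    fix g h assume "(g, h) \<in> A0 v Q"
    then have g: "g \<in> C0_k (degree Q)" and h: "h = weighted_op v Q g" by (auto simp: A0_eq)
    show "L2_inner h g \<in> \<real>\<^sub>\<ge>\<^sub>0"
      unfolding h L2_inner_weighted_op using nonneg by (intro L2_inner_poly_D_nonneg C0_k_weight v g) auto
  qed
qed

theorem theorem4p3:
  fixes K :: nat and Q :: "real poly" and v :: "real \<Rightarrow> real" and C :: real
  assumes "K \<ge> 2" and "even K"
    and "degree Q = K" and "coeff Q K > 0"
    and "C_k K v"
    and "\<exists>M. AE \<xi> in lborel. \<bar>v \<xi>\<bar> \<le> M"
    and "\<And>\<xi>. v \<xi> > 0"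
    and "\<And>\<xi>. \<bar>deriv v \<xi>\<bar> \<le> C * v \<xi>"
  shows "(op_positive (A v Q) \<longleftrightarrow> (\<forall>x. poly Q x \<ge> 0)) \<and>
         ((\<exists>x0. poly Q x0 < 0) \<longrightarrow>
            infinite {t::real. t < 0 \<and> complex_of_real t \<in> op_spectrum (A v Q)})"
proof -
  have v: "C_k (degree Q) v" and K: "degree Q \<ge> 1" using assms(1,3,5) by auto
  show ?thesis
    using op_positive_A_iff[OF v assms(7)] infinite_negative_spectrum[OF K v assms(7)] by blast
qed

end
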